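(* Assume there exist $m$ real-valued processes $Y^i=(Y^i_t)_{0\le t\le T}$, $i\in\mathcal I=\{1,\dots,m\}$, belonging to $\mathcal S^2$, such that for every $i\in\mathcal I$ and every $t\le T$, $$Y^i_t=\operatorname*{ess\,sup}_{\tau\in\mathcal T_t}E\Big[\int_t^{\tau}\psi_i(s,X_s)\,ds+\max_{j\in\mathcal I^{-i}}\big(-g_{ij}(\tau,X_\tau)+Y^j_\tau\big)\mathbf 1_{[\tau<T]}\,\Big|\,\mathcal F_t\Big],\qquad Y^i_T=0 .$$ Then: (i) $Y^1_0=\sup_{(\delta,\xi)\in\mathcal D}J(\delta,\xi)$. (ii) Define stopping times and modes recursively by $\xi^*_0=1$, $\tau^*_0=0$ and, for $n\ge1$, $$\tau^*_n=\inf\Big\{s\ge\tau^*_{n-1}:\ Y^{\xi^*_{n-1}}_s=\max_{k\in\mathcal I\setminus\{\xi^*_{n-1}\}}\big(-g_{\xi^*_{n-1}k}(s,X_s)+Y^k_s\big)\Big\}\wedge T,$$ and let $\xi^*_n$ be an $\mathcal F_{\tau^*_n}$-measurable index $l\in\mathcal I\setminus\{\xi^*_{n-1}\}$ attaining $\max_{k\in\mathcal I\setminus\{\xi^*_{n-1}\}}\big(-g_{\xi^*_{n-1}k}(\tau^*_n,X_{\tau^*_n})+Y^k_{\tau^*_n}\big)$ (here $Y^{\xi}_s:=\sum_{j}\mathbf 1_{[\xi=j]}Y^j_s$ and $g_{\xi k}:=\sum_j \mathbf 1_{[\xi=j]}g_{jk}$). Then the strategy $(\delta^*,\xi^* )=((\tau^*_n)_{n\ge1},(\xi^*_n)_{n\ge1})$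 is admissible (i.e. belongs to $\mathcal D$), is optimal, i.e. $J(\delta^*,\xi^* )=Y^1_0\ge J(\delta,\xi)$ for all $(\delta,\xi)\in\mathcal D$, and satisfies $$-\infty<E\Big[\sum_{k\ge1}g_{\xi^*_{k-1}\xi^*_k}(\tau^*_k,X_{\tau^*_k})\mathbf 1_{[\tau^*_k<T]}\Big]<+\infty .$$
   Context: Let $T>0$ and let $(\Omega,\mathcal F,P)$ be a probability space carrying a $d$-dimensional Brownian motion $B$; $\mathbf F=(\mathcal F_t)_{t\le T}$ is the $P$-completion of the natural filtration of $B$. $\mathcal S^2$ denotes the set of continuous $\mathbf F$-progressively measurable real processes $w$ with $E[\sup_{t\le T}|w_t|^2]<\infty$, and $\mathcal M^{2}$ the set of progressively measurable real processes with $E\int_0^T|w_s|^2ds<\infty$. For a stopping time $\tau$, $\mathcal T_\tau$ is the set of stopping times $\theta$ with $\tau\le\theta\le T$. $X=(X_t)_{t\le T}$ is a continuous progressively measurable $\mathbb R^k$-valued process. $\mathcal I=\{1,\dots,m\}$, $\mathcal I^{-i}=\mathcal I\setminus\{i\}$. The functions $\psi_i,g_{ij}:[0,T]\times\mathbb R^k\to\mathbb R$ ($i,j\in\mathcal I$) are continuous with $|\psi_i(t,x)|+|g_{ij}(t,x)|\le C(1+|x|^\gamma)$ for some constants $C,\gamma>0$; the processes $(\psi_i(t,X_t))_t$ belong to $\mathcal M^2$ and $(g_{ij}(t,X_t))_t$ to $\mathcal S^2$. The switching costs may be negative, and satisfy: $g_{ii}=0$, $g_{ij}+g_{ji}>0$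 for $i\ne j$, and for all $(t,x)$ and every loop of indices $i_1,\dots,i_k$ with $i_1=i_k$, $g_{i_1i_2}(t,x)+\dots+g_{i_{k-1}i_k}(t,x)+g_{i_ki_1}(t,x)>0$; if $g_{ij}$ is non-positive then $g_{ij}(T,X_T)=0$; and there is a constant $K>0$ with $\mathrm{Card}\{g_{ij}(t,x)<0: j\in\mathcal I^{-i},(t,x)\in[0,T]\times\mathbb R^k\}\le K$ (the negative switching costs are limited). An admissible strategy is a pair $(\delta,\xi)=((\tau_n)_{n\ge1},(\xi_n)_{n\ge1})$ where $(\tau_n)$ is a nondecreasing sequence of $\mathbf F$-stopping times with values in $[0,T]$, $\tau_0=0$, each $\xi_n$ is an $\mathcal F_{\tau_n}$-measurable $\mathcal I$-valued random variable (the mode switched to at $\tau_n$), $\xi_0=1$, and $P[\tau_n<T\ \forall n\ge0]=0$; the set of admissible strategies is $\mathcal D$. The associated mode indicator is $u_t=\mathbf 1_{[0,\tau_1]}(t)+\sum_{n\ge1}\xi_n\mathbf 1_{(\tau_n,\tau_{n+1}]}(t)$, and the expected total profit is $$J(\delta,\xi)=E\Big[\int_0^T\psi_{u_s}(s,X_s)ds-\sum_{n\ge1}g_{\xi_{n-1}\xi_n}(\tau_n,X_{\tau_n})\mathbf 1_{[\tau_n<T]}\Big].$$ *)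

theory Defs
  imports "HOL-Probability.Probability"
begin

definition brownian_motion :: "'a measure \<Rightarrow> real \<Rightarrow> (real \<Rightarrow> 'a \<Rightarrow> real^'d) \<Rightarrow> bool" where
  "brownian_motion M T B \<longleftrightarrow> prob_space M \<and>
     (\<forall>t\<in>{0..T}. B t \<in> borel_measurable M) \<and>
     (\<forall>\<omega>\<in>space M. B 0 \<omega> = 0 \<and> continuous_on {0..T} (\<lambda>t. B t \<omega>)) \<and>
     (\<forall>(n::nat) (ts::nat \<Rightarrow> real). (\<forall>i\<le>n. 0 \<le> ts i \<and> ts i \<le> T) \<and> (\<forall>i<n. ts i \<le> ts (Suc i)) \<longrightarrow>
        prob_space.indep_vars M (\<lambda>_. borel) (\<lambda>i \<omega>. B (ts (Suc i)) \<omega> - B (ts i) \<omega>) {..<n}) \<and>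
     (\<forall>s t. 0 \<le> s \<and> s < t \<and> t \<le> T \<longrightarrow>
        prob_space.indep_vars M (\<lambda>_. borel) (\<lambda>j \<omega>. (B t \<omega> - B s \<omega>) $ j) UNIV \<and>
        (\<forall>j. distributed M lborel (\<lambda>\<omega>. (B t \<omega> - B s \<omega>) $ j)
                (\<lambda>x. ennreal (normal_density 0 (sqrt (t - s)) x))))"

definition brownian_filtration :: "'a measure \<Rightarrow> real \<Rightarrow> (real \<Rightarrow> 'a \<Rightarrow> real^'d) \<Rightarrow> real \<Rightarrow> 'a measure" where
  "brownian_filtration M T B t = sigma (space M)
     ((\<Union>s\<in>{0..min t T}. {B s -` A \<inter> space M | A. A \<in> sets borel}) \<union> null_sets M)"

definition progressive :: "(real \<Rightarrow> 'a measure) \<Rightarrow> real \<Rightarrow> (real \<Rightarrow> 'a \<Rightarrow> 'b::topological_space) \<Rightarrow> bool" where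
  "progressive F T w \<longleftrightarrow>
     (\<forall>t\<in>{0..T}. (\<lambda>(s,\<omega>). w s \<omega>) \<in> borel_measurable (restrict_space borel {0..t} \<Otimes>\<^sub>M F t))"

definition S2 :: "'a measure \<Rightarrow> (real \<Rightarrow> 'a measure) \<Rightarrow> real \<Rightarrow> (real \<Rightarrow> 'a \<Rightarrow> real) \<Rightarrow> bool" where
  "S2 M F T w \<longleftrightarrow> (\<forall>\<omega>\<in>space M. continuous_on {0..T} (\<lambda>t. w t \<omega>)) \<and> progressive F T w \<and>
     integrable M (\<lambda>\<omega>. (Sup ((\<lambda>t. \<bar>w t \<omega>\<bar>) ` {0..T}))\<^sup>2)"

definition M2 :: "'a measure \<Rightarrow> (real \<Rightarrow> 'a measure) \<Rightarrow> real \<Rightarrow> (real \<Rightarrow> 'a \<Rightarrow> real) \<Rightarrow> bool" where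
  "M2 M F T w \<longleftrightarrow> progressive F T w \<and>
     (\<integral>\<^sup>+\<omega>. (\<integral>\<^sup>+s\<in>{0..T}. ennreal ((w s \<omega>)\<^sup>2) \<partial>lborel) \<partial>M) < \<infinity>"

definition stopping_times_from :: "'a measure \<Rightarrow> (real \<Rightarrow> 'a measure) \<Rightarrow> real \<Rightarrow> ('a \<Rightarrow> real) \<Rightarrow> ('a \<Rightarrow> real) set" where
  "stopping_times_from M F T \<tau> = {\<theta>. stopping_time F \<theta> \<and> (\<forall>\<omega>\<in>space M. \<tau> \<omega> \<le> \<theta> \<omega> \<and> \<theta> \<omega> \<le> T)}"

definition is_ess_sup :: "'a measure \<Rightarrow> ('a \<Rightarrow> real) set \<Rightarrow> ('a \<Rightarrow> real) \<Rightarrow> bool" where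
  "is_ess_sup M S Z \<longleftrightarrow> Z \<in> borel_measurable M \<and> (\<forall>f\<in>S. AE \<omega> in M. f \<omega> \<le> Z \<omega>) \<and>
     (\<forall>Z'\<in>borel_measurable M. (\<forall>f\<in>S. AE \<omega> in M. f \<omega> \<le> Z' \<omega>) \<longrightarrow> (AE \<omega> in M. Z \<omega> \<le> Z' \<omega>))"

definition admissible :: "'a measure \<Rightarrow> (real \<Rightarrow> 'a measure) \<Rightarrow> real \<Rightarrow> nat \<Rightarrow>
    (nat \<Rightarrow> 'a \<Rightarrow> real) \<Rightarrow> (nat \<Rightarrow> 'a \<Rightarrow> nat) \<Rightarrow> bool" where
  "admissible M F T m \<tau> \<xi> \<longleftrightarrow>
     (\<forall>\<omega>\<in>space M. \<tau> 0 \<omega> = 0 \<and> \<xi> 0 \<omega> = 1 \<and> (\<forall>n. \<tau> n \<omega> \<le> \<tau> (Suc n) \<omega>) \<and>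
        (\<forall>n. 0 \<le> \<tau> n \<omega> \<and> \<tau> n \<omega> \<le> T)) \<and>
     (\<forall>n. stopping_time F (\<tau> n)) \<and>
     (\<forall>n. \<xi> n \<in> measurable (filtration.pre_sigma (space M) F (\<tau> n)) (count_space {1..m})) \<and>
     emeasure M {\<omega>\<in>space M. \<forall>n. \<tau> n \<omega> < T} = 0"

definition strategies :: "'a measure \<Rightarrow> (real \<Rightarrow> 'a measure) \<Rightarrow> real \<Rightarrow> nat \<Rightarrow>
    ((nat \<Rightarrow> 'a \<Rightarrow> real) \<times> (nat \<Rightarrow> 'a \<Rightarrow> nat)) set" where
  "strategies M F T m = {(\<tau>, \<xi>). admissible M F T m \<tau> \<xi>}"

definition mode_indicator :: "(nat \<Rightarrow> 'a \<Rightarrow> real) \<Rightarrow> (nat \<Rightarrow> 'a \<Rightarrow> nat) \<Rightarrow> real \<Rightarrow> 'a \<Rightarrow> nat" where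
  "mode_indicator \<tau> \<xi> s \<omega> = (if s \<le> \<tau> 1 \<omega> then 1 else 0) +
     (\<Sum>n\<in>{n. \<tau> (Suc n) \<omega> < s \<and> s \<le> \<tau> (Suc (Suc n)) \<omega>}. \<xi> (Suc n) \<omega>)"

definition switching_cost :: "real \<Rightarrow> (real \<Rightarrow> 'a \<Rightarrow> 'x) \<Rightarrow> (nat \<Rightarrow> nat \<Rightarrow> real \<Rightarrow> 'x \<Rightarrow> real) \<Rightarrow>
    (nat \<Rightarrow> 'a \<Rightarrow> real) \<Rightarrow> (nat \<Rightarrow> 'a \<Rightarrow> nat) \<Rightarrow> 'a \<Rightarrow> real" where
  "switching_cost T X g \<tau> \<xi> \<omega> =
     (\<Sum>n. if \<tau> (Suc n) \<omega> < T then g (\<xi> n \<omega>) (\<xi> (Suc n) \<omega>) (\<tau> (Suc n) \<omega>) (X (\<tau> (Suc n) \<omega>) \<omega>) else 0)"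

definition switching_payoff :: "real \<Rightarrow> (real \<Rightarrow> 'a \<Rightarrow> 'x) \<Rightarrow> (nat \<Rightarrow> real \<Rightarrow> 'x \<Rightarrow> real) \<Rightarrow>
    (nat \<Rightarrow> nat \<Rightarrow> real \<Rightarrow> 'x \<Rightarrow> real) \<Rightarrow> (nat \<Rightarrow> 'a \<Rightarrow> real) \<Rightarrow> (nat \<Rightarrow> 'a \<Rightarrow> nat) \<Rightarrow> 'a \<Rightarrow> real" where
  "switching_payoff T X \<psi> g \<tau> \<xi> \<omega> =
     integral {0..T} (\<lambda>s. \<psi> (mode_indicator \<tau> \<xi> s \<omega>) s (X s \<omega>)) - switching_cost T X g \<tau> \<xi> \<omega>"

text \<open>Extended-real expectation E[Z] = E[Z^+] - E[Z^-]; when both parts are infinite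
  (expectation undefined) we use the convention -infinity.\<close>
definition ext_expectation :: "'a measure \<Rightarrow> ('a \<Rightarrow> real) \<Rightarrow> ereal" where
  "ext_expectation M Z =
     (let p = (\<integral>\<^sup>+\<omega>. ennreal (Z \<omega>) \<partial>M); q = (\<integral>\<^sup>+\<omega>. ennreal (- Z \<omega>) \<partial>M)
      in if p = \<infinity> \<and> q = \<infinity> then - \<infinity> else enn2ereal p - enn2ereal q)"

definition J :: "'a measure \<Rightarrow> real \<Rightarrow> (real \<Rightarrow> 'a \<Rightarrow> 'x) \<Rightarrow> (nat \<Rightarrow> real \<Rightarrow> 'x \<Rightarrow> real) \<Rightarrow>
    (nat \<Rightarrow> nat \<Rightarrow> real \<Rightarrow> 'x \<Rightarrow> real) \<Rightarrow> (nat \<Rightarrow> 'a \<Rightarrow> real) \<Rightarrow> (nat \<Rightarrow> 'a \<Rightarrow> nat) \<Rightarrow> ereal" where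
  "J M T X \<psi> g \<tau> \<xi> = ext_expectation M (switching_payoff T X \<psi> g \<tau> \<xi>)"

end

theory Submission
  imports Defs
begin

text \<open>Let \<open>V i t\<close> be \<open>Y i t\<close> plus the running profit of mode \<open>i\<close> over \<open>[0, t]\<close>. The Snell envelope equation makes each \<open>V i\<close> a continuous
  supermartingale dominated by a square integrable variable, and a martingale from any stopping
  time until \<open>Y i\<close> next meets its obstacle. For an arbitrary strategy, the payoff is
  \<open>Y 1 0\<close>, plus the sum over the switching intervals of the increments of \<open>V\<close> for the active mode,
  minus nonnegative terms that vanish for the proposed strategy. Switching costs of either sign
  leave no one-sided bound on the partial sums of these increments, so their limit is controlled
  in \<open>L\<^sup>2\<close>: the Doob decomposition of the sampled supermartingale
  bounds every transform of it in \<open>L\<^sup>2\<close> by the square of the dominating variable, independently of the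
  number of switches. The expectation of the limit is therefore nonpositive, and zero in the
  martingale case.\<close>

section \<open>Square integrable functions and supermartingale transforms\<close>

text \<open>The Snell equation is available only at deterministic times and only almost surely,
  whereas switching happens at stopping times. Hence statements about the past are phrased as
  integrals over past events rather than through versions of conditional expectations; they are
  proved at fixed times and carried to stopping times by rounding these up to finite grids.
  Continuity of the paths and one square integrable bound for the whole path justify the limits.

  The value of the active mode jumps at a switch, so no single supermartingale follows a strategy.
  The increments are therefore sorted by mode: for a fixed mode i, the intervals spent in i give a
  transform of \<open>V i\<close> whose 0/1 weights are known at the start of each interval.

  The loop condition has a separate task: it keeps the switches of the proposed strategy from
  accumulating before T. The value at time zero is at first a random variable; it becomes a number
  because events known at time zero have probability 0 or 1.\<close>

definition square_integrable :: "'a measure \<Rightarrow> ('a \<Rightarrow> real) \<Rightarrow> bool" where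
  "square_integrable M f \<longleftrightarrow> f \<in> borel_measurable M \<and> integrable M (\<lambda>\<omega>. (f \<omega>)\<^sup>2)"

lemma square_integrableD:
  assumes "square_integrable M f"
  shows "f \<in> borel_measurable M" "integrable M (\<lambda>\<omega>. (f \<omega>)\<^sup>2)"
  using assms by (auto simp: square_integrable_def)

lemma square_integrable_bound:
  assumes "square_integrable M g" "f \<in> borel_measurable M" "AE \<omega> in M. \<bar>f \<omega>\<bar> \<le> \<bar>g \<omega>\<bar>"
  shows "square_integrable M f"
  unfolding square_integrable_def
proof
  show "f \<in> borel_measurable M" by fact
  show "integrable M (\<lambda>\<omega>. (f \<omega>)\<^sup>2)"
    by (rule Bochner_Integration.integrable_bound[where f="\<lambda>\<omega>. (g \<omega>)\<^sup>2"])
      (use assms in \<open>auto simp: square_integrable_def abs_le_square_iff\<close>)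
qed

lemma square_integrable_add:
  assumes "square_integrable M f" "square_integrable M g"
  shows "square_integrable M (\<lambda>\<omega>. f \<omega> + g \<omega>)"
  unfolding square_integrable_def
proof
  note [measurable] = square_integrableD(1)[OF assms(1)] square_integrableD(1)[OF assms(2)]
  show "(\<lambda>\<omega>. f \<omega> + g \<omega>) \<in> borel_measurable M" by simp
  have *: "(a + b)\<^sup>2 \<le> \<bar>2 * a\<^sup>2 + 2 * b\<^sup>2\<bar>" for a b :: real
  proof -
    have "0 \<le> (a - b)\<^sup>2" by simp
    then show ?thesis by (simp add: power2_eq_square algebra_simps)
  qed
  show "integrable M (\<lambda>\<omega>. (f \<omega> + g \<omega>)\<^sup>2)"
    by (rule Bochner_Integration.integrable_bound[where f="\<lambda>\<omega>. 2 * (f \<omega>)\<^sup>2 + 2 * (g \<omega>)\<^sup>2"])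
      (use assms * in \<open>auto simp: square_integrable_def\<close>)
qed

lemma square_integrable_uminus:
  "square_integrable M f \<Longrightarrow> square_integrable M (\<lambda>\<omega>. - f \<omega>)"
  by (simp add: square_integrable_def)

lemma square_integrable_diff:
  assumes "square_integrable M f" "square_integrable M g"
  shows "square_integrable M (\<lambda>\<omega>. f \<omega> - g \<omega>)"
  using square_integrable_add[OF assms(1) square_integrable_uminus[OF assms(2)]] by simp

lemma square_integrable_zero: "square_integrable M (\<lambda>\<omega>. 0)"
  by (simp add: square_integrable_def)

lemma square_integrable_sum:
  "(\<And>i. i \<in> I \<Longrightarrow> square_integrable M (f i)) \<Longrightarrow> square_integrable M (\<lambda>\<omega>. \<Sum>i\<in>I. f i \<omega>)"
  by (induction I rule: infinite_finite_induct)
    (auto intro: square_integrable_add square_integrable_zero)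

lemma square_integrable_abs:
  "square_integrable M f \<Longrightarrow> square_integrable M (\<lambda>\<omega>. \<bar>f \<omega>\<bar>)"
  by (auto simp: square_integrable_def)

lemma square_integrable_indicator_mult:
  assumes "square_integrable M f" "A \<in> sets M"
  shows "square_integrable M (\<lambda>\<omega>. indicator A \<omega> * f \<omega>)"
proof (rule square_integrable_bound[OF assms(1)])
  note [measurable] = square_integrableD(1)[OF assms(1)] assms(2)
  show "(\<lambda>\<omega>. indicator A \<omega> * f \<omega>) \<in> borel_measurable M" by measurable
qed (auto simp: indicator_def)

lemma square_integrable_mult_integrable:
  assumes "square_integrable M f" "square_integrable M g"
  shows "integrable M (\<lambda>\<omega>. f \<omega> * g \<omega>)"
proof (rule Bochner_Integration.integrable_bound[where f="\<lambda>\<omega>. (f \<omega>)\<^sup>2 + (g \<omega>)\<^sup>2"])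
  note [measurable] = square_integrableD(1)[OF assms(1)] square_integrableD(1)[OF assms(2)]
  show "(\<lambda>\<omega>. f \<omega> * g \<omega>) \<in> borel_measurable M" by simp
  have "\<bar>a * b\<bar> \<le> \<bar>a\<^sup>2 + b\<^sup>2\<bar>" for a b :: real
  proof -
    have "0 \<le> (\<bar>a\<bar> - \<bar>b\<bar>)\<^sup>2" by simp
    moreover have "(\<bar>a\<bar> - \<bar>b\<bar>)\<^sup>2 = a\<^sup>2 + b\<^sup>2 - 2 * \<bar>a * b\<bar>"
      by (simp add: power2_diff abs_mult)
    ultimately show ?thesis by linarith
  qed
  then show "AE \<omega> in M. norm (f \<omega> * g \<omega>) \<le> norm ((f \<omega>)\<^sup>2 + (g \<omega>)\<^sup>2)" by simp
qed (use assms in \<open>auto simp: square_integrable_def\<close>)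

lemma (in finite_measure) square_integrable_integrable:
  assumes "square_integrable M f"
  shows "integrable M f"
  using square_integrable_mult_integrable[OF assms, of "\<lambda>_. 1"]
  by (simp add: square_integrable_def)

lemma (in finite_measure) square_integrable_cond_exp:
  assumes "subalgebra M G" "square_integrable M f"
  shows "square_integrable M (real_cond_exp M G f)"
proof -
  interpret finite_measure_subalgebra M G
    by (simp add: finite_measure_subalgebra_def finite_measure_axioms
        finite_measure_subalgebra_axioms_def assms(1))
  have "integrable M (\<lambda>x. (real_cond_exp M G f x)\<^sup>2)"
    by (rule integrable_convex_cond_exp[where q="\<lambda>x. x\<^sup>2" and I=UNIV])
      (use assms(2) in \<open>auto simp: square_integrable_def intro: square_integrable_integrable convex_power2\<close>)
  then show ?thesis by (simp add: square_integrable_def)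
qed

text \<open>In the Doob decomposition the compensator \<open>\<Sum>k<n. a k\<close> has second moment at most \<open>16 c\<close>, where
  \<open>c\<close> is the second moment of \<open>U\<close>, since \<open>a k\<close> integrates the remaining compensator to
  \<open>V k - V n\<close>; the constant is \<open>112 = 2 \<sqdot> (8 + 2 \<sqdot> 16) + 2 \<sqdot> 16\<close>.\<close>
lemma (in prob_space) supermartingale_transform_L2_bound:
  fixes G :: "nat \<Rightarrow> 'a measure" and V :: "nat \<Rightarrow> 'a \<Rightarrow> real" and A :: "nat \<Rightarrow> 'a set"
  assumes sub: "\<And>k. subalgebra M (G k)"
    and mono: "\<And>k. sets (G k) \<subseteq> sets (G (Suc k))"
    and adapted: "\<And>k. V k \<in> borel_measurable (G k)"
    and U: "square_integrable M U"
    and dom: "\<And>k \<omega>. \<omega> \<in> space M \<Longrightarrow> \<bar>V k \<omega>\<bar> \<le> U \<omega>"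
    and super: "\<And>k B. B \<in> sets (G k) \<Longrightarrow>
      (\<integral>\<omega>. indicator B \<omega> * V (Suc k) \<omega> \<partial>M) \<le> (\<integral>\<omega>. indicator B \<omega> * V k \<omega> \<partial>M)"
    and A: "\<And>k. A k \<in> sets (G k)"
  shows "square_integrable M (\<lambda>\<omega>. \<Sum>k<n. indicator (A k) \<omega> * (V (Suc k) \<omega> - V k \<omega>))" (is ?th1)
    and "(\<integral>\<omega>. (\<Sum>k<n. indicator (A k) \<omega> * (V (Suc k) \<omega> - V k \<omega>))\<^sup>2 \<partial>M) \<le> 112 * (\<integral>\<omega>. (U \<omega>)\<^sup>2 \<partial>M)" (is ?th2)
proof -
  note sqi = square_integrable_add square_integrable_diff square_integrable_sum square_integrable_indicator_mult
  have fms: "finite_measure_subalgebra M (G k)" for k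
    by (simp add: finite_measure_subalgebra_def finite_measure_axioms
        finite_measure_subalgebra_axioms_def sub)
  have mono': "sets (G k) \<subseteq> sets (G l)" if "k \<le> l" for k l
    using lift_Suc_mono_le[of "\<lambda>k. sets (G k)", OF mono that] .
  have space_G: "space (G k) = space M" for k
    using sub[of k] by (simp add: subalgebra_def)
  have subset_G: "sets (G k) \<subseteq> sets M" for k
    using sub[of k] by (simp add: subalgebra_def)
  have measG: "f \<in> borel_measurable (G l)" if "f \<in> borel_measurable (G k)" "k \<le> l" for f :: "'a \<Rightarrow> real" and k l
    using that mono'[OF that(2)] by (auto simp: measurable_def space_G)
  have measM: "f \<in> borel_measurable M" if "f \<in> borel_measurable (G k)" for f :: "'a \<Rightarrow> real" and k
    using that subset_G[of k] by (auto simp: measurable_def space_G)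
  have AM: "A k \<in> sets M" for k using A subset_G by blast
  have U_nonneg: "0 \<le> U \<omega>" if "\<omega> \<in> space M" for \<omega> using dom[OF that, of 0] by simp
  have V_sq: "square_integrable M (V k)" for k
    by (rule square_integrable_bound[OF U measM[OF adapted]])
      (use dom U_nonneg in \<open>auto intro!: AE_I2\<close>)
  define a where "a k = (\<lambda>\<omega>. V k \<omega> - real_cond_exp M (G k) (V (Suc k)) \<omega>)" for k
  have a_meas: "a k \<in> borel_measurable (G k)" for k
    unfolding a_def using adapted[of k] by measurable
  have a_sq: "square_integrable M (a k)" for k
    unfolding a_def
    by (intro square_integrable_diff V_sq square_integrable_cond_exp sub)
  have a_int: "(\<integral>\<omega>. f \<omega> * a k \<omega> \<partial>M) = (\<integral>\<omega>. f \<omega> * (V k \<omega> - V (Suc k) \<omega>) \<partial>M)"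
    if f: "f \<in> borel_measurable (G k)" "square_integrable M f" for f k
  proof -
    interpret finite_measure_subalgebra M "G k" by (rule fms)
    have i1: "integrable M (\<lambda>\<omega>. f \<omega> * V (Suc k) \<omega>)" "integrable M (\<lambda>\<omega>. f \<omega> * V k \<omega>)"
      using square_integrable_mult_integrable[OF f(2) V_sq] by auto
    have "(\<integral>\<omega>. f \<omega> * real_cond_exp M (G k) (V (Suc k)) \<omega> \<partial>M) = (\<integral>\<omega>. f \<omega> * V (Suc k) \<omega> \<partial>M)"
      and i2: "integrable M (\<lambda>\<omega>. f \<omega> * real_cond_exp M (G k) (V (Suc k)) \<omega>)"
      using real_cond_exp_intg[OF i1(1) f(1)] square_integrableD(1)[OF V_sq] by auto
    then show ?thesis
      unfolding a_def by (simp add: right_diff_distrib i1)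
  qed
  have a_nonneg: "AE \<omega> in M. 0 \<le> a k \<omega>" for k
  proof -
    \<comment> \<open>The supermartingale hypothesis speaks only of integrals over events, so it is
      tested on the event where the compensator increment is negative. There the integral is
      nonnegative by hypothesis and nonpositive by sign, hence zero.\<close>
    define B where "B = {\<omega>\<in>space (G k). a k \<omega> < 0}"
    have B: "B \<in> sets (G k)" unfolding B_def using a_meas[of k] by measurable
    then have BM: "B \<in> sets M" using subset_G by blast
    have i: "integrable M (\<lambda>\<omega>. indicator B \<omega> * a k \<omega>)" "integrable M (\<lambda>\<omega>. indicator B \<omega> * V k \<omega>)"
       "integrable M (\<lambda>\<omega>. indicator B \<omega> * V (Suc k) \<omega>)"
      using V_sq a_sq BM by (auto intro!: square_integrable_integrable square_integrable_indicator_mult)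
    have "square_integrable M (\<lambda>\<omega>. indicator B \<omega> :: real)"
      using square_integrable_indicator_mult[of M "\<lambda>_. 1", OF _ BM]
      by (simp add: square_integrable_def)
    then have "(\<integral>\<omega>. indicator B \<omega> * a k \<omega> \<partial>M) = (\<integral>\<omega>. indicator B \<omega> * (V k \<omega> - V (Suc k) \<omega>) \<partial>M)"
      using B by (intro a_int) auto
    also have "\<dots> = (\<integral>\<omega>. indicator B \<omega> * V k \<omega> \<partial>M) - (\<integral>\<omega>. indicator B \<omega> * V (Suc k) \<omega> \<partial>M)"
      using i by (simp add: right_diff_distrib)
    finally have "(\<integral>\<omega>. - (indicator B \<omega> * a k \<omega>) \<partial>M) \<le> 0"
      using super[OF B] i by simp
    moreover have nn: "AE \<omega> in M. 0 \<le> - (indicator B \<omega> * a k \<omega>)"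
      by (auto simp: B_def indicator_def)
    ultimately have "(\<integral>\<omega>. - (indicator B \<omega> * a k \<omega>) \<partial>M) = 0"
      using integral_nonneg_AE[OF nn] by linarith
    then have "AE \<omega> in M. - (indicator B \<omega> * a k \<omega>) = 0"
      using integral_nonneg_eq_0_iff_AE[OF _ nn] i by auto
    with AE_space show ?thesis
      by eventually_elim (auto simp: B_def indicator_def space_G not_less split: if_splits)
  qed
  define c where "c = (\<integral>\<omega>. (U \<omega>)\<^sup>2 \<partial>M)"
  have sum_a_sq: "square_integrable M (\<lambda>\<omega>. \<Sum>k<n. a k \<omega>)" for n
    by (intro square_integrable_sum a_sq)
  have compens: "(\<integral>\<omega>. (\<Sum>k<n. a k \<omega>)\<^sup>2 \<partial>M) \<le> 16 * c" for n
  proof -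
    \<comment> \<open>Twice the sum over all pairs k \<le> l, diagonal included, is the square of
      the sum plus the sum of the squares.\<close>
    have pw: "(\<Sum>k<n. b k)\<^sup>2 \<le> 2 * (\<Sum>k<n. b k * (\<Sum>l\<in>{k..<n}. b l))" for b :: "nat \<Rightarrow> real" and n
    proof (induction n)
      case (Suc n)
      have "(\<Sum>k<Suc n. b k * (\<Sum>l\<in>{k..<Suc n}. b l)) = (\<Sum>k<n. b k * (\<Sum>l\<in>{k..<n}. b l) + b k * b n) + b n * b n"
        by (simp add: distrib_left)
      also have "\<dots> = (\<Sum>k<n. b k * (\<Sum>l\<in>{k..<n}. b l)) + (\<Sum>k<n. b k) * b n + b n * b n"
        by (simp add: sum.distrib sum_distrib_right)
      finally have e: "(\<Sum>k<Suc n. b k * (\<Sum>l\<in>{k..<Suc n}. b l)) = \<dots>" .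
      have "(\<Sum>k<Suc n. b k)\<^sup>2 = (\<Sum>k<n. b k)\<^sup>2 + 2 * ((\<Sum>k<n. b k) * b n) + b n * b n"
        by (simp add: power2_eq_square algebra_simps)
      moreover have "0 \<le> b n * b n" by simp
      ultimately show ?case using Suc unfolding e distrib_left by linarith
    qed simp
    have tele: "(\<Sum>l\<in>{k..<n}. V l \<omega> - V (Suc l) \<omega>) = V k \<omega> - V n \<omega>" if "k \<le> n" for k \<omega>
      using sum_Suc_diff'[OF that, of "\<lambda>l. - V l \<omega>"] by simp
    \<comment> \<open>The weight \<open>a k\<close> is known at every later index, so
      \<open>a_int\<close> replaces each later compensator increment by a decrease of
      \<open>V\<close>; the tail then telescopes and is at most twice \<open>U\<close>.\<close>
    have step: "(\<integral>\<omega>. a k \<omega> * (\<Sum>l\<in>{k..<n}. a l \<omega>) \<partial>M) \<le> 2 * (\<integral>\<omega>. a k \<omega> * U \<omega> \<partial>M)" if "k < n" for k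
    proof -
      have "(\<integral>\<omega>. a k \<omega> * (\<Sum>l\<in>{k..<n}. a l \<omega>) \<partial>M) = (\<Sum>l\<in>{k..<n}. \<integral>\<omega>. a k \<omega> * a l \<omega> \<partial>M)"
        by (simp add: sum_distrib_left square_integrable_mult_integrable a_sq)
      also have "\<dots> = (\<Sum>l\<in>{k..<n}. \<integral>\<omega>. a k \<omega> * (V l \<omega> - V (Suc l) \<omega>) \<partial>M)"
        by (intro sum.cong refl a_int a_sq measG[OF a_meas]) auto
      also have "\<dots> = (\<integral>\<omega>. a k \<omega> * (\<Sum>l\<in>{k..<n}. V l \<omega> - V (Suc l) \<omega>) \<partial>M)"
        unfolding sum_distrib_left
        by (subst Bochner_Integration.integral_sum)
          (auto intro!: square_integrable_mult_integrable a_sq sqi V_sq)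
      also have "\<dots> = (\<integral>\<omega>. a k \<omega> * (V k \<omega> - V n \<omega>) \<partial>M)"
        using that by (simp add: tele)
      also have "\<dots> \<le> (\<integral>\<omega>. 2 * (a k \<omega> * U \<omega>) \<partial>M)"
      proof (rule integral_mono_AE)
        show "AE \<omega> in M. a k \<omega> * (V k \<omega> - V n \<omega>) \<le> 2 * (a k \<omega> * U \<omega>)"
          using a_nonneg[of k] AE_space
        proof eventually_elim
          case (elim \<omega>)
          then have "V k \<omega> - V n \<omega> \<le> 2 * U \<omega>" using dom[of \<omega> k] dom[of \<omega> n] by auto
          with elim have "a k \<omega> * (V k \<omega> - V n \<omega>) \<le> a k \<omega> * (2 * U \<omega>)" by (intro mult_left_mono)
          then show ?case by simp
        qed
      qed (auto intro!: square_integrable_mult_integrable a_sq sqi V_sq U)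
      finally show ?thesis by simp
    qed
    have "(\<integral>\<omega>. (\<Sum>k<n. a k \<omega>)\<^sup>2 \<partial>M) \<le> (\<integral>\<omega>. 2 * (\<Sum>k<n. a k \<omega> * (\<Sum>l\<in>{k..<n}. a l \<omega>)) \<partial>M)"
      by (intro integral_mono pw square_integrableD(2)[OF sum_a_sq] integrable_mult_right
          Bochner_Integration.integrable_sum square_integrable_mult_integrable a_sq sqi) 
    also have "\<dots> = 2 * (\<Sum>k<n. \<integral>\<omega>. a k \<omega> * (\<Sum>l\<in>{k..<n}. a l \<omega>) \<partial>M)"
      by (simp add: square_integrable_mult_integrable a_sq sqi)
    also have "\<dots> \<le> 2 * (\<Sum>k<n. 2 * (\<integral>\<omega>. a k \<omega> * U \<omega> \<partial>M))"
      by (intro mult_left_mono sum_mono step) auto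
    also have "\<dots> = (\<integral>\<omega>. 4 * (\<Sum>k<n. a k \<omega>) * U \<omega> \<partial>M)"
      by (simp add: sum_distrib_left sum_distrib_right mult.assoc square_integrable_mult_integrable a_sq U)
    \<comment> \<open>Young's inequality in the form 4 x y \<le> x^2 / 2 + 8 y^2. Half of the second
      moment, which is finite, reappears on the right and is absorbed on the left; this doubles 8 c
      to 16 c.\<close>
    also have "\<dots> \<le> (\<integral>\<omega>. (\<Sum>k<n. a k \<omega>)\<^sup>2 / 2 + 8 * (U \<omega>)\<^sup>2 \<partial>M)"
    proof (rule integral_mono)
      fix \<omega>
      have "0 \<le> ((\<Sum>k<n. a k \<omega>) - 4 * U \<omega>)\<^sup>2" by simp
      then show "4 * (\<Sum>k<n. a k \<omega>) * U \<omega> \<le> (\<Sum>k<n. a k \<omega>)\<^sup>2 / 2 + 8 * (U \<omega>)\<^sup>2"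
        unfolding power2_diff by (simp add: power_mult_distrib)
    next
      show "integrable M (\<lambda>\<omega>. 4 * (\<Sum>k<n. a k \<omega>) * U \<omega>)"
        using square_integrable_mult_integrable[OF sum_a_sq U] by (simp add: mult.assoc)
    qed (use sum_a_sq[of n] U in \<open>auto simp: square_integrable_def\<close>)
    also have "\<dots> = (\<integral>\<omega>. (\<Sum>k<n. a k \<omega>)\<^sup>2 \<partial>M) / 2 + 8 * c"
      using sum_a_sq[of n] U by (simp add: square_integrable_def c_def)
    finally show ?thesis by simp
  qed
  define d where "d k = (\<lambda>\<omega>. V (Suc k) \<omega> - V k \<omega> + a k \<omega>)" for k
  have d_sq: "square_integrable M (d k)" for k
    unfolding d_def by (intro sqi V_sq a_sq)
  have d_meas: "d k \<in> borel_measurable (G (Suc k))" for k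
    unfolding d_def using adapted[of "Suc k"] measG[OF adapted[of k], of "Suc k"] measG[OF a_meas[of k], of "Suc k"]
    by simp
  have d_int: "(\<integral>\<omega>. f \<omega> * d k \<omega> \<partial>M) = 0"
    if f: "f \<in> borel_measurable (G k)" "square_integrable M f" for f k
  proof -
    have "(\<integral>\<omega>. f \<omega> * d k \<omega> \<partial>M) = (\<integral>\<omega>. f \<omega> * a k \<omega> - f \<omega> * (V k \<omega> - V (Suc k) \<omega>) \<partial>M)"
      unfolding d_def by (intro Bochner_Integration.integral_cong) (auto simp: algebra_simps)
    also have "\<dots> = 0"
      by (subst Bochner_Integration.integral_diff)
        (auto intro!: square_integrable_mult_integrable f sqi V_sq a_sq simp: a_int[OF f])
    finally show ?thesis .
  qed
  \<comment> \<open>Martingale increments stay orthogonal after multiplication by indicators known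
    at the start of each step: in the cross term \<open>d n\<close> is integrated against a function
    measurable for \<open>G n\<close>.\<close>
  have orth: "(\<integral>\<omega>. (\<Sum>k<n. indicator (H k) \<omega> * d k \<omega>)\<^sup>2 \<partial>M) = (\<Sum>k<n. \<integral>\<omega>. indicator (H k) \<omega> * (d k \<omega>)\<^sup>2 \<partial>M)"
    if H: "\<And>k. H k \<in> sets (G k)" for H n
  proof (induction n)
    case (Suc n)
    have HM: "H k \<in> sets M" for k using H subset_G by blast
    let ?m = "\<lambda>\<omega>. \<Sum>k<n. indicator (H k) \<omega> * d k \<omega>"
    have m_sq: "square_integrable M ?m" by (intro sqi d_sq HM)
    have m_meas: "?m \<in> borel_measurable (G n)"
    proof (intro borel_measurable_sum borel_measurable_times)
      fix k assume "k \<in> {..<n}"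
      then show "indicator (H k) \<in> borel_measurable (G n)" "d k \<in> borel_measurable (G n)"
        using H[of k] mono'[of k n] measG[OF d_meas, of k n] by auto
    qed
    have f: "(\<lambda>\<omega>. indicator (H n) \<omega> * ?m \<omega>) \<in> borel_measurable (G n)"
      using m_meas H[of n] by auto
    have "(\<integral>\<omega>. (\<Sum>k<Suc n. indicator (H k) \<omega> * d k \<omega>)\<^sup>2 \<partial>M)
      = (\<integral>\<omega>. (?m \<omega>)\<^sup>2 + 2 * ((indicator (H n) \<omega> * ?m \<omega>) * d n \<omega>) + indicator (H n) \<omega> * (d n \<omega>)\<^sup>2 \<partial>M)"
      by (intro Bochner_Integration.integral_cong) (auto simp: power2_eq_square algebra_simps indicator_def)
    also have "\<dots> = (\<integral>\<omega>. (?m \<omega>)\<^sup>2 \<partial>M) + 2 * (\<integral>\<omega>. (indicator (H n) \<omega> * ?m \<omega>) * d n \<omega> \<partial>M)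
        + (\<integral>\<omega>. indicator (H n) \<omega> * (d n \<omega>)\<^sup>2 \<partial>M)"
    proof -
      have i1: "integrable M (\<lambda>\<omega>. (?m \<omega>)\<^sup>2)" using m_sq by (rule square_integrableD)
      have i2: "integrable M (\<lambda>\<omega>. (indicator (H n) \<omega> * ?m \<omega>) * d n \<omega>)"
        by (intro square_integrable_mult_integrable square_integrable_indicator_mult m_sq HM d_sq)
      have i3: "integrable M (\<lambda>\<omega>. indicator (H n) \<omega> * (d n \<omega>)\<^sup>2)"
        using integrable_mult_indicator[OF HM square_integrableD(2)[OF d_sq]] by simp
      show ?thesis
        by (subst Bochner_Integration.integral_add, intro Bochner_Integration.integrable_add i1 integrable_mult_right i2, rule i3,
            subst Bochner_Integration.integral_add, rule i1, intro integrable_mult_right i2) simp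
    qed
    also have "(\<integral>\<omega>. (indicator (H n) \<omega> * ?m \<omega>) * d n \<omega> \<partial>M) = 0"
      by (intro d_int f square_integrable_indicator_mult m_sq HM)
    finally show ?case using Suc by simp
  qed simp
  let ?m = "\<lambda>\<omega>. \<Sum>k<n. indicator (A k) \<omega> * d k \<omega>"
  let ?a = "\<lambda>\<omega>. \<Sum>k<n. indicator (A k) \<omega> * a k \<omega>"
  have "(\<integral>\<omega>. (?m \<omega>)\<^sup>2 \<partial>M) = (\<Sum>k<n. \<integral>\<omega>. indicator (A k) \<omega> * (d k \<omega>)\<^sup>2 \<partial>M)"
    by (rule orth[OF A])
  \<comment> \<open>Enlarging every weight to the whole space and reading \<open>orth\<close>
    backwards bounds the transform by the full martingale, which is \<open>V n - V 0\<close> plus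
    the compensator and retains no trace of \<open>A\<close>.\<close>
  also have "\<dots> \<le> (\<Sum>k<n. \<integral>\<omega>. indicator (space M) \<omega> * (d k \<omega>)\<^sup>2 \<partial>M)"
  proof (intro sum_mono integral_mono)
    fix k
    show "integrable M (\<lambda>\<omega>. indicator (A k) \<omega> * (d k \<omega>)\<^sup>2)" "integrable M (\<lambda>\<omega>. indicator (space M) \<omega> * (d k \<omega>)\<^sup>2)"
      using integrable_mult_indicator[OF AM square_integrableD(2)[OF d_sq]]
        integrable_mult_indicator[OF sets.top square_integrableD(2)[OF d_sq]] by simp_all
  qed (auto simp: indicator_def)
  also have "\<dots> = (\<integral>\<omega>. (\<Sum>k<n. indicator (space M) \<omega> * d k \<omega>)\<^sup>2 \<partial>M)"
    by (rule orth[symmetric]) (metis sets.top space_G)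
  also have "\<dots> = (\<integral>\<omega>. ((V n \<omega> - V 0 \<omega>) + (\<Sum>k<n. a k \<omega>))\<^sup>2 \<partial>M)"
    using sum_lessThan_telescope[of "\<lambda>k. V k _" n]
    by (intro Bochner_Integration.integral_cong refl) (simp add: d_def sum.distrib)
  also have "\<dots> \<le> (\<integral>\<omega>. 8 * (U \<omega>)\<^sup>2 + 2 * (\<Sum>k<n. a k \<omega>)\<^sup>2 \<partial>M)"
  proof (rule integral_mono)
    fix \<omega> assume \<omega>: "\<omega> \<in> space M"
    let ?v = "V n \<omega> - V 0 \<omega>" and ?s = "\<Sum>k<n. a k \<omega>"
    have "\<bar>?v\<bar> \<le> \<bar>2 * U \<omega>\<bar>" using dom[OF \<omega>, of n] dom[OF \<omega>, of 0] by auto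
    then have "?v\<^sup>2 \<le> (2 * U \<omega>)\<^sup>2" by (simp only: abs_le_square_iff)
    moreover have "0 \<le> (?v - ?s)\<^sup>2" by simp
    ultimately show "(?v + ?s)\<^sup>2 \<le> 8 * (U \<omega>)\<^sup>2 + 2 * ?s\<^sup>2"
      by (simp add: power2_diff power2_sum power_mult_distrib)
  qed (use sum_a_sq[of n] U in \<open>auto simp: square_integrable_def intro!: square_integrableD(2) sqi V_sq a_sq\<close>)
  also have "\<dots> = 8 * c + 2 * (\<integral>\<omega>. (\<Sum>k<n. a k \<omega>)\<^sup>2 \<partial>M)"
    using sum_a_sq[of n] U by (simp add: square_integrable_def c_def)
  finally have m_bound: "(\<integral>\<omega>. (?m \<omega>)\<^sup>2 \<partial>M) \<le> 40 * c" using compens[of n] by simp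
  have "(\<integral>\<omega>. (?a \<omega>)\<^sup>2 \<partial>M) \<le> (\<integral>\<omega>. (\<Sum>k<n. a k \<omega>)\<^sup>2 \<partial>M)"
  proof (rule integral_mono_AE)
    have "AE \<omega> in M. \<forall>k. 0 \<le> a k \<omega>" using a_nonneg by (simp add: AE_all_countable)
    then show "AE \<omega> in M. (?a \<omega>)\<^sup>2 \<le> (\<Sum>k<n. a k \<omega>)\<^sup>2"
      by eventually_elim (intro power_mono sum_mono sum_nonneg, auto simp: indicator_def)
  qed (intro square_integrableD(2) sqi a_sq AM)+
  then have a_bound: "(\<integral>\<omega>. (?a \<omega>)\<^sup>2 \<partial>M) \<le> 16 * c" using compens[of n] by simp
  show ?th1 by (intro sqi V_sq AM)
  have "(\<integral>\<omega>. (\<Sum>k<n. indicator (A k) \<omega> * (V (Suc k) \<omega> - V k \<omega>))\<^sup>2 \<partial>M)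
    = (\<integral>\<omega>. (?m \<omega> - ?a \<omega>)\<^sup>2 \<partial>M)"
    by (simp add: d_def distrib_left sum.distrib right_diff_distrib)
  also have "\<dots> \<le> (\<integral>\<omega>. 2 * (?m \<omega>)\<^sup>2 + 2 * (?a \<omega>)\<^sup>2 \<partial>M)"
  proof (rule integral_mono)
    fix \<omega>
    have "0 \<le> (?m \<omega> + ?a \<omega>)\<^sup>2" by simp
    then show "(?m \<omega> - ?a \<omega>)\<^sup>2 \<le> 2 * (?m \<omega>)\<^sup>2 + 2 * (?a \<omega>)\<^sup>2"
      by (simp add: power2_diff power2_sum)
  qed (intro square_integrableD(2) Bochner_Integration.integrable_add integrable_mult_right sqi a_sq d_sq AM)+
  also have "\<dots> = 2 * (\<integral>\<omega>. (?m \<omega>)\<^sup>2 \<partial>M) + 2 * (\<integral>\<omega>. (?a \<omega>)\<^sup>2 \<partial>M)"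
    by (subst Bochner_Integration.integral_add)
      (intro square_integrableD(2) integrable_mult_right sqi a_sq d_sq AM | simp only: integral_mult_right_zero)+
  finally show ?th2 using m_bound a_bound by (simp add: c_def)
qed

text \<open>Vitali's convergence theorem, with the common second moment bound as the source of
  uniform integrability. Dominated convergence handles the part of \<open>f n - h\<close> below a
  truncation level R; the part above R is at most the second moment divided by R.\<close>

lemma (in prob_space) tendsto_integral_L2_bounded:
  fixes f :: "nat \<Rightarrow> 'a \<Rightarrow> real"
  assumes f: "\<And>n. square_integrable M (f n)" and bd: "\<And>n. (\<integral>\<omega>. (f n \<omega>)\<^sup>2 \<partial>M) \<le> C"
    and h: "h \<in> borel_measurable M" and lim: "AE \<omega> in M. (\<lambda>n. f n \<omega>) \<longlonglongrightarrow> h \<omega>"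
  shows "square_integrable M h" "(\<lambda>n. \<integral>\<omega>. f n \<omega> \<partial>M) \<longlonglongrightarrow> (\<integral>\<omega>. h \<omega> \<partial>M)"
proof -
  note [measurable] = square_integrableD(1)[OF f] h
  have C: "0 \<le> C"
    by (rule order_trans[OF Bochner_Integration.integral_nonneg bd[of 0]]) simp
  \<comment> \<open>Fatou's lemma for the squares hands the bound \<open>C\<close> on to the
    limit.\<close>
  have "(\<integral>\<^sup>+\<omega>. ennreal ((h \<omega>)\<^sup>2) \<partial>M) = (\<integral>\<^sup>+\<omega>. liminf (\<lambda>n. ennreal ((f n \<omega>)\<^sup>2)) \<partial>M)"
  proof (rule nn_integral_cong_AE)
    show "AE \<omega> in M. ennreal ((h \<omega>)\<^sup>2) = liminf (\<lambda>n. ennreal ((f n \<omega>)\<^sup>2))"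
      using lim
    proof eventually_elim
      case (elim \<omega>)
      then have "(\<lambda>n. ennreal ((f n \<omega>)\<^sup>2)) \<longlonglongrightarrow> ennreal ((h \<omega>)\<^sup>2)"
        by (intro tendsto_ennrealI tendsto_power)
      then show ?case by (rule lim_imp_Liminf[symmetric, rotated]) simp
    qed
  qed
  also have "\<dots> \<le> liminf (\<lambda>n. \<integral>\<^sup>+\<omega>. ennreal ((f n \<omega>)\<^sup>2) \<partial>M)"
    by (rule nn_integral_liminf) measurable
  also have "\<dots> \<le> ennreal C"
  proof (rule Liminf_le)
    show "\<forall>\<^sub>F n in sequentially. (\<integral>\<^sup>+\<omega>. ennreal ((f n \<omega>)\<^sup>2) \<partial>M) \<le> ennreal C"
      using bd by (intro always_eventually allI)
        (simp add: nn_integral_eq_integral square_integrableD(2)[OF f] ennreal_leI)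
  qed simp
  finally have "(\<integral>\<^sup>+\<omega>. ennreal ((h \<omega>)\<^sup>2) \<partial>M) < \<infinity>"
    by (rule le_less_trans) simp
  then have "integrable M (\<lambda>\<omega>. (h \<omega>)\<^sup>2)"
    by (intro integrableI_nonneg) auto
  then show h_sq: "square_integrable M h"
    by (simp add: square_integrable_def h)
  \<comment> \<open>Bounds the second moments of all \<open>f n - h\<close>, by (x - y)^2 \<le> 2
    x^2 + 2 y^2. The extra 1 keeps the truncation level chosen below strictly positive.\<close>
  define D where "D = 2 * C + 2 * (\<integral>\<omega>. (h \<omega>)\<^sup>2 \<partial>M) + 1"
  have D: "0 < D" using C by (auto simp: D_def intro!: add_nonneg_pos add_nonneg_nonneg Bochner_Integration.integral_nonneg)
  have diff_sq: "square_integrable M (\<lambda>\<omega>. f n \<omega> - h \<omega>)" for n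
    by (intro square_integrable_diff f h_sq)
  have D_bd: "(\<integral>\<omega>. (f n \<omega> - h \<omega>)\<^sup>2 \<partial>M) \<le> D" for n
  proof -
    have "(\<integral>\<omega>. (f n \<omega> - h \<omega>)\<^sup>2 \<partial>M) \<le> (\<integral>\<omega>. 2 * (f n \<omega>)\<^sup>2 + 2 * (h \<omega>)\<^sup>2 \<partial>M)"
    proof (rule integral_mono)
      fix \<omega>
      have "0 \<le> (f n \<omega> + h \<omega>)\<^sup>2" by simp
      then show "(f n \<omega> - h \<omega>)\<^sup>2 \<le> 2 * (f n \<omega>)\<^sup>2 + 2 * (h \<omega>)\<^sup>2"
        by (simp add: power2_diff power2_sum)
    qed (use square_integrableD(2)[OF diff_sq] square_integrableD(2)[OF f] square_integrableD(2)[OF h_sq] in auto)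
    also have "\<dots> \<le> D"
      using bd[of n] square_integrableD(2)[OF f] square_integrableD(2)[OF h_sq] by (simp add: D_def)
    finally show ?thesis .
  qed
  have trunc: "(\<lambda>n. \<integral>\<omega>. min \<bar>f n \<omega> - h \<omega>\<bar> R \<partial>M) \<longlonglongrightarrow> 0" if "0 < R" for R
  proof -
    have "(\<lambda>n. \<integral>\<omega>. min \<bar>f n \<omega> - h \<omega>\<bar> R \<partial>M) \<longlonglongrightarrow> (\<integral>\<omega>. 0 \<partial>M)"
    proof (rule integral_dominated_convergence[where w="\<lambda>_. R"])
      show "AE \<omega> in M. (\<lambda>n. min \<bar>f n \<omega> - h \<omega>\<bar> R) \<longlonglongrightarrow> 0"
        using lim
      proof eventually_elim
        case (elim \<omega>)
        then have "(\<lambda>n. min \<bar>f n \<omega> - h \<omega>\<bar> R) \<longlonglongrightarrow> min \<bar>h \<omega> - h \<omega>\<bar> R"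
          by (intro tendsto_intros)
        then show ?case using that by simp
      qed
    qed (use that in auto)
    then show ?thesis by simp
  qed
  have abs_le: "\<bar>x\<bar> \<le> min \<bar>x\<bar> R + x\<^sup>2 / R" if "0 < R" for x R :: real
  proof (cases "\<bar>x\<bar> \<le> R")
    case False
    then have "R * \<bar>x\<bar> \<le> \<bar>x\<bar> * \<bar>x\<bar>" by (intro mult_right_mono) auto
    then have "\<bar>x\<bar> \<le> x\<^sup>2 / R" using that by (simp add: field_simps power2_eq_square)
    then show ?thesis using that by auto
  qed (use that in auto)
  have diff_int: "integrable M (\<lambda>\<omega>. f n \<omega> - h \<omega>)" for n
    by (rule square_integrable_integrable[OF diff_sq])
  have L1: "(\<lambda>n. \<integral>\<omega>. \<bar>f n \<omega> - h \<omega>\<bar> \<partial>M) \<longlonglongrightarrow> 0"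
  proof (rule LIMSEQ_I)
    fix r :: real assume r: "0 < r"
    \<comment> \<open>At this level the part above R contributes at most D / R = r / 2.\<close>
    define R where "R = 2 * D / r"
    have R: "0 < R" using D r by (simp add: R_def)
    obtain N where N: "\<And>n. n \<ge> N \<Longrightarrow> norm ((\<integral>\<omega>. min \<bar>f n \<omega> - h \<omega>\<bar> R \<partial>M) - 0) < r / 2"
      using LIMSEQ_D[OF trunc[OF R], of "r/2"] r by auto
    have "norm ((\<integral>\<omega>. \<bar>f n \<omega> - h \<omega>\<bar> \<partial>M) - 0) < r" if "n \<ge> N" for n
    proof -
      have i1: "integrable M (\<lambda>\<omega>. min \<bar>f n \<omega> - h \<omega>\<bar> R)"
        by (rule Bochner_Integration.integrable_bound[where f="\<lambda>_. R"]) (use R in auto)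
      have i2: "integrable M (\<lambda>\<omega>. (f n \<omega> - h \<omega>)\<^sup>2 / R)"
        using square_integrableD(2)[OF diff_sq] by simp
      have "(\<integral>\<omega>. \<bar>f n \<omega> - h \<omega>\<bar> \<partial>M) \<le> (\<integral>\<omega>. min \<bar>f n \<omega> - h \<omega>\<bar> R + (f n \<omega> - h \<omega>)\<^sup>2 / R \<partial>M)"
        using diff_int i1 i2 abs_le[OF R] by (intro integral_mono) auto
      also have "\<dots> = (\<integral>\<omega>. min \<bar>f n \<omega> - h \<omega>\<bar> R \<partial>M) + (\<integral>\<omega>. (f n \<omega> - h \<omega>)\<^sup>2 \<partial>M) / R"
        using i1 i2 by simp
      also have "\<dots> < r / 2 + D / R"
        using N[OF that] D_bd[of n] R by (intro add_less_le_mono divide_right_mono) auto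
      also have "\<dots> = r" using D r by (simp add: R_def)
      finally show ?thesis by (simp add: Bochner_Integration.integral_nonneg)
    qed
    then show "\<exists>N. \<forall>n\<ge>N. norm ((\<integral>\<omega>. \<bar>f n \<omega> - h \<omega>\<bar> \<partial>M) - 0) < r" by blast
  qed
  have "(\<lambda>n. (\<integral>\<omega>. f n \<omega> \<partial>M) - (\<integral>\<omega>. h \<omega> \<partial>M)) \<longlonglongrightarrow> 0"
  proof (rule Lim_null_comparison[OF _ L1])
    show "\<forall>\<^sub>F n in sequentially. norm ((\<integral>\<omega>. f n \<omega> \<partial>M) - (\<integral>\<omega>. h \<omega> \<partial>M)) \<le> (\<integral>\<omega>. \<bar>f n \<omega> - h \<omega>\<bar> \<partial>M)"
    proof (intro always_eventually allI)
      fix n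
      have "(\<integral>\<omega>. f n \<omega> \<partial>M) - (\<integral>\<omega>. h \<omega> \<partial>M) = (\<integral>\<omega>. f n \<omega> - h \<omega> \<partial>M)"
        using square_integrable_integrable[OF f] square_integrable_integrable[OF h_sq] by simp
      then show "norm ((\<integral>\<omega>. f n \<omega> \<partial>M) - (\<integral>\<omega>. h \<omega> \<partial>M)) \<le> (\<integral>\<omega>. \<bar>f n \<omega> - h \<omega>\<bar> \<partial>M)"
        using integral_norm_bound[of M "\<lambda>\<omega>. f n \<omega> - h \<omega>"] by simp
    qed
  qed
  then show "(\<lambda>n. \<integral>\<omega>. f n \<omega> \<partial>M) \<longlonglongrightarrow> (\<integral>\<omega>. h \<omega> \<partial>M)"
    by (simp add: LIM_zero_iff)
qed

section \<open>Stopping times and progressive processes\<close>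

lemma continuous_on_Max_image:
  fixes f :: "'i \<Rightarrow> 'a::topological_space \<Rightarrow> real"
  assumes "finite I" "I \<noteq> {}" "\<And>i. i \<in> I \<Longrightarrow> continuous_on S (f i)"
  shows "continuous_on S (\<lambda>x. Max ((\<lambda>i. f i x) ` I))"
  using assms
proof (induction I rule: finite_ne_induct)
  case (insert i I)
  then have "continuous_on S (\<lambda>x. max (f i x) (Max ((\<lambda>i. f i x) ` I)))"
    by (intro continuous_on_max) auto
  then show ?case using insert by simp
qed simp

lemma progressive_sub:
  fixes u w :: "real \<Rightarrow> 'a \<Rightarrow> real"
  assumes "progressive F T u" "progressive F T w"
  shows "progressive F T (\<lambda>t \<omega>. u t \<omega> - w t \<omega>)"
  using assms unfolding progressive_def split_beta' by (intro ballI borel_measurable_diff) auto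

lemma progressive_add:
  fixes u w :: "real \<Rightarrow> 'a \<Rightarrow> real"
  assumes "progressive F T u" "progressive F T w"
  shows "progressive F T (\<lambda>t \<omega>. u t \<omega> + w t \<omega>)"
  using assms unfolding progressive_def split_beta' by (intro ballI borel_measurable_add) auto

lemma progressive_Max:
  fixes f :: "'i \<Rightarrow> real \<Rightarrow> 'a \<Rightarrow> real"
  assumes "finite I" "\<And>i. i \<in> I \<Longrightarrow> progressive F T (f i)"
  shows "progressive F T (\<lambda>t \<omega>. Max ((\<lambda>i. f i t \<omega>) ` I))"
  using assms unfolding progressive_def split_beta' by (intro ballI borel_measurable_Max) auto

text \<open>The infimum of the empty set of reals carries no information, hence the separate default
  value T. Only the number \<open>\<sigma> \<omega>\<close> enters, so a constant function in place
  of \<sigma> expresses a start at a deterministic time.\<close>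

definition first_meet :: "real \<Rightarrow> (real \<Rightarrow> 'a \<Rightarrow> real) \<Rightarrow> (real \<Rightarrow> 'a \<Rightarrow> real) \<Rightarrow> ('a \<Rightarrow> real) \<Rightarrow> 'a \<Rightarrow> real" where
  "first_meet T Y L \<sigma> \<omega> =
     (let S = {s\<in>{\<sigma> \<omega>..T}. Y s \<omega> = L s \<omega>} in if S = {} then T else min (Inf S) T)"

lemma first_meet_le: "first_meet T Y L \<sigma> \<omega> \<le> T"
  by (simp add: first_meet_def Let_def)

lemma first_meet_ge:
  assumes "\<sigma> \<omega> \<le> T"
  shows "\<sigma> \<omega> \<le> first_meet T Y L \<sigma> \<omega>"
  using assms by (auto simp: first_meet_def Let_def intro!: cInf_greatest)

lemma first_meet_lower:
  assumes "\<sigma> \<omega> \<le> s" "s \<le> T" "Y s \<omega> = L s \<omega>"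
  shows "first_meet T Y L \<sigma> \<omega> \<le> s"
proof -
  have "Inf {s\<in>{\<sigma> \<omega>..T}. Y s \<omega> = L s \<omega>} \<le> s"
    using assms by (intro cInf_lower) (auto intro!: bdd_belowI[of _ "\<sigma> \<omega>"])
  then show ?thesis using assms by (auto simp: first_meet_def Let_def)
qed

text \<open>A value below T excludes the default case, and the meeting set is closed by continuity,
  so it contains its infimum.\<close>

lemma first_meet_attained:
  assumes "0 \<le> \<sigma> \<omega>" and cont: "continuous_on {0..T} (\<lambda>s. Y s \<omega>)" "continuous_on {0..T} (\<lambda>s. L s \<omega>)"
    and "first_meet T Y L \<sigma> \<omega> < T"
  shows "Y (first_meet T Y L \<sigma> \<omega>) \<omega> = L (first_meet T Y L \<sigma> \<omega>) \<omega>"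
proof -
  let ?S = "{s\<in>{\<sigma> \<omega>..T}. Y s \<omega> = L s \<omega>}"
  have ne: "?S \<noteq> {}" and eq: "first_meet T Y L \<sigma> \<omega> = Inf ?S"
    using assms(4) by (auto simp: first_meet_def Let_def min_def split: if_splits)
  have "closed ({\<sigma> \<omega>..T} \<inter> (\<lambda>s. Y s \<omega> - L s \<omega>) -` {0})"
    using assms(1)
    by (intro continuous_closed_preimage continuous_intros continuous_on_subset[OF cont(1)] continuous_on_subset[OF cont(2)]) auto
  also have "{\<sigma> \<omega>..T} \<inter> (\<lambda>s. Y s \<omega> - L s \<omega>) -` {0} = ?S" by auto
  finally have "closed ?S" .
  then have "Inf ?S \<in> ?S"
    using ne by (intro closed_contains_Inf) (auto intro!: bdd_belowI[of _ "\<sigma> \<omega>"])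
  then show ?thesis by (simp add: eq)
qed

text \<open>No meeting lies between \<sigma> and s, so both starting points see the same meeting
  set. This is what allows a random start to be traded for a deterministic grid point.\<close>

lemma first_meet_restart:
  assumes "\<sigma> \<omega> \<le> s" "s < first_meet T Y L \<sigma> \<omega>"
  shows "first_meet T Y L (\<lambda>_. s) \<omega> = first_meet T Y L \<sigma> \<omega>"
proof -
  have "s < T" using assms(2) first_meet_le[of T Y L \<sigma> \<omega>] by linarith
  have "{r\<in>{s..T}. Y r \<omega> = L r \<omega>} = {r\<in>{\<sigma> \<omega>..T}. Y r \<omega> = L r \<omega>}"
    using assms first_meet_lower[of \<sigma> \<omega> _ T Y L] by force
  then show ?thesis by (simp add: first_meet_def)
qed

section \<open>Stopping times with values in [0, T] and processes sampled at them\<close>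

locale filtered_prob_space = prob_space M for M :: "'a measure" +
  fixes F :: "real \<Rightarrow> 'a measure" and T :: real
  assumes T_pos: "0 < T"
    and space_filt: "\<And>t. space (F t) = space M"
    and sets_filt_mono: "\<And>s t. s \<le> t \<Longrightarrow> sets (F s) \<subseteq> sets (F t)"
    and sets_filt: "\<And>t. sets (F t) \<subseteq> sets M"
begin

sublocale filtration "space M" F
  by unfold_locales (simp_all add: space_filt sets_filt_mono)

abbreviation stops :: "('a \<Rightarrow> real) set" where
  "stops \<equiv> stopping_times_from M F T (\<lambda>_. 0)"

lemma stopsD:
  assumes "\<theta> \<in> stops"
  shows "stopping_time F \<theta>" "\<And>\<omega>. \<omega> \<in> space M \<Longrightarrow> 0 \<le> \<theta> \<omega>" "\<And>\<omega>. \<omega> \<in> space M \<Longrightarrow> \<theta> \<omega> \<le> T"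
  using assms by (auto simp: stopping_times_from_def)

lemma stopsI:
  assumes "stopping_time F \<theta>" "\<And>\<omega>. \<omega> \<in> space M \<Longrightarrow> 0 \<le> \<theta> \<omega>" "\<And>\<omega>. \<omega> \<in> space M \<Longrightarrow> \<theta> \<omega> \<le> T"
  shows "\<theta> \<in> stops"
  using assms by (auto simp: stopping_times_from_def)

lemma stops_const: "t \<in> {0..T} \<Longrightarrow> (\<lambda>_. t) \<in> stops"
  by (simp add: stopping_times_from_def stopping_time_const)

lemma stops_min: "\<sigma> \<in> stops \<Longrightarrow> \<theta> \<in> stops \<Longrightarrow> (\<lambda>\<omega>. min (\<sigma> \<omega>) (\<theta> \<omega>)) \<in> stops"
  unfolding stopping_times_from_def by (auto intro!: stopping_time_min simp: min_le_iff_disj)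

text \<open>The filtration is indexed by all reals, but for a function with values in [0, T] the
  event is empty before 0 and full from T on.\<close>

lemma stopsI_le:
  assumes "\<And>t. t \<in> {0..<T} \<Longrightarrow> {\<omega>\<in>space M. \<theta> \<omega> \<le> t} \<in> sets (F t)"
    and "\<And>\<omega>. \<omega> \<in> space M \<Longrightarrow> 0 \<le> \<theta> \<omega>" "\<And>\<omega>. \<omega> \<in> space M \<Longrightarrow> \<theta> \<omega> \<le> T"
  shows "\<theta> \<in> stops"
proof (rule stopsI)
  show "stopping_time F \<theta>"
  proof (rule stopping_timeI)
    fix t
    consider "t < 0" | "t \<in> {0..<T}" | "T \<le> t" by force
    then have "{\<omega>\<in>space M. \<theta> \<omega> \<le> t} \<in> sets (F t)"
    proof cases
      case 1
      then have "{\<omega>\<in>space M. \<theta> \<omega> \<le> t} = {}" using assms(2) by force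
      then show ?thesis by (metis sets.empty_sets)
    next
      case 3
      then have "{\<omega>\<in>space M. \<theta> \<omega> \<le> t} = space (F t)" using assms(3) by (force simp: space_filt)
      then show ?thesis by (metis sets.top)
    qed (rule assms(1))
    then show "Measurable.pred (F t) (\<lambda>x. \<theta> x \<le> t)" by (simp add: pred_def space_filt)
  qed
qed (use assms in auto)

lemma subalgebra_filt: "subalgebra M (F t)"
  by (simp add: subalgebra_def space_filt sets_filt)

lemma subalgebra_pre_sigma:
  assumes "\<theta> \<in> stops"
  shows "subalgebra M (pre_sigma \<theta>)"
  unfolding subalgebra_def
proof
  show "space (pre_sigma \<theta>) = space M" by (rule space_pre_sigma)
  show "sets (pre_sigma \<theta>) \<subseteq> sets M"
  proof
    fix A assume A: "A \<in> sets (pre_sigma \<theta>)"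
    then have "A \<subseteq> space M" using sets.sets_into_space space_pre_sigma by blast
    then have "A = {\<omega>\<in>A. \<theta> \<omega> \<le> T}" using stopsD(3)[OF assms] by auto
    then show "A \<in> sets M"
      using sets_pre_sigmaD[OF stopsD(1)[OF assms] A, of T] sets_filt by auto
  qed
qed

lemma pre_sigma_sets_M: "\<theta> \<in> stops \<Longrightarrow> A \<in> sets (pre_sigma \<theta>) \<Longrightarrow> A \<in> sets M"
  using subalgebra_pre_sigma by (auto simp: subalgebra_def)

lemma pre_sigma_const: "sets (pre_sigma (\<lambda>_. t)) = sets (F t)"
proof (intro equalityI subsetI)
  fix A assume "A \<in> sets (pre_sigma (\<lambda>_. t))"
  from sets_pre_sigmaD[OF stopping_time_const this, of t] show "A \<in> sets (F t)" by simp
next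
  fix A assume A: "A \<in> sets (F t)"
  show "A \<in> sets (pre_sigma (\<lambda>_. t))"
  proof (rule sets_pre_sigmaI[OF stopping_time_const])
    fix u
    show "{\<omega> \<in> A. t \<le> u} \<in> sets (F u)"
      using A sets_filt_mono[of t u] by (cases "t \<le> u") auto
  qed
qed

lemma stops_min_const_measurable:
  assumes "\<theta> \<in> stops"
  shows "(\<lambda>\<omega>. min (\<theta> \<omega>) t) \<in> borel_measurable (F t)"
proof (rule borel_measurableI_le)
  fix u
  show "{\<omega> \<in> space (F t). min (\<theta> \<omega>) t \<le> u} \<in> sets (F t)"
  proof (cases "t \<le> u")
    case False
    then have "{\<omega> \<in> space (F t). min (\<theta> \<omega>) t \<le> u} = {\<omega> \<in> space (F t). \<theta> \<omega> \<le> u}" by auto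
    then show ?thesis
      using stopping_time_le_const[OF stopsD(1)[OF assms], of u t] False by (auto simp: pred_def)
  qed (simp add: min.coboundedI2)
qed

lemma progressive_compose:
  assumes "progressive F T w" "t \<in> {0..T}" "\<theta> \<in> borel_measurable (F t)"
    "\<And>\<omega>. \<omega> \<in> space M \<Longrightarrow> \<theta> \<omega> \<in> {0..t}"
  shows "(\<lambda>\<omega>. w (\<theta> \<omega>) \<omega>) \<in> borel_measurable (F t)"
proof -
  have "(\<lambda>\<omega>. (\<theta> \<omega>, \<omega>)) \<in> F t \<rightarrow>\<^sub>M restrict_space borel {0..t} \<Otimes>\<^sub>M F t"
    using assms by (intro measurable_Pair measurable_restrict_space2) (auto simp: space_filt)
  moreover have "(\<lambda>(s,\<omega>). w s \<omega>) \<in> borel_measurable (restrict_space borel {0..t} \<Otimes>\<^sub>M F t)"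
    using assms(1,2) by (simp add: progressive_def)
  ultimately have "(\<lambda>\<omega>. (\<lambda>(s,\<omega>). w s \<omega>) (\<theta> \<omega>, \<omega>)) \<in> borel_measurable (F t)"
    by (rule measurable_compose)
  then show ?thesis by simp
qed

lemma progressive_adapted:
  assumes "progressive F T w" "t \<in> {0..T}"
  shows "w t \<in> borel_measurable (F t)"
  using progressive_compose[OF assms, of "\<lambda>_. t"] assms(2) by simp

lemma progressive_stopped:
  assumes w: "progressive F T w" and \<theta>: "\<theta> \<in> stops"
  shows "(\<lambda>\<omega>. w (\<theta> \<omega>) \<omega>) \<in> borel_measurable (pre_sigma \<theta>)"
proof (rule measurableI)
  fix B :: "'b set" assume B: "B \<in> sets borel"
  show "(\<lambda>\<omega>. w (\<theta> \<omega>) \<omega>) -` B \<inter> space (pre_sigma \<theta>) \<in> sets (pre_sigma \<theta>)"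
  proof (rule sets_pre_sigmaI[OF stopsD(1)[OF \<theta>]])
    fix t
    \<comment> \<open>Progressive measurability is available up to T only. As \<theta> never exceeds
      T, having stopped by t means having stopped by u, and on that event \<theta> equals its
      minimum with u, which is known at time u.\<close>
    define u where "u = min t T"
    show "{\<omega> \<in> (\<lambda>\<omega>. w (\<theta> \<omega>) \<omega>) -` B \<inter> space (pre_sigma \<theta>). \<theta> \<omega> \<le> t} \<in> sets (F t)" (is "?S \<in> _")
    proof (cases "0 \<le> t")
      case True
      then have u: "u \<in> {0..T}" using T_pos by (auto simp: u_def)
      have [measurable]: "(\<lambda>\<omega>. w (min (\<theta> \<omega>) u) \<omega>) \<in> borel_measurable (F u)"
        using u stopsD[OF \<theta>]
        by (intro progressive_compose[OF w u] stops_min_const_measurable \<theta>) auto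
      have [measurable]: "Measurable.pred (F u) (\<lambda>\<omega>. \<theta> \<omega> \<le> u)"
        by (rule stopping_timeD[OF stopsD(1)[OF \<theta>]])
      have "?S = {\<omega>\<in>space (F u). w (min (\<theta> \<omega>) u) \<omega> \<in> B \<and> \<theta> \<omega> \<le> u}"
        using stopsD(3)[OF \<theta>] by (auto simp: space_pre_sigma space_filt u_def)
      also have "\<dots> \<in> sets (F u)" using B by measurable
      finally show ?thesis using sets_filt_mono[of u t] by (auto simp: u_def)
    next
      case False
      then have "?S = {}" using stopsD(2)[OF \<theta>] by (fastforce simp: space_pre_sigma)
      then show ?thesis by (metis sets.empty_sets)
    qed
  qed
qed simp

lemma progressive_stopped_M:
  assumes "progressive F T w" "\<theta> \<in> stops"
  shows "(\<lambda>\<omega>. w (\<theta> \<omega>) \<omega>) \<in> borel_measurable M"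
  using measurable_from_subalg[OF subalgebra_pre_sigma[OF assms(2)] progressive_stopped[OF assms]] .

text \<open>The meeting has occurred by t exactly if \<sigma> \<le> t and the distance of the two
  paths has minimum zero on [\<sigma>, t]. By continuity this can be read off from countably many
  times in [0, t], so the event lies in \<open>F t\<close> itself, without a look into the immediate
  future.\<close>

lemma first_meet_stops:
  assumes \<sigma>: "\<sigma> \<in> stops" and prog: "progressive F T Y" "progressive F T L"
    and cont: "\<And>\<omega>. \<omega> \<in> space M \<Longrightarrow> continuous_on {0..T} (\<lambda>t. Y t \<omega>)"
      "\<And>\<omega>. \<omega> \<in> space M \<Longrightarrow> continuous_on {0..T} (\<lambda>t. L t \<omega>)"
  shows "first_meet T Y L \<sigma> \<in> stops"
proof (rule stopsI_le)
  note \<sigma>D = stopsD[OF \<sigma>]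
  fix \<omega> assume \<omega>: "\<omega> \<in> space M"
  show "first_meet T Y L \<sigma> \<omega> \<le> T" by (rule first_meet_le)
  show "0 \<le> first_meet T Y L \<sigma> \<omega>"
    using first_meet_ge[of \<sigma> \<omega> T Y L] \<sigma>D(2,3)[OF \<omega>] by simp
next
  note \<sigma>D = stopsD[OF \<sigma>]
  fix t assume t: "t \<in> {0..<T}"
  define W where "W = (\<lambda>s \<omega>. \<bar>Y s \<omega> - L s \<omega>\<bar>)"
  \<comment> \<open>A meeting strictly before t is approximated by rationals to its right; the point
    t is added for a meeting that takes place at t.\<close>
  define Q where "Q = insert t (\<rat> \<inter> {0..t})"
  have Q: "countable Q" "Q \<subseteq> {0..t}" using t by (auto simp: Q_def countable_rat)
  have W_prog: "progressive F T W"
    unfolding W_def using progressive_sub[OF prog] unfolding progressive_def split_beta' by auto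
  have W_cont: "continuous_on {0..t} (\<lambda>s. W s \<omega>)" if "\<omega> \<in> space M" for \<omega>
    unfolding W_def using t
    by (intro continuous_intros continuous_on_subset[OF cont(1)[OF that]] continuous_on_subset[OF cont(2)[OF that]]) auto
  \<comment> \<open>On the event \<sigma> \<le> t this moves q into [\<sigma>, t]. The result stays
    measurable for \<open>F t\<close>, since \<sigma> enters only through its minimum with
    t.\<close>
  define r where "r q \<omega> = max (min (\<sigma> \<omega>) t) q" for q \<omega>
  have r: "r q \<omega> \<in> {0..t}" if "q \<in> Q" "\<omega> \<in> space M" for q \<omega>
    using that Q \<sigma>D(2)[OF that(2)] by (auto simp: r_def max_def min_def)
  have key: "first_meet T Y L \<sigma> \<omega> \<le> t \<longleftrightarrow> \<sigma> \<omega> \<le> t \<and> (\<forall>n::nat. \<exists>q\<in>Q. W (r q \<omega>) \<omega> < 1 / Suc n)"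
    if \<omega>: "\<omega> \<in> space M" for \<omega>
  proof safe
    assume le: "first_meet T Y L \<sigma> \<omega> \<le> t"
    define D where "D = first_meet T Y L \<sigma> \<omega>"
    have "\<sigma> \<omega> \<le> D" unfolding D_def by (rule first_meet_ge) (rule \<sigma>D(3)[OF \<omega>])
    then show \<sigma>t: "\<sigma> \<omega> \<le> t" using le by (simp add: D_def)
    have D0: "0 \<le> D" "D \<le> t" using \<open>\<sigma> \<omega> \<le> D\<close> \<sigma>D(2)[OF \<omega>] le by (auto simp: D_def)
    have WD: "W D \<omega> = 0"
      using first_meet_attained[of \<sigma> \<omega> T Y L] \<sigma>D(2)[OF \<omega>] cont[OF \<omega>] le t by (simp add: D_def W_def)
    fix n :: nat
    show "\<exists>q\<in>Q. W (r q \<omega>) \<omega> < 1 / Suc n"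
    proof (cases "D = t")
      case True
      then show ?thesis using WD \<sigma>t by (intro bexI[of _ t]) (auto simp: Q_def r_def max_def)
    next
      case False
      with D0 have "D < t" by simp
      obtain \<delta> where \<delta>: "0 < \<delta>" "\<And>s. s \<in> {0..t} \<Longrightarrow> dist s D < \<delta> \<Longrightarrow> dist (W s \<omega>) (W D \<omega>) < 1 / Suc n"
        using W_cont[OF \<omega>, unfolded continuous_on_iff, rule_format, of D "1 / Suc n"] D0 by auto
      obtain q where q: "q \<in> \<rat>" "D < q" "q < min t (D + \<delta>)"
        using Rats_dense_in_real[of D "min t (D + \<delta>)"] \<open>D < t\<close> \<delta>(1) by auto
      then have "q \<in> Q" "r q \<omega> = q" using D0 \<open>\<sigma> \<omega> \<le> D\<close> by (auto simp: Q_def r_def)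
      moreover have "W q \<omega> < 1 / Suc n"
        using \<delta>(2)[of q] q D0 WD by (auto simp: dist_real_def)
      ultimately show ?thesis by (intro bexI[of _ q]) simp_all
    qed
  next
    assume \<sigma>t: "\<sigma> \<omega> \<le> t" and all: "\<forall>n::nat. \<exists>q\<in>Q. W (r q \<omega>) \<omega> < 1 / Suc n"
    have "continuous_on {\<sigma> \<omega>..t} (\<lambda>s. W s \<omega>)"
      using \<sigma>D(2)[OF \<omega>] by (intro continuous_on_subset[OF W_cont[OF \<omega>]]) auto
    then obtain s where s: "s \<in> {\<sigma> \<omega>..t}" "\<And>s'. s' \<in> {\<sigma> \<omega>..t} \<Longrightarrow> W s \<omega> \<le> W s' \<omega>"
      using continuous_attains_inf[of "{\<sigma> \<omega>..t}" "\<lambda>s. W s \<omega>"] \<sigma>t by auto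
    have "W s \<omega> < 1 / Suc n" for n :: nat
    proof -
      obtain q where q: "q \<in> Q" "W (r q \<omega>) \<omega> < 1 / Suc n" using all by blast
      then have "r q \<omega> \<in> {\<sigma> \<omega>..t}" using \<sigma>t Q by (auto simp: r_def)
      from s(2)[OF this] q show ?thesis by simp
    qed
    then have "W s \<omega> \<le> 0"
      by (meson nat_approx_posE not_le order_less_asym)
    then have "Y s \<omega> = L s \<omega>" by (simp add: W_def)
    then show "first_meet T Y L \<sigma> \<omega> \<le> t"
      using first_meet_lower[of \<sigma> \<omega> s T Y L] s t by auto
  qed
  have [measurable]: "Measurable.pred (F t) (\<lambda>\<omega>. \<sigma> \<omega> \<le> t)" by (rule stopping_timeD[OF \<sigma>D(1)])
  have [measurable]: "(\<lambda>\<omega>. W (r q \<omega>) \<omega>) \<in> borel_measurable (F t)" if "q \<in> Q" for q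
  proof (rule progressive_compose[OF W_prog])
    show "r q \<in> borel_measurable (F t)"
      unfolding r_def using stops_min_const_measurable[OF \<sigma>, of t] by measurable
  qed (use t r[OF that] in auto)
  have "{\<omega>\<in>space M. first_meet T Y L \<sigma> \<omega> \<le> t} =
      {\<omega>\<in>space (F t). \<sigma> \<omega> \<le> t \<and> (\<forall>n::nat. \<exists>q\<in>Q. W (r q \<omega>) \<omega> < 1 / Suc n)}"
    using key by (auto simp: space_filt)
  also have "\<dots> \<in> sets (F t)"
    unfolding pred_def[symmetric]
    by (intro pred_intros_logic pred_intros_countable measurable_pred_countable Q(1)) measurable
  finally show "{\<omega>\<in>space M. first_meet T Y L \<sigma> \<omega> \<le> t} \<in> sets (F t)" .
qed

text \<open>Joint measurability is that of a Lebesgue integral depending on a parameter; continuity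
  of the paths identifies it with the gauge integral.\<close>

lemma progressive_integral:
  fixes f :: "real \<Rightarrow> 'a \<Rightarrow> real"
  assumes f: "progressive F T f"
    and cont: "\<And>\<omega>. \<omega> \<in> space M \<Longrightarrow> continuous_on {0..T} (\<lambda>t. f t \<omega>)"
  shows "progressive F T (\<lambda>t \<omega>. integral {0..t} (\<lambda>s. f s \<omega>))"
  unfolding progressive_def
proof
  fix t assume t: "t \<in> {0..T}"
  let ?N = "restrict_space borel {0..t} \<Otimes>\<^sub>M F t"
  have fm: "(\<lambda>(s,\<omega>). f s \<omega>) \<in> borel_measurable ?N" using f t by (simp add: progressive_def)
  \<comment> \<open>Clamping the integration variable extends the integrand to all real s without
    leaving the strip on which \<open>f\<close> is known to be measurable. The cut-off factor
    introduced below discards the times at which clamping changes anything.\<close>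
  have "(\<lambda>p. (max 0 (min (snd p) t), snd (fst p))) \<in> (?N \<Otimes>\<^sub>M lborel) \<rightarrow>\<^sub>M ?N"
  proof (intro measurable_Pair measurable_restrict_space2)
    show "(\<lambda>p. max 0 (min (snd p) t)) \<in> borel_measurable (?N \<Otimes>\<^sub>M lborel)" by measurable
    show "(\<lambda>p. snd (fst p)) \<in> ?N \<Otimes>\<^sub>M lborel \<rightarrow>\<^sub>M F t" by measurable
  qed (use t in auto)
  from measurable_compose[OF this fm]
  have f': "(\<lambda>p. f (max 0 (min (snd p) t)) (snd (fst p))) \<in> borel_measurable (?N \<Otimes>\<^sub>M lborel)"
    by simp
  have fst': "(\<lambda>p. fst (fst p)) \<in> borel_measurable (?N \<Otimes>\<^sub>M lborel)"
  proof -
    have "(\<lambda>s. s) \<in> restrict_space borel {0..t} \<rightarrow>\<^sub>M borel" by (intro measurable_restrict_space1) simp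
    then have "fst \<in> ?N \<rightarrow>\<^sub>M borel" using measurable_compose[OF measurable_fst] by fastforce
    then show ?thesis using measurable_compose[OF measurable_fst] by fastforce
  qed
  have "(\<lambda>p. (if 0 \<le> snd p \<and> snd p \<le> fst (fst p) then 1 else 0) * f (max 0 (min (snd p) t)) (snd (fst p)))
    \<in> borel_measurable (?N \<Otimes>\<^sub>M lborel)"
    using fst' f' by measurable
  then have "(\<lambda>x. \<integral>s. (if 0 \<le> s \<and> s \<le> fst x then 1 else 0) * f (max 0 (min s t)) (snd x) \<partial>lborel) \<in> borel_measurable ?N"
    by (intro lborel.borel_measurable_lebesgue_integral) (simp add: split_beta')
  also have "?this \<longleftrightarrow> (\<lambda>(t, \<omega>). integral {0..t} (\<lambda>s. f s \<omega>)) \<in> borel_measurable ?N"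
  proof (rule measurable_cong)
    fix x assume "x \<in> space ?N"
    then have x: "fst x \<in> {0..t}" "snd x \<in> space M"
      by (auto simp: space_pair_measure space_filt space_restrict_space)
    have c: "continuous_on {0..fst x} (\<lambda>s. f s (snd x))"
      using x t by (intro continuous_on_subset[OF cont]) auto
    have "(\<integral>s. (if 0 \<le> s \<and> s \<le> fst x then 1 else 0) * f (max 0 (min s t)) (snd x) \<partial>lborel)
      = (LINT s:{0..fst x}|lborel. f s (snd x))"
      unfolding set_lebesgue_integral_def
      using x by (intro Bochner_Integration.integral_cong) (auto simp: indicator_def)
    also have "\<dots> = integral {0..fst x} (\<lambda>s. f s (snd x))"
      by (intro set_borel_integral_eq_integral borel_integrable_atLeastAtMost') (rule c)
    finally show "(\<integral>s. (if 0 \<le> s \<and> s \<le> fst x then 1 else 0) * f (max 0 (min s t)) (snd x) \<partial>lborel)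
      = (case x of (t, \<omega>) \<Rightarrow> integral {0..t} (\<lambda>s. f s \<omega>))" by (simp add: split_beta')
  qed
  finally show "(\<lambda>(t, \<omega>). integral {0..t} (\<lambda>s. f s \<omega>)) \<in> borel_measurable ?N" .
qed

end

section \<open>Optional sampling\<close>

context filtered_prob_space
begin

section \<open>Rounding times up to a finite grid of mesh T / (n + 1)\<close>

definition grid_point :: "nat \<Rightarrow> nat \<Rightarrow> real" where
  "grid_point n k = real k * T / Suc n"

definition grid_index :: "nat \<Rightarrow> real \<Rightarrow> nat" where
  "grid_index n x = nat \<lceil>x * Suc n / T\<rceil>"

definition grid_up :: "nat \<Rightarrow> real \<Rightarrow> real" where
  "grid_up n x = grid_point n (grid_index n x)"

lemma grid_index_le_iff: "grid_index n x \<le> k \<longleftrightarrow> x \<le> grid_point n k"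
  unfolding grid_index_def grid_point_def nat_ceiling_le_eq using T_pos by (simp add: field_simps)

lemma grid_index_greater_iff: "k < grid_index n x \<longleftrightarrow> grid_point n k < x"
  using grid_index_le_iff[of n x k] by linarith

lemma grid_point_mem: "k \<le> Suc n \<Longrightarrow> grid_point n k \<in> {0..T}"
proof -
  assume "k \<le> Suc n"
  then have "real k * T \<le> real (Suc n) * T" using T_pos by (intro mult_right_mono) auto
  then show ?thesis using T_pos by (auto simp: grid_point_def field_simps)
qed

lemma grid_point_mono: "k \<le> l \<Longrightarrow> grid_point n k \<le> grid_point n l"
  unfolding grid_point_def using T_pos by (intro divide_right_mono mult_right_mono) auto

lemma grid_index_le: "x \<le> T \<Longrightarrow> grid_index n x \<le> Suc n"
  using T_pos by (simp add: grid_index_le_iff grid_point_def)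

lemma grid_up_ge: "x \<le> grid_up n x"
  using grid_index_le_iff[of n x "grid_index n x"] by (simp add: grid_up_def)

lemma grid_up_mem: "x \<le> T \<Longrightarrow> grid_up n x \<in> {0..T}"
  unfolding grid_up_def by (intro grid_point_mem grid_index_le)

lemma grid_up_le: "0 \<le> x \<Longrightarrow> grid_up n x \<le> x + T / Suc n"
proof (cases "grid_index n x")
  case 0
  then show "0 \<le> x \<Longrightarrow> ?thesis" using T_pos by (simp add: grid_up_def grid_point_def)
next
  case (Suc j)
  then have "grid_point n j < x" using grid_index_greater_iff[of j n x] by simp
  moreover have "grid_point n (Suc j) = grid_point n j + T / Suc n"
    by (simp add: grid_point_def add_divide_distrib distrib_right)
  ultimately show ?thesis unfolding grid_up_def Suc by linarith
qed

lemma grid_up_tendsto: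
  assumes "0 \<le> x"
  shows "(\<lambda>n. grid_up n x) \<longlonglongrightarrow> x"
proof (rule tendsto_sandwich[of "\<lambda>_. x" _ _ "\<lambda>n. x + T / Suc n"])
  have "(\<lambda>n. T * inverse (real (Suc n))) \<longlonglongrightarrow> T * 0"
    by (intro tendsto_intros LIMSEQ_inverse_real_of_nat)
  then have "(\<lambda>n. x + T * inverse (real (Suc n))) \<longlonglongrightarrow> x + T * 0"
    by (intro tendsto_add tendsto_const)
  then show "(\<lambda>n. x + T / Suc n) \<longlonglongrightarrow> x" by (simp add: divide_inverse)
qed (use grid_up_ge grid_up_le[OF assms] in \<open>auto intro!: always_eventually\<close>)

lemma grid_up_measurable [measurable]: "grid_up n \<in> borel_measurable borel"
  unfolding grid_up_def grid_point_def grid_index_def by measurable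

text \<open>With stopping times in place of x and y, the condition under the sum is an event known
  at the k-th grid time. An increment between rounded stopping times thus becomes a sum of
  increments between fixed times on past events.\<close>

lemma grid_telescope:
  fixes f :: "nat \<Rightarrow> real"
  assumes "x \<le> y" "y \<le> T"
  shows "(\<Sum>k<Suc n. (if x \<le> grid_point n k \<and> grid_point n k < y then f (Suc k) - f k else 0))
    = f (grid_index n y) - f (grid_index n x)"
proof -
  have le: "grid_index n x \<le> grid_index n y"
    using grid_index_le_iff[of n x "grid_index n y"] grid_up_ge[of y n] assms(1)
    by (simp add: grid_up_def)
  have "(\<Sum>k<Suc n. (if x \<le> grid_point n k \<and> grid_point n k < y then f (Suc k) - f k else 0))
    = (\<Sum>k\<in>{k\<in>{..<Suc n}. x \<le> grid_point n k \<and> grid_point n k < y}. f (Suc k) - f k)"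
    by (subst sum.inter_filter) auto
  also have "{k\<in>{..<Suc n}. x \<le> grid_point n k \<and> grid_point n k < y} = {grid_index n x..<grid_index n y}"
    using grid_index_le[OF assms(2), of n]
    by (auto simp: grid_index_le_iff[symmetric] grid_index_greater_iff[symmetric])
  also have "(\<Sum>k\<in>\<dots>. f (Suc k) - f k) = f (grid_index n y) - f (grid_index n x)"
    by (rule sum_Suc_diff'[OF le])
  finally show ?thesis .
qed

text \<open>One square integrable variable bounds the entire path. It serves as dominating function
  when stopping times are approximated, and as the variable \<open>U\<close> of the L2 bound
  whatever the sampling times are.\<close>

definition dominated_process :: "(real \<Rightarrow> 'a \<Rightarrow> real) \<Rightarrow> ('a \<Rightarrow> real) \<Rightarrow> bool" where
  "dominated_process V U \<longleftrightarrow> progressive F T V \<and>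
     (\<forall>\<omega>\<in>space M. continuous_on {0..T} (\<lambda>t. V t \<omega>)) \<and> square_integrable M U \<and>
     (\<forall>\<omega>\<in>space M. \<forall>t\<in>{0..T}. \<bar>V t \<omega>\<bar> \<le> U \<omega>)"

lemma dominated_processD:
  assumes "dominated_process V U"
  shows "progressive F T V" "\<And>\<omega>. \<omega> \<in> space M \<Longrightarrow> continuous_on {0..T} (\<lambda>t. V t \<omega>)"
    "square_integrable M U" "\<And>\<omega> t. \<omega> \<in> space M \<Longrightarrow> 0 \<le> t \<Longrightarrow> t \<le> T \<Longrightarrow> \<bar>V t \<omega>\<bar> \<le> U \<omega>"
  using assms by (auto simp: dominated_process_def)

lemma dominated_process_stopped:
  assumes V: "dominated_process V U" and \<theta>: "\<theta> \<in> stops"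
  shows "square_integrable M (\<lambda>\<omega>. V (\<theta> \<omega>) \<omega>)"
proof (rule square_integrable_bound[OF dominated_processD(3)[OF V]])
  show "(\<lambda>\<omega>. V (\<theta> \<omega>) \<omega>) \<in> borel_measurable M"
    by (rule progressive_stopped_M[OF dominated_processD(1)[OF V] \<theta>])
  show "AE \<omega> in M. \<bar>V (\<theta> \<omega>) \<omega>\<bar> \<le> \<bar>U \<omega>\<bar>"
    using dominated_processD(4)[OF V] stopsD[OF \<theta>] by (intro AE_I2) force
qed

lemma dominated_process_indicator_integrable:
  assumes "dominated_process V U" "\<theta> \<in> stops" "A \<in> sets M"
  shows "integrable M (\<lambda>\<omega>. indicator A \<omega> * V (\<theta> \<omega>) \<omega>)"
  by (intro square_integrable_integrable square_integrable_indicator_mult dominated_process_stopped[OF assms(1)] assms)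

lemma stops_measurable_T:
  assumes "\<theta> \<in> stops"
  shows "\<theta> \<in> borel_measurable (F T)"
  using stops_min_const_measurable[OF assms, of T] stopsD(3)[OF assms]
  by (subst measurable_cong[of _ _ "\<lambda>\<omega>. min (\<theta> \<omega>) T"]) (auto simp: space_filt min_def)

lemma stops_measurable:
  assumes "\<theta> \<in> stops"
  shows "\<theta> \<in> borel_measurable M"
  using measurable_from_subalg[OF subalgebra_filt stops_measurable_T[OF assms]] .

lemma progressive_grid_up_measurable:
  assumes V: "progressive F T V" and \<theta>: "\<theta> \<in> stops"
  shows "(\<lambda>\<omega>. V (grid_up n (\<theta> \<omega>)) \<omega>) \<in> borel_measurable M"
proof -
  have "(\<lambda>\<omega>. V (grid_up n (\<theta> \<omega>)) \<omega>) \<in> borel_measurable (F T)"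
  proof (rule progressive_compose[OF V])
    show "(\<lambda>\<omega>. grid_up n (\<theta> \<omega>)) \<in> borel_measurable (F T)"
      using stops_measurable_T[OF \<theta>] by measurable
  qed (use T_pos grid_up_mem stopsD(3)[OF \<theta>] in auto)
  then show ?thesis using measurable_from_subalg[OF subalgebra_filt] by blast
qed

lemma dominated_process_grid_up_integrable:
  assumes V: "dominated_process V U" and \<theta>: "\<theta> \<in> stops" and A: "A \<in> sets M"
  shows "integrable M (\<lambda>\<omega>. indicator A \<omega> * V (grid_up n (\<theta> \<omega>)) \<omega>)"
proof (rule Bochner_Integration.integrable_bound[OF square_integrable_integrable[OF dominated_processD(3)[OF V]]])
  note [measurable] = progressive_grid_up_measurable[OF dominated_processD(1)[OF V] \<theta>] A
  show "(\<lambda>\<omega>. indicator A \<omega> * V (grid_up n (\<theta> \<omega>)) \<omega>) \<in> borel_measurable M" by measurable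
  show "AE \<omega> in M. norm (indicator A \<omega> * V (grid_up n (\<theta> \<omega>)) \<omega>) \<le> norm (U \<omega>)"
  proof (rule AE_I2)
    fix \<omega> assume \<omega>: "\<omega> \<in> space M"
    then have "\<bar>V (grid_up n (\<theta> \<omega>)) \<omega>\<bar> \<le> U \<omega>"
      using dominated_processD(4)[OF V \<omega>] grid_up_mem[OF stopsD(3)[OF \<theta> \<omega>]] by auto
    then show "norm (indicator A \<omega> * V (grid_up n (\<theta> \<omega>)) \<omega>) \<le> norm (U \<omega>)"
      by (auto simp: indicator_def)
  qed
qed

text \<open>The events may vary with n because the martingale argument for random starting times
  restricts to events that depend on the grid. Measurability of the sampled values is a separate
  hypothesis, so that rounded times can be inserted directly.\<close>

lemma dominated_process_tendsto:
  fixes r :: "nat \<Rightarrow> 'a \<Rightarrow> real"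
  assumes V: "dominated_process V U" and A: "\<And>n. A n \<in> sets M" and B: "B \<in> sets M"
    and meas: "\<And>n. (\<lambda>\<omega>. V (r n \<omega>) \<omega>) \<in> borel_measurable M" and \<theta>: "\<theta> \<in> stops"
    and r: "\<And>n \<omega>. \<omega> \<in> space M \<Longrightarrow> r n \<omega> \<in> {0..T}"
    and lim: "AE \<omega> in M. (\<lambda>n. r n \<omega>) \<longlonglongrightarrow> \<theta> \<omega>"
    and limA: "AE \<omega> in M. \<forall>\<^sub>F n in sequentially. \<omega> \<in> A n \<longleftrightarrow> \<omega> \<in> B"
  shows "(\<lambda>n. \<integral>\<omega>. indicator (A n) \<omega> * V (r n \<omega>) \<omega> \<partial>M) \<longlonglongrightarrow> (\<integral>\<omega>. indicator B \<omega> * V (\<theta> \<omega>) \<omega> \<partial>M)"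
proof (rule integral_dominated_convergence[where w=U])
  note [measurable] = A B meas progressive_stopped_M[OF dominated_processD(1)[OF V] \<theta>]
  show "integrable M U" by (rule square_integrable_integrable[OF dominated_processD(3)[OF V]])
  show "(\<lambda>\<omega>. indicator B \<omega> * V (\<theta> \<omega>) \<omega>) \<in> borel_measurable M" by measurable
  show "(\<lambda>\<omega>. indicator (A n) \<omega> * V (r n \<omega>) \<omega>) \<in> borel_measurable M" for n by measurable
  show "AE \<omega> in M. norm (indicator (A n) \<omega> * V (r n \<omega>) \<omega>) \<le> U \<omega>" for n
  proof (rule AE_I2)
    fix \<omega> assume \<omega>: "\<omega> \<in> space M"
    have "\<bar>V (r n \<omega>) \<omega>\<bar> \<le> U \<omega>"
      using dominated_processD(4)[OF V \<omega>] r[OF \<omega>, of n] by auto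
    then show "norm (indicator (A n) \<omega> * V (r n \<omega>) \<omega>) \<le> U \<omega>"
      by (auto simp: indicator_def)
  qed
  show "AE \<omega> in M. (\<lambda>n. indicator (A n) \<omega> * V (r n \<omega>) \<omega>) \<longlonglongrightarrow> indicator B \<omega> * V (\<theta> \<omega>) \<omega>"
    using lim limA AE_space
  proof eventually_elim
    case (elim \<omega>)
    have "(\<lambda>n. V (r n \<omega>) \<omega>) \<longlonglongrightarrow> V (\<theta> \<omega>) \<omega>"
      using continuous_on_tendsto_compose[OF dominated_processD(2)[OF V elim(3)] elim(1)]
        stopsD[OF \<theta>] elim(3) r by auto
    moreover have "(\<lambda>n. indicator (A n) \<omega> :: real) \<longlonglongrightarrow> indicator B \<omega>"
      by (rule tendsto_eventually) (use elim(2) in eventually_elim, auto simp: indicator_def)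
    ultimately show ?case by (intro tendsto_mult)
  qed
qed

text \<open>Stated with integrals over past events, which avoids choosing versions of conditional
  expectations; integrability is supplied by \<open>dominated_process\<close>.\<close>

definition supermartingale :: "(real \<Rightarrow> 'a \<Rightarrow> real) \<Rightarrow> bool" where
  "supermartingale V \<longleftrightarrow> (\<forall>s\<in>{0..T}. \<forall>t\<in>{s..T}. \<forall>A\<in>sets (F s).
     (\<integral>\<omega>. indicator A \<omega> * V t \<omega> \<partial>M) \<le> (\<integral>\<omega>. indicator A \<omega> * V s \<omega> \<partial>M))"

text \<open>After rounding up, the difference of the two sides is a finite sum of increments between
  neighbouring grid times, each over an event known at its left end and therefore nonpositive. Path
  continuity and domination then remove the rounding.\<close>

lemma optional_sampling:
  assumes V: "dominated_process V U" and super: "supermartingale V"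
    and \<sigma>: "\<sigma> \<in> stops" and \<theta>: "\<theta> \<in> stops" and le: "\<And>\<omega>. \<omega> \<in> space M \<Longrightarrow> \<sigma> \<omega> \<le> \<theta> \<omega>"
    and A: "A \<in> sets (pre_sigma \<sigma>)"
  shows "(\<integral>\<omega>. indicator A \<omega> * V (\<theta> \<omega>) \<omega> \<partial>M) \<le> (\<integral>\<omega>. indicator A \<omega> * V (\<sigma> \<omega>) \<omega> \<partial>M)"
proof (rule LIMSEQ_le)
  have AM: "A \<in> sets M" by (rule pre_sigma_sets_M[OF \<sigma> A])
  note conv = dominated_process_tendsto[OF V AM AM progressive_grid_up_measurable[OF dominated_processD(1)[OF V]]]
  show "(\<lambda>n. \<integral>\<omega>. indicator A \<omega> * V (grid_up n (\<theta> \<omega>)) \<omega> \<partial>M) \<longlonglongrightarrow> (\<integral>\<omega>. indicator A \<omega> * V (\<theta> \<omega>) \<omega> \<partial>M)"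
    by (rule conv[OF \<theta> \<theta>]) (auto intro!: AE_I2 grid_up_tendsto stopsD[OF \<theta>] grid_up_mem simp del: atLeastAtMost_iff)
  show "(\<lambda>n. \<integral>\<omega>. indicator A \<omega> * V (grid_up n (\<sigma> \<omega>)) \<omega> \<partial>M) \<longlonglongrightarrow> (\<integral>\<omega>. indicator A \<omega> * V (\<sigma> \<omega>) \<omega> \<partial>M)"
    by (rule conv[OF \<sigma> \<sigma>]) (auto intro!: AE_I2 grid_up_tendsto stopsD[OF \<sigma>] grid_up_mem simp del: atLeastAtMost_iff)
  have "(\<integral>\<omega>. indicator A \<omega> * V (grid_up n (\<theta> \<omega>)) \<omega> \<partial>M) \<le> (\<integral>\<omega>. indicator A \<omega> * V (grid_up n (\<sigma> \<omega>)) \<omega> \<partial>M)" for n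
  proof -
    \<comment> \<open>The part of \<open>A\<close> on which \<sigma> has stopped is known at the
      grid time by definition of \<open>pre_sigma\<close>; the other factor is the complement of the
      event that \<theta> has stopped.\<close>
    define C where "C k = {\<omega>\<in>A. \<sigma> \<omega> \<le> grid_point n k} \<inter> {\<omega>\<in>space M. grid_point n k < \<theta> \<omega>}" for k
    have C: "C k \<in> sets (F (grid_point n k))" for k
      unfolding C_def using sets_pre_sigmaD[OF stopsD(1)[OF \<sigma>] A] stopping_timeD2[OF stopsD(1)[OF \<theta>]]
      by (intro sets.Int) (auto simp: pred_def space_filt)
    have CM: "C k \<in> sets M" for k using C sets_filt by blast
    have int: "integrable M (\<lambda>\<omega>. indicator (C k) \<omega> * V (grid_point n l) \<omega>)" if "l \<le> Suc n" for k l
      using dominated_process_indicator_integrable[OF V stops_const[OF grid_point_mem[OF that]] CM] by simp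
    have "(\<integral>\<omega>. indicator A \<omega> * V (grid_up n (\<theta> \<omega>)) \<omega> \<partial>M) - (\<integral>\<omega>. indicator A \<omega> * V (grid_up n (\<sigma> \<omega>)) \<omega> \<partial>M)
      = (\<integral>\<omega>. indicator A \<omega> * V (grid_up n (\<theta> \<omega>)) \<omega> - indicator A \<omega> * V (grid_up n (\<sigma> \<omega>)) \<omega> \<partial>M)"
      using dominated_process_grid_up_integrable[OF V _ AM] \<sigma> \<theta> by simp
    also have "\<dots> = (\<integral>\<omega>. (\<Sum>k<Suc n. indicator (C k) \<omega> * V (grid_point n (Suc k)) \<omega> - indicator (C k) \<omega> * V (grid_point n k) \<omega>) \<partial>M)"
    proof (rule Bochner_Integration.integral_cong[OF refl])
      fix \<omega> assume \<omega>: "\<omega> \<in> space M"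
      have "indicator A \<omega> * V (grid_up n (\<theta> \<omega>)) \<omega> - indicator A \<omega> * V (grid_up n (\<sigma> \<omega>)) \<omega>
        = indicator A \<omega> * (\<Sum>k<Suc n. (if \<sigma> \<omega> \<le> grid_point n k \<and> grid_point n k < \<theta> \<omega>
            then V (grid_point n (Suc k)) \<omega> - V (grid_point n k) \<omega> else 0))"
        unfolding grid_up_def right_diff_distrib[symmetric]
        using grid_telescope[OF le[OF \<omega>] stopsD(3)[OF \<theta> \<omega>], of n "\<lambda>k. V (grid_point n k) \<omega>"] by simp
      also have "\<dots> = (\<Sum>k<Suc n. indicator (C k) \<omega> * V (grid_point n (Suc k)) \<omega> - indicator (C k) \<omega> * V (grid_point n k) \<omega>)"
        unfolding sum_distrib_left using \<omega> by (intro sum.cong refl) (auto simp: C_def indicator_def)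
      finally show "indicator A \<omega> * V (grid_up n (\<theta> \<omega>)) \<omega> - indicator A \<omega> * V (grid_up n (\<sigma> \<omega>)) \<omega> = \<dots>" .
    qed
    also have "\<dots> = (\<Sum>k<Suc n. (\<integral>\<omega>. indicator (C k) \<omega> * V (grid_point n (Suc k)) \<omega> \<partial>M) - (\<integral>\<omega>. indicator (C k) \<omega> * V (grid_point n k) \<omega> \<partial>M))"
    proof (subst Bochner_Integration.integral_sum)
      show "(\<Sum>k<Suc n. \<integral>\<omega>. indicator (C k) \<omega> * V (grid_point n (Suc k)) \<omega> - indicator (C k) \<omega> * V (grid_point n k) \<omega> \<partial>M)
        = (\<Sum>k<Suc n. (\<integral>\<omega>. indicator (C k) \<omega> * V (grid_point n (Suc k)) \<omega> \<partial>M) - (\<integral>\<omega>. indicator (C k) \<omega> * V (grid_point n k) \<omega> \<partial>M))"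
        by (intro sum.cong refl Bochner_Integration.integral_diff int) auto
    qed (auto intro!: Bochner_Integration.integrable_diff int)
    also have "\<dots> \<le> 0"
    proof (rule sum_nonpos)
      fix k assume "k \<in> {..<Suc n}"
      then have "grid_point n k \<in> {0..T}" "grid_point n (Suc k) \<in> {grid_point n k..T}"
        using grid_point_mem[of k n] grid_point_mem[of "Suc k" n] grid_point_mono[of k "Suc k" n] by auto
      then have "(\<integral>\<omega>. indicator (C k) \<omega> * V (grid_point n (Suc k)) \<omega> \<partial>M) \<le> (\<integral>\<omega>. indicator (C k) \<omega> * V (grid_point n k) \<omega> \<partial>M)"
        using super C[of k] unfolding supermartingale_def by blast
      then show "(\<integral>\<omega>. indicator (C k) \<omega> * V (grid_point n (Suc k)) \<omega> \<partial>M) - (\<integral>\<omega>. indicator (C k) \<omega> * V (grid_point n k) \<omega> \<partial>M) \<le> 0"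
        by simp
    qed
    finally show ?thesis by simp
  qed
  then show "\<exists>N. \<forall>n\<ge>N. (\<integral>\<omega>. indicator A \<omega> * V (grid_up n (\<theta> \<omega>)) \<omega> \<partial>M) \<le> (\<integral>\<omega>. indicator A \<omega> * V (grid_up n (\<sigma> \<omega>)) \<omega> \<partial>M)"
    by blast
qed

end

section \<open>Optimal stopping\<close>

lemma integral_split_indicator:
  fixes h :: "'a \<Rightarrow> real"
  assumes "A \<in> sets M" "integrable M h"
  shows "(\<integral>\<omega>. h \<omega> \<partial>M) = (\<integral>\<omega>. indicator A \<omega> * h \<omega> \<partial>M) + (\<integral>\<omega>. indicator (space M - A) \<omega> * h \<omega> \<partial>M)"
proof -
  have "(\<integral>\<omega>. h \<omega> \<partial>M) = (\<integral>\<omega>. indicator A \<omega> * h \<omega> + indicator (space M - A) \<omega> * h \<omega> \<partial>M)"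
    by (intro Bochner_Integration.integral_cong refl) (auto simp: indicator_def)
  then show ?thesis
    using integrable_mult_indicator[OF assms] integrable_mult_indicator[OF sets.compl_sets[OF assms(1)] assms(2)] by simp
qed

text \<open>For an upwards directed family the integral of the essential supremum is the supremum of
  the integrals. The running maxima of a maximising sequence increase to some \<open>W\<close>. A
  member exceeding \<open>W\<close> on a set of positive measure would push the integral of its
  maximum with \<open>W\<close> above that supremum; so \<open>W\<close> is an upper bound, and
  minimality of \<open>Z\<close> gives \<open>Z \<le> W\<close>.\<close>

lemma (in prob_space) ess_sup_integral_approx:
  assumes ess: "is_ess_sup M S Z" and Z: "integrable M Z" and S: "\<And>f. f \<in> S \<Longrightarrow> integrable M f" "S \<noteq> {}"
    and directed: "\<And>f g. f \<in> S \<Longrightarrow> g \<in> S \<Longrightarrow> \<exists>h\<in>S. AE \<omega> in M. h \<omega> = max (f \<omega>) (g \<omega>)"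
    and "0 < \<epsilon>"
  shows "\<exists>f\<in>S. (\<integral>\<omega>. Z \<omega> \<partial>M) - \<epsilon> < (\<integral>\<omega>. f \<omega> \<partial>M)"
proof -
  define \<alpha> where "\<alpha> = (SUP f\<in>S. \<integral>\<omega>. f \<omega> \<partial>M)"
  have upper: "AE \<omega> in M. f \<omega> \<le> Z \<omega>" if "f \<in> S" for f
    using ess that by (auto simp: is_ess_sup_def)
  have bdd: "bdd_above ((\<lambda>f. \<integral>\<omega>. f \<omega> \<partial>M) ` S)"
    using integral_mono_AE[OF S(1) Z upper] by (intro bdd_aboveI2) auto
  have le_\<alpha>: "(\<integral>\<omega>. f \<omega> \<partial>M) \<le> \<alpha>" if "f \<in> S" for f
    unfolding \<alpha>_def by (rule cSUP_upper[OF that bdd])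
  have "\<exists>f\<in>S. \<alpha> - 1 / Suc n < (\<integral>\<omega>. f \<omega> \<partial>M)" for n :: nat
    using less_cSUP_iff[OF S(2) bdd, of "\<alpha> - 1 / Suc n"] by (simp add: \<alpha>_def)
  then obtain f where f: "\<And>n. f n \<in> S" "\<And>n::nat. \<alpha> - 1 / Suc n < (\<integral>\<omega>. f n \<omega> \<partial>M)"
    by metis
  have f_meas[measurable]: "f n \<in> borel_measurable M" for n using S(1)[OF f(1)] by auto
  define z where "z n = (\<lambda>\<omega>. Max ((\<lambda>k. f k \<omega>) ` {..n}))" for n
  have z_meas[measurable]: "z n \<in> borel_measurable M" for n
    unfolding z_def by (rule borel_measurable_Max) auto
  have z_Suc: "z (Suc n) \<omega> = max (f (Suc n) \<omega>) (z n \<omega>)" for n \<omega>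
    by (simp add: z_def atMost_Suc)
  have z_in: "\<exists>h\<in>S. AE \<omega> in M. h \<omega> = z n \<omega>" for n
  proof (induction n)
    case 0
    then show ?case using f(1)[of 0] by (auto simp: z_def)
  next
    case (Suc n)
    then obtain h where h: "h \<in> S" "AE \<omega> in M. h \<omega> = z n \<omega>" by blast
    obtain h' where h': "h' \<in> S" "AE \<omega> in M. h' \<omega> = max (f (Suc n) \<omega>) (h \<omega>)"
      using directed[OF f(1) h(1)] by blast
    have "AE \<omega> in M. h' \<omega> = z (Suc n) \<omega>"
      using h(2) h'(2) by eventually_elim (simp add: z_Suc)
    then show ?case using h'(1) by blast
  qed
  have z_mono: "incseq (\<lambda>n. z n \<omega>)" for \<omega>
    by (rule incseq_SucI) (simp add: z_Suc)
  have z_ge: "f n \<omega> \<le> z n \<omega>" for n \<omega> unfolding z_def by (rule Max_ge) auto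
  have z_le: "AE \<omega> in M. \<forall>n. z n \<omega> \<le> Z \<omega>"
  proof (subst AE_all_countable, rule allI)
    fix n
    obtain h where "h \<in> S" "AE \<omega> in M. h \<omega> = z n \<omega>" using z_in by blast
    from upper[OF this(1)] this(2) show "AE \<omega> in M. z n \<omega> \<le> Z \<omega>"
      by eventually_elim simp
  qed
  \<comment> \<open>Since \<open>z n \<le> Z\<close> is known only almost everywhere, the minimum
    with \<open>Z\<close> keeps the supremum bounded at every point, as measurability of a real
    supremum requires.\<close>
  define W where "W = (\<lambda>\<omega>. SUP n. min (z n \<omega>) (Z \<omega>))"
  have bdd_z: "bdd_above (range (\<lambda>n. min (z n \<omega>) (Z \<omega>)))" for \<omega>
    by (rule bdd_aboveI2[where M="Z \<omega>"]) simp
  have W_meas[measurable]: "W \<in> borel_measurable M"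
    unfolding W_def using borel_measurable_integrable[OF Z] bdd_z
    by (intro borel_measurable_cSUP) auto
  have W: "AE \<omega> in M. (\<lambda>n. z n \<omega>) \<longlonglongrightarrow> W \<omega> \<and> (\<forall>n. z n \<omega> \<le> W \<omega>) \<and> W \<omega> \<le> Z \<omega>"
    using z_le
  proof eventually_elim
    case (elim \<omega>)
    then have eq: "min (z n \<omega>) (Z \<omega>) = z n \<omega>" for n by simp
    show ?case
      using LIMSEQ_incseq_SUP[OF bdd_z[of \<omega>, unfolded eq] z_mono] cSUP_upper[OF _ bdd_z[of \<omega>, unfolded eq]]
        cSUP_least[of UNIV "\<lambda>n. z n \<omega>" "Z \<omega>"] elim
      by (auto simp: W_def eq)
  qed
  \<comment> \<open>By directedness the maximum of g with a running maximum is almost everywhere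
    again a member of the family, so its integral is at most \<alpha>. Dominated convergence passes
    this on to \<open>W\<close>.\<close>
  have maxlim: "integrable M (\<lambda>\<omega>. max (g \<omega>) (W \<omega>))" "(\<integral>\<omega>. max (g \<omega>) (W \<omega>) \<partial>M) \<le> \<alpha>" if g: "g \<in> S" for g
  proof -
    note [measurable] = borel_measurable_integrable[OF S(1)[OF g]] borel_measurable_integrable[OF Z]
    have dom: "AE \<omega> in M. \<bar>max (g \<omega>) (z n \<omega>)\<bar> \<le> \<bar>g \<omega>\<bar> + \<bar>Z \<omega>\<bar>" for n
      using z_le upper[OF g]
      by eventually_elim (auto simp: max_def abs_le_iff dest!: spec[of _ n])
    have i: "integrable M (\<lambda>\<omega>. \<bar>g \<omega>\<bar> + \<bar>Z \<omega>\<bar>)" using S(1)[OF g] Z by auto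
    have lim: "AE \<omega> in M. (\<lambda>n. max (g \<omega>) (z n \<omega>)) \<longlonglongrightarrow> max (g \<omega>) (W \<omega>)"
      using W by eventually_elim (auto intro!: tendsto_max)
    have conv: "(\<lambda>n. \<integral>\<omega>. max (g \<omega>) (z n \<omega>) \<partial>M) \<longlonglongrightarrow> (\<integral>\<omega>. max (g \<omega>) (W \<omega>) \<partial>M)"
      by (rule integral_dominated_convergence[OF _ _ i lim]) (use dom in auto)
    show "integrable M (\<lambda>\<omega>. max (g \<omega>) (W \<omega>))"
      by (rule integrable_dominated_convergence[OF _ _ i lim]) (use dom in auto)
    have "(\<integral>\<omega>. max (g \<omega>) (z n \<omega>) \<partial>M) \<le> \<alpha>" for n
    proof -
      obtain h where h: "h \<in> S" "AE \<omega> in M. h \<omega> = z n \<omega>" using z_in by blast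
      obtain h' where h': "h' \<in> S" "AE \<omega> in M. h' \<omega> = max (g \<omega>) (h \<omega>)"
        using directed[OF g h(1)] by blast
      note [measurable] = borel_measurable_integrable[OF S(1)[OF h'(1)]]
      have "(\<integral>\<omega>. max (g \<omega>) (z n \<omega>) \<partial>M) = (\<integral>\<omega>. h' \<omega> \<partial>M)"
        using h(2) h'(2) by (intro integral_cong_AE) auto
      then show ?thesis using le_\<alpha>[OF h'(1)] by simp
    qed
    then show "(\<integral>\<omega>. max (g \<omega>) (W \<omega>) \<partial>M) \<le> \<alpha>"
      by (intro LIMSEQ_le_const2[OF conv]) blast
  qed
  have W_int: "integrable M W"
  proof -
    have "AE \<omega> in M. max (f 0 \<omega>) (W \<omega>) = W \<omega>"
      using W by eventually_elim (use z_ge[of 0] in \<open>force simp: max_def intro: order_trans\<close>)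
    from integrable_cong_AE[OF _ _ this] maxlim(1)[OF f(1)[of 0]] show ?thesis by simp
  qed
  have W_ge: "\<alpha> \<le> (\<integral>\<omega>. W \<omega> \<partial>M)"
  proof (rule LIMSEQ_le_const2)
    show "(\<lambda>n. \<alpha> - inverse (real (Suc n))) \<longlonglongrightarrow> \<alpha>"
      using tendsto_diff[OF tendsto_const LIMSEQ_inverse_real_of_nat] by simp
    have "\<alpha> - inverse (real (Suc n)) \<le> (\<integral>\<omega>. W \<omega> \<partial>M)" for n
    proof -
      have "(\<integral>\<omega>. f n \<omega> \<partial>M) \<le> (\<integral>\<omega>. W \<omega> \<partial>M)"
        using W by (intro integral_mono_AE S(1)[OF f(1)] W_int, eventually_elim)
          (use z_ge[of n] in \<open>blast intro: order_trans\<close>)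
      then show ?thesis using f(2)[of n] by (simp add: inverse_eq_divide)
    qed
    then show "\<exists>N. \<forall>n\<ge>N. \<alpha> - inverse (real (Suc n)) \<le> (\<integral>\<omega>. W \<omega> \<partial>M)" by blast
  qed
  have "AE \<omega> in M. g \<omega> \<le> W \<omega>" if g: "g \<in> S" for g
  proof -
    have i: "integrable M (\<lambda>\<omega>. max (g \<omega>) (W \<omega>) - W \<omega>)"
      using maxlim(1)[OF g] W_int by simp
    have "(\<integral>\<omega>. max (g \<omega>) (W \<omega>) - W \<omega> \<partial>M) \<le> 0"
      using maxlim[OF g] W_int W_ge by simp
    moreover have "0 \<le> (\<integral>\<omega>. max (g \<omega>) (W \<omega>) - W \<omega> \<partial>M)" by (intro Bochner_Integration.integral_nonneg) simp
    ultimately have "(\<integral>\<omega>. max (g \<omega>) (W \<omega>) - W \<omega> \<partial>M) = 0" by linarith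
    then have "AE \<omega> in M. max (g \<omega>) (W \<omega>) - W \<omega> = 0"
      by (subst (asm) integral_nonneg_eq_0_iff_AE[OF i]) auto
    then show ?thesis by eventually_elim (simp add: max_def split: if_splits)
  qed
  then have "AE \<omega> in M. Z \<omega> \<le> W \<omega>" using ess W_meas unfolding is_ess_sup_def by blast
  then have "(\<integral>\<omega>. Z \<omega> \<partial>M) \<le> (\<integral>\<omega>. W \<omega> \<partial>M)" by (intro integral_mono_AE Z W_int)
  also have "\<dots> \<le> (\<integral>\<omega>. max (f 0 \<omega>) (W \<omega>) \<partial>M)"
    by (intro integral_mono W_int maxlim(1) f) auto
  also have "\<dots> \<le> \<alpha>" by (intro maxlim f)
  finally have Z_\<alpha>: "(\<integral>\<omega>. Z \<omega> \<partial>M) \<le> \<alpha>" .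
  obtain n :: nat where "1 / Suc n < \<epsilon>" using \<open>0 < \<epsilon>\<close> nat_approx_posE by blast
  then have "(\<integral>\<omega>. Z \<omega> \<partial>M) - \<epsilon> < (\<integral>\<omega>. f n \<omega> \<partial>M)" using Z_\<alpha> f(2)[of n] by linarith
  then show ?thesis using f(1) by blast
qed

section \<open>The Snell envelope of a single obstacle\<close>

locale optimal_stopping = filtered_prob_space M F T for M :: "'a measure" and F T +
  fixes f L Y :: "real \<Rightarrow> 'a \<Rightarrow> real" and UI UL UY :: "'a \<Rightarrow> real"
  assumes f_cont: "\<And>\<omega>. \<omega> \<in> space M \<Longrightarrow> continuous_on {0..T} (\<lambda>t. f t \<omega>)"
    and I_dom: "dominated_process (\<lambda>t \<omega>. integral {0..t} (\<lambda>s. f s \<omega>)) UI"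
    and L_dom: "dominated_process L UL"
    and Y_dom: "dominated_process Y UY"
    and Y_T: "\<And>\<omega>. \<omega> \<in> space M \<Longrightarrow> Y T \<omega> = 0"
    and L_T: "\<And>\<omega>. \<omega> \<in> space M \<Longrightarrow> L T \<omega> \<le> 0"
    and snell: "\<And>t. t \<in> {0..T} \<Longrightarrow> is_ess_sup M
        {real_cond_exp M (F t)
           (\<lambda>\<omega>. integral {t..\<theta> \<omega>} (\<lambda>s. f s \<omega>) + (if \<theta> \<omega> < T then L (\<theta> \<omega>) \<omega> else 0))
         | \<theta>. \<theta> \<in> stopping_times_from M F T (\<lambda>_. t)}
        (Y t)"
begin

definition I :: "real \<Rightarrow> 'a \<Rightarrow> real" where "I t \<omega> = integral {0..t} (\<lambda>s. f s \<omega>)"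

definition V :: "real \<Rightarrow> 'a \<Rightarrow> real" where "V t \<omega> = Y t \<omega> + I t \<omega>"

text \<open>Profit is counted from time 0 rather than from the starting time, so one functional
  serves every t. Waiting until T collects no obstacle, in accordance with
  \<open>Y T \<omega> = 0\<close>.\<close>

definition reward :: "('a \<Rightarrow> real) \<Rightarrow> 'a \<Rightarrow> real" where
  "reward \<theta> \<omega> = I (\<theta> \<omega>) \<omega> + (if \<theta> \<omega> < T then L (\<theta> \<omega>) \<omega> else 0)"

lemma I_dom': "dominated_process I UI"
  using I_dom by (simp add: I_def[abs_def])

lemma V_dom: "dominated_process V (\<lambda>\<omega>. UY \<omega> + UI \<omega>)"
  unfolding dominated_process_def
proof (intro conjI ballI)
  note D = dominated_processD[OF Y_dom] dominated_processD[OF I_dom']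
  show "progressive F T V" unfolding V_def[abs_def] by (rule progressive_add) (rule D)+
  show "square_integrable M (\<lambda>\<omega>. UY \<omega> + UI \<omega>)" by (rule square_integrable_add) (rule D)+
  fix \<omega> assume \<omega>: "\<omega> \<in> space M"
  show "continuous_on {0..T} (\<lambda>t. V t \<omega>)"
    unfolding V_def by (intro continuous_on_add D \<omega>)
  fix t assume "t \<in> {0..T}"
  then show "\<bar>V t \<omega>\<bar> \<le> UY \<omega> + UI \<omega>"
    unfolding V_def using D(4)[OF \<omega>, of t] D(8)[OF \<omega>, of t] by auto
qed

lemma stops_from_stops: "0 \<le> t \<Longrightarrow> \<theta> \<in> stopping_times_from M F T (\<lambda>_. t) \<Longrightarrow> \<theta> \<in> stops"
  by (force simp: stopping_times_from_def)

lemma stops_from_mono: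
  "s \<le> t \<Longrightarrow> \<theta> \<in> stopping_times_from M F T (\<lambda>_. t) \<Longrightarrow> \<theta> \<in> stopping_times_from M F T (\<lambda>_. s)"
  by (force simp: stopping_times_from_def)

lemma stops_from_const: "t \<le> u \<Longrightarrow> u \<le> T \<Longrightarrow> (\<lambda>_. u) \<in> stopping_times_from M F T (\<lambda>_. t)"
  by (simp add: stopping_times_from_def stopping_time_const)

lemma reward_sq:
  assumes \<theta>: "\<theta> \<in> stops"
  shows "square_integrable M (reward \<theta>)"
  unfolding reward_def[abs_def]
proof (rule square_integrable_add[OF dominated_process_stopped[OF I_dom' \<theta>]])
  note [measurable] = stops_measurable[OF \<theta>] square_integrableD(1)[OF dominated_process_stopped[OF L_dom \<theta>]]
  show "square_integrable M (\<lambda>\<omega>. if \<theta> \<omega> < T then L (\<theta> \<omega>) \<omega> else 0)"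
    by (rule square_integrable_bound[OF dominated_process_stopped[OF L_dom \<theta>]]) auto
qed

lemma running_reward_eq:
  assumes "0 \<le> t" "\<theta> \<in> stopping_times_from M F T (\<lambda>_. t)" "\<omega> \<in> space M"
  shows "integral {t..\<theta> \<omega>} (\<lambda>s. f s \<omega>) + (if \<theta> \<omega> < T then L (\<theta> \<omega>) \<omega> else 0) = reward \<theta> \<omega> - I t \<omega>"
proof -
  have \<theta>: "t \<le> \<theta> \<omega>" "\<theta> \<omega> \<le> T" using assms(2,3) by (auto simp: stopping_times_from_def)
  have "(\<lambda>s. f s \<omega>) integrable_on {0..\<theta> \<omega>}"
    using \<theta> by (intro integrable_continuous_real continuous_on_subset[OF f_cont[OF assms(3)]]) auto
  then have "integral {0..t} (\<lambda>s. f s \<omega>) + integral {t..\<theta> \<omega>} (\<lambda>s. f s \<omega>) = integral {0..\<theta> \<omega>} (\<lambda>s. f s \<omega>)"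
    by (intro Henstock_Kurzweil_Integration.integral_combine assms(1) \<theta>)
  then show ?thesis by (simp add: reward_def I_def)
qed

lemma running_reward_integrable:
  assumes "t \<in> {0..T}" "\<theta> \<in> stopping_times_from M F T (\<lambda>_. t)"
  shows "integrable M (\<lambda>\<omega>. integral {t..\<theta> \<omega>} (\<lambda>s. f s \<omega>) + (if \<theta> \<omega> < T then L (\<theta> \<omega>) \<omega> else 0))"
proof -
  have "\<theta> \<in> stops" using assms by (intro stops_from_stops) auto
  then have "integrable M (\<lambda>\<omega>. reward \<theta> \<omega> - I t \<omega>)"
    using square_integrable_integrable[OF dominated_process_stopped[OF I_dom' stops_const[OF assms(1)]]]
      square_integrable_integrable[OF reward_sq] by auto
  then show ?thesis
    using running_reward_eq[OF _ assms(2)] assms(1)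
    by (subst Bochner_Integration.integrable_cong[OF refl, of _ _ "\<lambda>\<omega>. reward \<theta> \<omega> - I t \<omega>"]) auto
qed

lemma filt_finite_measure_subalgebra: "finite_measure_subalgebra M (F t)"
  by (simp add: finite_measure_subalgebra_def finite_measure_axioms
      finite_measure_subalgebra_axioms_def subalgebra_filt)

text \<open>The upper bound half of the Snell equation, integrated over an event known at t after
  adding the profit up to t on both sides.\<close>

lemma reward_integral_le:
  assumes t: "t \<in> {0..T}" and \<theta>: "\<theta> \<in> stopping_times_from M F T (\<lambda>_. t)" and A: "A \<in> sets (F t)"
  shows "(\<integral>\<omega>. indicator A \<omega> * reward \<theta> \<omega> \<partial>M) \<le> (\<integral>\<omega>. indicator A \<omega> * V t \<omega> \<partial>M)"
proof -
  interpret finite_measure_subalgebra M "F t" by (rule filt_finite_measure_subalgebra)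
  let ?R = "\<lambda>\<omega>. integral {t..\<theta> \<omega>} (\<lambda>s. f s \<omega>) + (if \<theta> \<omega> < T then L (\<theta> \<omega>) \<omega> else 0)"
  have AM: "A \<in> sets M" using A sets_filt by blast
  have \<theta>': "\<theta> \<in> stops" using t \<theta> by (intro stops_from_stops) auto
  note R = running_reward_integrable[OF t \<theta>]
  have Yt: "integrable M (\<lambda>\<omega>. indicator A \<omega> * Y t \<omega>)" and It: "integrable M (\<lambda>\<omega>. indicator A \<omega> * I t \<omega>)"
    using dominated_process_indicator_integrable[OF Y_dom stops_const[OF t] AM]
      dominated_process_indicator_integrable[OF I_dom' stops_const[OF t] AM] by auto
  have RA: "integrable M (\<lambda>\<omega>. indicator A \<omega> * ?R \<omega>)"
    using integrable_mult_indicator[OF AM R] by simp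
  have ce: "integrable M (\<lambda>\<omega>. indicator A \<omega> * real_cond_exp M (F t) ?R \<omega>)"
    "(\<integral>\<omega>. indicator A \<omega> * real_cond_exp M (F t) ?R \<omega> \<partial>M) = (\<integral>\<omega>. indicator A \<omega> * ?R \<omega> \<partial>M)"
    using real_cond_exp_intg[OF RA] A R by auto
  have "AE \<omega> in M. real_cond_exp M (F t) ?R \<omega> \<le> Y t \<omega>"
    using snell[OF t] \<theta> unfolding is_ess_sup_def by blast
  then have "(\<integral>\<omega>. indicator A \<omega> * real_cond_exp M (F t) ?R \<omega> \<partial>M) \<le> (\<integral>\<omega>. indicator A \<omega> * Y t \<omega> \<partial>M)"
    by (intro integral_mono_AE ce Yt, eventually_elim) (auto simp: indicator_def)
  then have "(\<integral>\<omega>. indicator A \<omega> * ?R \<omega> \<partial>M) + (\<integral>\<omega>. indicator A \<omega> * I t \<omega> \<partial>M)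
     \<le> (\<integral>\<omega>. indicator A \<omega> * Y t \<omega> \<partial>M) + (\<integral>\<omega>. indicator A \<omega> * I t \<omega> \<partial>M)"
    using ce(2) by simp
  also have "(\<integral>\<omega>. indicator A \<omega> * Y t \<omega> \<partial>M) + (\<integral>\<omega>. indicator A \<omega> * I t \<omega> \<partial>M) = (\<integral>\<omega>. indicator A \<omega> * V t \<omega> \<partial>M)"
    using Yt It by (simp add: V_def distrib_left)
  also have "(\<integral>\<omega>. indicator A \<omega> * ?R \<omega> \<partial>M) + (\<integral>\<omega>. indicator A \<omega> * I t \<omega> \<partial>M) = (\<integral>\<omega>. indicator A \<omega> * ?R \<omega> + indicator A \<omega> * I t \<omega> \<partial>M)"
    using RA It by (rule Bochner_Integration.integral_add[symmetric])
  also have "\<dots> = (\<integral>\<omega>. indicator A \<omega> * reward \<theta> \<omega> \<partial>M)"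
  proof (rule Bochner_Integration.integral_cong[OF refl])
    fix \<omega> assume "\<omega> \<in> space M"
    then show "indicator A \<omega> * ?R \<omega> + indicator A \<omega> * I t \<omega> = indicator A \<omega> * reward \<theta> \<omega>"
      using running_reward_eq[of t \<theta> \<omega>] t \<theta> by (simp add: distrib_left[symmetric] del: distrib_left)
  qed
  finally show ?thesis .
qed

lemma stops_from_if:
  assumes \<theta>: "\<theta> \<in> stopping_times_from M F T (\<lambda>_. t)" and \<theta>': "\<theta>' \<in> stopping_times_from M F T (\<lambda>_. t)"
    and B: "B \<in> sets (F t)"
  shows "(\<lambda>\<omega>. if \<omega> \<in> B then \<theta> \<omega> else \<theta>' \<omega>) \<in> stopping_times_from M F T (\<lambda>_. t)"
proof -
  have "stopping_time F (\<lambda>\<omega>. if \<omega> \<in> B then \<theta> \<omega> else \<theta>' \<omega>)"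
  proof (rule stopping_timeI)
    fix u
    have *: "Measurable.pred (F u) (\<lambda>\<omega>. \<theta> \<omega> \<le> u)" "Measurable.pred (F u) (\<lambda>\<omega>. \<theta>' \<omega> \<le> u)"
      using \<theta> \<theta>' by (auto simp: stopping_times_from_def intro: stopping_timeD)
    show "Measurable.pred (F u) (\<lambda>\<omega>. (if \<omega> \<in> B then \<theta> \<omega> else \<theta>' \<omega>) \<le> u)"
    proof (cases "t \<le> u")
      case True
      then have [measurable]: "B \<in> sets (F u)" using B sets_filt_mono by blast
      have "Measurable.pred (F u) (\<lambda>\<omega>. if \<omega> \<in> B then \<theta> \<omega> \<le> u else \<theta>' \<omega> \<le> u)"
        using * by measurable
      also have "(\<lambda>\<omega>. if \<omega> \<in> B then \<theta> \<omega> \<le> u else \<theta>' \<omega> \<le> u) = (\<lambda>\<omega>. (if \<omega> \<in> B then \<theta> \<omega> else \<theta>' \<omega>) \<le> u)"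
        by auto
      finally show ?thesis .
    next
      \<comment> \<open>Before t neither stopping time has occurred, so the event is empty;
        \<open>B\<close> is known only from t on.\<close>
      case False
      have "{\<omega>\<in>space (F u). (if \<omega> \<in> B then \<theta> \<omega> else \<theta>' \<omega>) \<le> u} = {}"
        using \<theta> \<theta>' False by (force simp: space_filt stopping_times_from_def)
      then show ?thesis by (simp only: pred_def sets.empty_sets)
    qed
  qed
  then show ?thesis using \<theta> \<theta>' by (auto simp: stopping_times_from_def)
qed

text \<open>The least upper bound half of the Snell equation. The conditional rewards form an
  upwards directed family because two stopping times can be pasted together along the event, known
  at t, on which one conditional reward is at least the other.\<close>

lemma near_optimal:
  assumes t: "t \<in> {0..T}" and "0 < \<epsilon>"
  shows "\<exists>\<theta>\<in>stopping_times_from M F T (\<lambda>_. t). (\<integral>\<omega>. V t \<omega> \<partial>M) - \<epsilon> < (\<integral>\<omega>. reward \<theta> \<omega> \<partial>M)"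
proof -
  interpret finite_measure_subalgebra M "F t" by (rule filt_finite_measure_subalgebra)
  let ?ST = "stopping_times_from M F T (\<lambda>_. t)"
  define R where "R \<theta> \<omega> = integral {t..\<theta> \<omega>} (\<lambda>s. f s \<omega>) + (if \<theta> \<omega> < T then L (\<theta> \<omega>) \<omega> else 0)" for \<theta> \<omega>
  define S where "S = {real_cond_exp M (F t) (R \<theta>) | \<theta>. \<theta> \<in> ?ST}"
  have R: "integrable M (R \<theta>)" if "\<theta> \<in> ?ST" for \<theta>
    using running_reward_integrable[OF t that] by (simp add: R_def[abs_def])
  have It: "integrable M (I t)"
    using square_integrable_integrable[OF dominated_process_stopped[OF I_dom' stops_const[OF t]]] by simp
  have Yt: "integrable M (Y t)"
    using square_integrable_integrable[OF dominated_process_stopped[OF Y_dom stops_const[OF t]]] by simp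
  have "\<exists>g\<in>S. (\<integral>\<omega>. Y t \<omega> \<partial>M) - \<epsilon> < (\<integral>\<omega>. g \<omega> \<partial>M)"
  proof (rule ess_sup_integral_approx)
    show "is_ess_sup M S (Y t)"
      using snell[OF t] by (simp add: S_def R_def[abs_def])
    show "integrable M (Y t)" by (rule Yt)
    show "integrable M g" if "g \<in> S" for g
      using that real_cond_exp_int(1)[OF R] by (auto simp: S_def)
    show "S \<noteq> {}" using stops_from_const[of t T] t by (auto simp: S_def)
    show "\<exists>h\<in>S. AE \<omega> in M. h \<omega> = max (g \<omega>) (g' \<omega>)" if gS: "g \<in> S" "g' \<in> S" for g g'
    proof -
      obtain \<theta> \<theta>' where \<theta>: "\<theta> \<in> ?ST" "g = real_cond_exp M (F t) (R \<theta>)"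
        and \<theta>': "\<theta>' \<in> ?ST" "g' = real_cond_exp M (F t) (R \<theta>')"
        using gS by (auto simp: S_def)
      have [measurable]: "g \<in> borel_measurable (F t)" "g' \<in> borel_measurable (F t)"
        unfolding \<theta> \<theta>' by auto
      define B where "B = {\<omega>\<in>space (F t). g' \<omega> \<le> g \<omega>}"
      have B: "B \<in> sets (F t)" unfolding B_def by measurable
      then have BM[measurable]: "B \<in> sets M" using sets_filt by blast
      define \<kappa> where "\<kappa> = (\<lambda>\<omega>. if \<omega> \<in> B then \<theta> \<omega> else \<theta>' \<omega>)"
      have \<kappa>: "\<kappa> \<in> ?ST" unfolding \<kappa>_def by (rule stops_from_if[OF \<theta>(1) \<theta>'(1) B])
      \<comment> \<open>The conditional reward of the pasted time is identified by its integrals: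
        each event known at t is cut along \<open>B\<close>, and on either piece the pasted reward
        is one of the two given ones.\<close>
      have "AE \<omega> in M. real_cond_exp M (F t) (R \<kappa>) \<omega> = max (g \<omega>) (g' \<omega>)"
      proof (rule real_cond_exp_charact)
        have gi: "integrable M g" "integrable M g'" unfolding \<theta> \<theta>'
          by (auto intro!: real_cond_exp_int(1) R \<theta>(1) \<theta>'(1))
        then show "integrable M (\<lambda>\<omega>. max (g \<omega>) (g' \<omega>))" by (rule Bochner_Integration.integrable_max)
        show "integrable M (R \<kappa>)" by (rule R[OF \<kappa>])
        show "(\<lambda>\<omega>. max (g \<omega>) (g' \<omega>)) \<in> borel_measurable (F t)" by measurable
        fix A assume A: "A \<in> sets (F t)"
        then have AM: "A \<in> sets M" using sets_filt by blast
        have AB: "A \<inter> B \<in> sets (F t)" "A - B \<in> sets (F t)" using A B by auto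
        have ABM: "A \<inter> B \<in> sets M" "A - B \<in> sets M" using AM BM by auto
        have e1: "(\<integral>\<omega>. indicator (A \<inter> B) \<omega> * R \<theta> \<omega> \<partial>M) = (\<integral>\<omega>. indicator (A \<inter> B) \<omega> * g \<omega> \<partial>M)"
          unfolding \<theta>(2) using real_cond_exp_intA[OF R[OF \<theta>(1)] AB(1)] by (simp add: set_lebesgue_integral_def)
        have e2: "(\<integral>\<omega>. indicator (A - B) \<omega> * R \<theta>' \<omega> \<partial>M) = (\<integral>\<omega>. indicator (A - B) \<omega> * g' \<omega> \<partial>M)"
          unfolding \<theta>'(2) using real_cond_exp_intA[OF R[OF \<theta>'(1)] AB(2)] by (simp add: set_lebesgue_integral_def)
        have ints: "integrable M (\<lambda>\<omega>. indicator (A \<inter> B) \<omega> * R \<theta> \<omega>)" "integrable M (\<lambda>\<omega>. indicator (A - B) \<omega> * R \<theta>' \<omega>)"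
          "integrable M (\<lambda>\<omega>. indicator (A \<inter> B) \<omega> * g \<omega>)" "integrable M (\<lambda>\<omega>. indicator (A - B) \<omega> * g' \<omega>)"
          using integrable_mult_indicator[OF ABM(1) R[OF \<theta>(1)]] integrable_mult_indicator[OF ABM(2) R[OF \<theta>'(1)]]
            integrable_mult_indicator[OF ABM(1) gi(1)] integrable_mult_indicator[OF ABM(2) gi(2)] by simp_all
        have "set_lebesgue_integral M A (R \<kappa>)
          = (\<integral>\<omega>. indicator (A \<inter> B) \<omega> * R \<theta> \<omega> + indicator (A - B) \<omega> * R \<theta>' \<omega> \<partial>M)"
          unfolding set_lebesgue_integral_def
          by (intro Bochner_Integration.integral_cong refl) (auto simp: \<kappa>_def R_def indicator_def)
        also have "\<dots> = (\<integral>\<omega>. indicator (A \<inter> B) \<omega> * g \<omega> + indicator (A - B) \<omega> * g' \<omega> \<partial>M)"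
          using e1 e2 ints by simp
        also have "\<dots> = set_lebesgue_integral M A (\<lambda>\<omega>. max (g \<omega>) (g' \<omega>))"
          unfolding set_lebesgue_integral_def
          by (intro Bochner_Integration.integral_cong refl) (auto simp: B_def indicator_def space_filt)
        finally show "set_lebesgue_integral M A (R \<kappa>) = set_lebesgue_integral M A (\<lambda>\<omega>. max (g \<omega>) (g' \<omega>))" .
      qed
      then show ?thesis using \<kappa> unfolding S_def by blast
    qed
  qed fact
  then obtain \<theta> where \<theta>: "\<theta> \<in> ?ST" and lt: "(\<integral>\<omega>. Y t \<omega> \<partial>M) - \<epsilon> < (\<integral>\<omega>. real_cond_exp M (F t) (R \<theta>) \<omega> \<partial>M)"
    by (auto simp: S_def)
  have \<theta>s: "\<theta> \<in> stops" using \<theta> t by (intro stops_from_stops) auto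
  have "(\<integral>\<omega>. real_cond_exp M (F t) (R \<theta>) \<omega> \<partial>M) = (\<integral>\<omega>. R \<theta> \<omega> \<partial>M)"
    by (rule real_cond_exp_int(2)[OF R[OF \<theta>]])
  also have "\<dots> = (\<integral>\<omega>. reward \<theta> \<omega> - I t \<omega> \<partial>M)"
    using running_reward_eq[OF _ \<theta>] t by (intro Bochner_Integration.integral_cong refl) (auto simp: R_def)
  also have "\<dots> = (\<integral>\<omega>. reward \<theta> \<omega> \<partial>M) - (\<integral>\<omega>. I t \<omega> \<partial>M)"
    using It square_integrable_integrable[OF reward_sq[OF \<theta>s]] by simp
  finally have "(\<integral>\<omega>. V t \<omega> \<partial>M) - \<epsilon> < (\<integral>\<omega>. reward \<theta> \<omega> \<partial>M)"
    using lt It Yt by (simp add: V_def)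
  then show ?thesis using \<theta> by blast
qed

text \<open>Near optimality compares integrals over the whole space only. Subtracting the upper
  bound \<open>reward_integral_le\<close> on the complement of \<open>A\<close> localises it to
  \<open>A\<close> with the same error, and a stopping time after t also competes from the earlier
  time s.\<close>

lemma V_supermartingale: "supermartingale V"
  unfolding supermartingale_def
proof (intro ballI)
  fix s t A assume s: "s \<in> {0..T}" and t: "t \<in> {s..T}" and A: "A \<in> sets (F s)"
  have t': "t \<in> {0..T}" using s t by auto
  have At: "A \<in> sets (F t)" using A t sets_filt_mono[of s t] by auto
  have AM: "A \<in> sets M" using A sets_filt by blast
  have cA: "space M - A \<in> sets (F t)" using At by (metis sets.compl_sets space_filt)
  note split = integral_split_indicator[OF AM]
  have Vt: "integrable M (V t)"
    using square_integrable_integrable[OF dominated_process_stopped[OF V_dom stops_const[OF t']]] by simp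
  show "(\<integral>\<omega>. indicator A \<omega> * V t \<omega> \<partial>M) \<le> (\<integral>\<omega>. indicator A \<omega> * V s \<omega> \<partial>M)"
  proof (rule field_le_epsilon)
    fix \<epsilon> :: real assume "0 < \<epsilon>"
    then obtain \<theta> where \<theta>: "\<theta> \<in> stopping_times_from M F T (\<lambda>_. t)" "(\<integral>\<omega>. V t \<omega> \<partial>M) - \<epsilon> < (\<integral>\<omega>. reward \<theta> \<omega> \<partial>M)"
      using near_optimal[OF t'] by blast
    have \<theta>s: "\<theta> \<in> stops" using \<theta> t' by (intro stops_from_stops) auto
    have "(\<integral>\<omega>. indicator (space M - A) \<omega> * reward \<theta> \<omega> \<partial>M) \<le> (\<integral>\<omega>. indicator (space M - A) \<omega> * V t \<omega> \<partial>M)"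
      by (rule reward_integral_le[OF t' \<theta>(1) cA])
    then have "(\<integral>\<omega>. indicator A \<omega> * V t \<omega> \<partial>M) \<le> (\<integral>\<omega>. indicator A \<omega> * reward \<theta> \<omega> \<partial>M) + \<epsilon>"
      using \<theta>(2) split[OF Vt] split[OF square_integrable_integrable[OF reward_sq[OF \<theta>s]]] by linarith
    also have "(\<integral>\<omega>. indicator A \<omega> * reward \<theta> \<omega> \<partial>M) \<le> (\<integral>\<omega>. indicator A \<omega> * V s \<omega> \<partial>M)"
      using t by (intro reward_integral_le s A stops_from_mono[OF _ \<theta>(1)]) auto
    finally show "(\<integral>\<omega>. indicator A \<omega> * V t \<omega> \<partial>M) \<le> (\<integral>\<omega>. indicator A \<omega> * V s \<omega> \<partial>M) + \<epsilon>" by simp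
  qed
qed

text \<open>Stopping at once is a competitor in the Snell equation. This gives the inequality for
  all rational times before T outside one null set; continuity extends it to all times before T, and
  the terminal conditions settle T itself.\<close>

lemma Y_ge_L: "AE \<omega> in M. \<forall>t\<in>{0..T}. L t \<omega> \<le> Y t \<omega>"
proof -
  have "AE \<omega> in M. L t \<omega> \<le> Y t \<omega>" if t: "t \<in> {0..<T}" for t
  proof -
    interpret finite_measure_subalgebra M "F t" by (rule filt_finite_measure_subalgebra)
    have t': "t \<in> {0..T}" using t by auto
    have "L t \<in> borel_measurable (F t)"
      by (rule progressive_adapted[OF dominated_processD(1)[OF L_dom] t'])
    moreover have "integrable M (L t)"
      using square_integrable_integrable[OF dominated_process_stopped[OF L_dom stops_const[OF t']]] by simp
    ultimately have "AE \<omega> in M. real_cond_exp M (F t) (L t) \<omega> = L t \<omega>" by simp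
    moreover have "AE \<omega> in M. real_cond_exp M (F t) (\<lambda>\<omega>. integral {t..t} (\<lambda>s. f s \<omega>) + (if t < T then L t \<omega> else 0)) \<omega> \<le> Y t \<omega>"
      using snell[OF t'] stops_from_const[of t t] t unfolding is_ess_sup_def by force
    ultimately show ?thesis
      by eventually_elim (use t in simp)
  qed
  then have "AE \<omega> in M. \<forall>t\<in>\<rat> \<inter> {0..<T}. L t \<omega> \<le> Y t \<omega>"
    by (subst AE_ball_countable) (auto simp: countable_rat)
  with AE_space show ?thesis
  proof eventually_elim
    case (elim \<omega>)
    show ?case
    proof
      fix t assume t: "t \<in> {0..T}"
      show "L t \<omega> \<le> Y t \<omega>"
      proof (cases "t = T")
        case True
        then show ?thesis using Y_T L_T elim by simp
      next
        case False
        show ?thesis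
        proof (rule ccontr)
          assume "\<not> L t \<omega> \<le> Y t \<omega>"
          then have pos: "0 < L t \<omega> - Y t \<omega>" by simp
          have "continuous_on {0..T} (\<lambda>t. L t \<omega> - Y t \<omega>)"
            by (intro continuous_on_diff dominated_processD(2)[OF L_dom] dominated_processD(2)[OF Y_dom] elim)
          then obtain \<delta> where \<delta>: "0 < \<delta>" "\<And>s. s \<in> {0..T} \<Longrightarrow> dist s t < \<delta> \<Longrightarrow> dist (L s \<omega> - Y s \<omega>) (L t \<omega> - Y t \<omega>) < L t \<omega> - Y t \<omega>"
            using t pos unfolding continuous_on_iff by blast
          obtain q where q: "q \<in> \<rat>" "t < q" "q < min T (t + \<delta>)"
            using Rats_dense_in_real[of t "min T (t + \<delta>)"] t False \<delta>(1) by auto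
          then have "L q \<omega> \<le> Y q \<omega>" using elim(2) t by auto
          moreover have "dist (L q \<omega> - Y q \<omega>) (L t \<omega> - Y t \<omega>) < L t \<omega> - Y t \<omega>"
            using q t by (intro \<delta>(2)) (auto simp: dist_real_def)
          ultimately show False by (auto simp: dist_real_def)
        qed
      qed
    qed
  qed
qed

lemma reward_le_V:
  assumes \<theta>: "\<theta> \<in> stops"
  shows "AE \<omega> in M. reward \<theta> \<omega> \<le> V (\<theta> \<omega>) \<omega>"
  using Y_ge_L AE_space
proof eventually_elim
  case (elim \<omega>)
  show ?case
  proof (cases "\<theta> \<omega> < T")
    case True
    then show ?thesis using elim stopsD[OF \<theta>] by (simp add: reward_def V_def)
  next
    case False
    then have "\<theta> \<omega> = T" using elim(2) stopsD(3)[OF \<theta>] by force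
    then show ?thesis using Y_T elim by (simp add: reward_def V_def)
  qed
qed

text \<open>On [t, D - r] the distance between \<open>Y\<close> and \<open>L\<close> has a positive
  minimum by compactness, so times at which the gap is small cannot lie there. The gap is set to 0
  at T, where stopping loses nothing and the minimum with D is D anyway.\<close>

lemma meet_approach:
  fixes u :: "nat \<Rightarrow> real"
  assumes \<omega>: "\<omega> \<in> space M" and t: "t \<in> {0..T}" and u: "\<And>n. u n \<in> {t..T}"
    and lim: "(\<lambda>n. if u n < T then Y (u n) \<omega> - L (u n) \<omega> else 0) \<longlonglongrightarrow> 0"
  shows "(\<lambda>n. min (u n) (first_meet T Y L (\<lambda>_. t) \<omega>)) \<longlonglongrightarrow> first_meet T Y L (\<lambda>_. t) \<omega>"
proof (rule LIMSEQ_I)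
  define D where "D = first_meet T Y L (\<lambda>_. t) \<omega>"
  have D: "t \<le> D" "D \<le> T"
    using first_meet_ge[of "\<lambda>_. t" \<omega> T Y L] t by (auto simp: D_def first_meet_le)
  fix r :: real assume r: "0 < r"
  show "\<exists>N. \<forall>n\<ge>N. norm (min (u n) D - D) < r"
  proof (cases "t \<le> D - r")
    case False
    then have "norm (min (u n) D - D) < r" for n using u[of n] D r by auto
    then show ?thesis by blast
  next
    case True
    have "continuous_on {t..D - r} (\<lambda>s. \<bar>Y s \<omega> - L s \<omega>\<bar>)"
      using t D r by (intro continuous_intros continuous_on_subset[OF dominated_processD(2)[OF L_dom \<omega>]]
          continuous_on_subset[OF dominated_processD(2)[OF Y_dom \<omega>]]) auto
    then obtain s where s: "s \<in> {t..D - r}" "\<And>s'. s' \<in> {t..D - r} \<Longrightarrow> \<bar>Y s \<omega> - L s \<omega>\<bar> \<le> \<bar>Y s' \<omega> - L s' \<omega>\<bar>"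
      using continuous_attains_inf[of "{t..D - r}" "\<lambda>s. \<bar>Y s \<omega> - L s \<omega>\<bar>"] True by auto
    have "Y s \<omega> \<noteq> L s \<omega>"
      using first_meet_lower[of "\<lambda>_. t" \<omega> s T Y L] s(1) D r by (auto simp: D_def[symmetric])
    then have pos: "0 < \<bar>Y s \<omega> - L s \<omega>\<bar>" by simp
    obtain N where N: "\<And>n. n \<ge> N \<Longrightarrow> norm ((if u n < T then Y (u n) \<omega> - L (u n) \<omega> else 0) - 0) < \<bar>Y s \<omega> - L s \<omega>\<bar>"
      using LIMSEQ_D[OF lim pos] by blast
    have "norm (min (u n) D - D) < r" if "n \<ge> N" for n
    proof (rule ccontr)
      assume "\<not> norm (min (u n) D - D) < r"
      then have "u n \<le> D - r" using r by (auto simp: min_def split: if_splits)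
      then have "u n \<in> {t..D - r}" "u n < T" using u[of n] D r by auto
      then show False using N[OF that] s(2)[of "u n"] by simp
    qed
    then show ?thesis by blast
  qed
qed

text \<open>Along almost optimal stopping times \<open>\<theta> n\<close> the gap \<open>Y - L\<close> tends to zero, which forces
  \<open>min (\<theta> n) D\<close> to converge to the first meeting time \<open>D\<close>.\<close>
lemma meet_martingale_const:
  assumes t: "t \<in> {0..T}" and A: "A \<in> sets (F t)"
  shows "(\<integral>\<omega>. indicator A \<omega> * V (first_meet T Y L (\<lambda>_. t) \<omega>) \<omega> \<partial>M) = (\<integral>\<omega>. indicator A \<omega> * V t \<omega> \<partial>M)"
proof -
  define D where "D = first_meet T Y L (\<lambda>_. t)"
  note YD = dominated_processD[OF Y_dom] and LD = dominated_processD[OF L_dom]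
  have ts: "(\<lambda>_. t) \<in> stops" by (rule stops_const[OF t])
  have Ds: "D \<in> stops" unfolding D_def by (rule first_meet_stops[OF ts YD(1) LD(1) YD(2) LD(2)])
  have D_ge: "t \<le> D \<omega>" for \<omega> unfolding D_def using first_meet_ge[of "\<lambda>_. t" \<omega> T Y L] t by simp
  have V_int: "integrable M (\<lambda>\<omega>. V (\<theta> \<omega>) \<omega>)" if "\<theta> \<in> stops" for \<theta>
    by (rule square_integrable_integrable[OF dominated_process_stopped[OF V_dom that]])
  have rew_int: "integrable M (reward \<theta>)" if "\<theta> \<in> stops" for \<theta>
    by (rule square_integrable_integrable[OF reward_sq[OF that]])
  have opt: "(\<integral>\<omega>. V (\<theta> \<omega>) \<omega> \<partial>M) \<le> (\<integral>\<omega>. V (\<sigma> \<omega>) \<omega> \<partial>M)"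
    if "\<sigma> \<in> stops" "\<theta> \<in> stops" "\<And>\<omega>. \<omega> \<in> space M \<Longrightarrow> \<sigma> \<omega> \<le> \<theta> \<omega>" for \<sigma> \<theta>
  proof -
    have "space M \<in> sets (pre_sigma \<sigma>)" by (metis sets.top space_pre_sigma)
    from optional_sampling[OF V_dom V_supermartingale that this] show ?thesis
      by (simp cong: Bochner_Integration.integral_cong)
  qed
  have "\<exists>\<theta>\<in>stopping_times_from M F T (\<lambda>_. t). (\<integral>\<omega>. V t \<omega> \<partial>M) - 1 / Suc n < (\<integral>\<omega>. reward \<theta> \<omega> \<partial>M)" for n :: nat
    by (rule near_optimal[OF t]) simp
  then obtain \<theta> where \<theta>: "\<And>n. \<theta> n \<in> stopping_times_from M F T (\<lambda>_. t)"
    and near: "\<And>n::nat. (\<integral>\<omega>. V t \<omega> \<partial>M) - 1 / Suc n < (\<integral>\<omega>. reward (\<theta> n) \<omega> \<partial>M)" by metis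
  have \<theta>s: "\<theta> n \<in> stops" for n using \<theta> t by (intro stops_from_stops) auto
  have \<theta>_ge: "\<theta> n \<omega> \<in> {t..T}" if "\<omega> \<in> space M" for n \<omega>
    using \<theta>[of n] that by (auto simp: stopping_times_from_def)
  \<comment> \<open>The loss from stopping at \<open>\<theta> n\<close>. Its mean is at most 1 / (n
    + 1): the mean of \<open>V\<close> at \<open>\<theta> n\<close> does not exceed that of
    \<open>V t\<close>, and the mean reward falls short of the latter by less than 1 / (n +
    1).\<close>
  define gap where "gap n \<omega> = V (\<theta> n \<omega>) \<omega> - reward (\<theta> n) \<omega>" for n \<omega>
  have gap_int: "integrable M (gap n)" for n
    unfolding gap_def[abs_def] by (intro Bochner_Integration.integrable_diff V_int rew_int \<theta>s)
  have gap_nonneg: "AE \<omega> in M. 0 \<le> gap n \<omega>" for n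
    using reward_le_V[OF \<theta>s[of n]] by eventually_elim (simp add: gap_def)
  have V_theta: "(\<integral>\<omega>. V (\<theta> n \<omega>) \<omega> \<partial>M) \<le> (\<integral>\<omega>. V t \<omega> \<partial>M)" for n
    using opt[OF ts \<theta>s[of n]] \<theta>_ge by auto
  have gap_small: "(\<integral>\<omega>. norm (gap n \<omega>) \<partial>M) \<le> inverse (Suc n)" for n
  proof -
    have "(\<integral>\<omega>. norm (gap n \<omega>) \<partial>M) = (\<integral>\<omega>. gap n \<omega> \<partial>M)"
      using gap_nonneg[of n] borel_measurable_integrable[OF gap_int[of n]]
      by (intro integral_cong_AE) (auto elim: eventually_mono)
    also have "\<dots> = (\<integral>\<omega>. V (\<theta> n \<omega>) \<omega> \<partial>M) - (\<integral>\<omega>. reward (\<theta> n) \<omega> \<partial>M)"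
      unfolding gap_def by (rule Bochner_Integration.integral_diff[OF V_int[OF \<theta>s] rew_int[OF \<theta>s]])
    finally show ?thesis using near[of n] V_theta[of n] by (simp add: inverse_eq_divide)
  qed
  have "(\<lambda>n. \<integral>\<omega>. norm (gap n \<omega>) \<partial>M) \<longlonglongrightarrow> 0"
    by (rule tendsto_sandwich[OF _ _ tendsto_const LIMSEQ_inverse_real_of_nat])
      (use gap_small in \<open>auto intro!: always_eventually Bochner_Integration.integral_nonneg\<close>)
  \<comment> \<open>Convergence in mean yields almost sure convergence only along a subsequence,
    which suffices for comparing means in the limit.\<close>
  from tendsto_L1_AE_subseq[OF gap_int this] obtain r :: "nat \<Rightarrow> nat" where r: "strict_mono r"
    and gap0: "AE \<omega> in M. (\<lambda>n. gap (r n) \<omega>) \<longlonglongrightarrow> 0" by blast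
  have gap_eq: "gap n \<omega> = (if \<theta> n \<omega> < T then Y (\<theta> n \<omega>) \<omega> - L (\<theta> n \<omega>) \<omega> else 0)" if "\<omega> \<in> space M" for n \<omega>
    using \<theta>_ge[OF that, of n] Y_T[OF that] by (cases "\<theta> n \<omega> = T") (auto simp: gap_def V_def reward_def)
  have lim: "AE \<omega> in M. (\<lambda>n. min (\<theta> (r n) \<omega>) (D \<omega>)) \<longlonglongrightarrow> D \<omega>"
    using gap0 AE_space
  proof eventually_elim
    case (elim \<omega>)
    then show ?case unfolding D_def
      using \<theta>_ge by (intro meet_approach[OF _ t]) (simp_all add: gap_eq)
  qed
  have ms: "(\<lambda>\<omega>. min (\<theta> n \<omega>) (D \<omega>)) \<in> stops" for n by (intro stops_min \<theta>s Ds)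
  have "(\<lambda>n. \<integral>\<omega>. indicator (space M) \<omega> * V (min (\<theta> (r n) \<omega>) (D \<omega>)) \<omega> \<partial>M) \<longlonglongrightarrow> (\<integral>\<omega>. indicator (space M) \<omega> * V (D \<omega>) \<omega> \<partial>M)"
    using stopsD[OF ms]
    by (intro dominated_process_tendsto[OF V_dom _ _ _ Ds _ lim] progressive_stopped_M[OF dominated_processD(1)[OF V_dom] ms]) auto
  then have conv: "(\<lambda>n. \<integral>\<omega>. V (min (\<theta> (r n) \<omega>) (D \<omega>)) \<omega> \<partial>M) \<longlonglongrightarrow> (\<integral>\<omega>. V (D \<omega>) \<omega> \<partial>M)"
    by (simp cong: Bochner_Integration.integral_cong)
  have ge: "(\<integral>\<omega>. V t \<omega> \<partial>M) - inverse (Suc (r n)) \<le> (\<integral>\<omega>. V (min (\<theta> (r n) \<omega>) (D \<omega>)) \<omega> \<partial>M)" for n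
  proof -
    have "(\<integral>\<omega>. reward (\<theta> (r n)) \<omega> \<partial>M) \<le> (\<integral>\<omega>. V (\<theta> (r n) \<omega>) \<omega> \<partial>M)"
      by (rule integral_mono_AE[OF rew_int[OF \<theta>s] V_int[OF \<theta>s] reward_le_V[OF \<theta>s]])
    also have "\<dots> \<le> (\<integral>\<omega>. V (min (\<theta> (r n) \<omega>) (D \<omega>)) \<omega> \<partial>M)" by (intro opt ms \<theta>s) simp
    finally show ?thesis using near[of "r n"] by (simp add: inverse_eq_divide)
  qed
  have "(\<lambda>n. (\<integral>\<omega>. V t \<omega> \<partial>M) - inverse (real (Suc (r n)))) \<longlonglongrightarrow> (\<integral>\<omega>. V t \<omega> \<partial>M) - 0"
    using LIMSEQ_subseq_LIMSEQ[OF LIMSEQ_inverse_real_of_nat r]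
    by (intro tendsto_diff tendsto_const) (simp add: o_def)
  from LIMSEQ_le[OF this conv] ge
  have total: "(\<integral>\<omega>. V t \<omega> \<partial>M) \<le> (\<integral>\<omega>. V (D \<omega>) \<omega> \<partial>M)" by auto
  have AM: "A \<in> sets M" using A sets_filt by blast
  have cA: "space M - A \<in> sets (F t)" using A by (metis sets.compl_sets space_filt)
  note split = integral_split_indicator[OF AM]
  have os: "(\<integral>\<omega>. indicator B \<omega> * V (D \<omega>) \<omega> \<partial>M) \<le> (\<integral>\<omega>. indicator B \<omega> * V t \<omega> \<partial>M)" if "B \<in> sets (F t)" for B
    using D_ge that by (intro optional_sampling[OF V_dom V_supermartingale ts Ds]) (auto simp: pre_sigma_const)
  \<comment> \<open>The supermartingale inequality holds on \<open>A\<close> and on its complement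
    while the totals force equality, so neither inequality can be strict.\<close>
  show ?thesis
    using os[OF A] os[OF cA] total split[OF V_int[OF Ds]] split[OF V_int[OF ts]] unfolding D_def by linarith
qed

text \<open>Discretise \<open>\<sigma>\<close> from above. Restarting at a grid point leaves the meeting time \<open>D\<close> unchanged only while
  that point is still below \<open>D\<close>, hence the restriction to the events \<open>Bn n\<close>; where \<open>\<sigma> = D\<close> there is nothing
  to prove.\<close>
lemma meet_martingale:
  assumes \<sigma>: "\<sigma> \<in> stops" and A: "A \<in> sets (pre_sigma \<sigma>)"
  shows "(\<integral>\<omega>. indicator A \<omega> * V (first_meet T Y L \<sigma> \<omega>) \<omega> \<partial>M) = (\<integral>\<omega>. indicator A \<omega> * V (\<sigma> \<omega>) \<omega> \<partial>M)"
proof -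
  define D where "D = first_meet T Y L \<sigma>"
  note YD = dominated_processD[OF Y_dom] and LD = dominated_processD[OF L_dom]
  have Ds: "D \<in> stops" unfolding D_def by (rule first_meet_stops[OF \<sigma> YD(1) LD(1) YD(2) LD(2)])
  have D_ge: "\<sigma> \<omega> \<le> D \<omega>" if "\<omega> \<in> space M" for \<omega>
    unfolding D_def using first_meet_ge[of \<sigma> \<omega> T Y L] stopsD(3)[OF \<sigma> that] by simp
  have AM: "A \<in> sets M" by (rule pre_sigma_sets_M[OF \<sigma> A])
  note [measurable] = AM stops_measurable[OF \<sigma>] stops_measurable[OF Ds]
  define B where "B = {\<omega>\<in>space M. \<omega> \<in> A \<and> \<sigma> \<omega> < D \<omega>}"
  define Bn where "Bn n = {\<omega>\<in>space M. \<omega> \<in> A \<and> grid_up n (\<sigma> \<omega>) < D \<omega>}" for n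
  have B: "B \<in> sets M" unfolding B_def by measurable
  have Bn: "Bn n \<in> sets M" for n unfolding Bn_def by measurable
  have limB: "AE \<omega> in M. \<forall>\<^sub>F n in sequentially. \<omega> \<in> Bn n \<longleftrightarrow> \<omega> \<in> B"
  proof (rule AE_I2)
    fix \<omega> assume \<omega>: "\<omega> \<in> space M"
    show "\<forall>\<^sub>F n in sequentially. \<omega> \<in> Bn n \<longleftrightarrow> \<omega> \<in> B"
    proof (cases "\<sigma> \<omega> < D \<omega>")
      case True
      then have "\<forall>\<^sub>F n in sequentially. grid_up n (\<sigma> \<omega>) < D \<omega>"
        using grid_up_tendsto[OF stopsD(2)[OF \<sigma> \<omega>]] by (rule order_tendstoD(2)[rotated])
      then show ?thesis by eventually_elim (use \<omega> True in \<open>auto simp: B_def Bn_def\<close>)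
    next
      case False
      then have "\<not> grid_up n (\<sigma> \<omega>) < D \<omega>" for n using grid_up_ge[of "\<sigma> \<omega>" n] by linarith
      then show ?thesis using False by (intro always_eventually) (auto simp: B_def Bn_def)
    qed
  qed
  have "(\<lambda>n. \<integral>\<omega>. indicator (Bn n) \<omega> * V (grid_up n (\<sigma> \<omega>)) \<omega> \<partial>M) \<longlonglongrightarrow> (\<integral>\<omega>. indicator B \<omega> * V (\<sigma> \<omega>) \<omega> \<partial>M)"
    using grid_up_mem[OF stopsD(3)[OF \<sigma>]]
    by (intro dominated_process_tendsto[OF V_dom Bn B _ \<sigma> _ _ limB]
        progressive_grid_up_measurable[OF dominated_processD(1)[OF V_dom] \<sigma>] AE_I2 grid_up_tendsto stopsD[OF \<sigma>])
  moreover have "(\<lambda>n. \<integral>\<omega>. indicator (Bn n) \<omega> * V (D \<omega>) \<omega> \<partial>M) \<longlonglongrightarrow> (\<integral>\<omega>. indicator B \<omega> * V (D \<omega>) \<omega> \<partial>M)"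
    using stopsD[OF Ds]
    by (intro dominated_process_tendsto[OF V_dom Bn B _ Ds _ _ limB]
        progressive_stopped_M[OF dominated_processD(1)[OF V_dom] Ds] AE_I2) auto
  moreover have "(\<integral>\<omega>. indicator (Bn n) \<omega> * V (D \<omega>) \<omega> \<partial>M) = (\<integral>\<omega>. indicator (Bn n) \<omega> * V (grid_up n (\<sigma> \<omega>)) \<omega> \<partial>M)" for n
  proof -
    \<comment> \<open>The event of \<open>Bn n\<close> on which \<sigma> is rounded up to the k-th
      grid point. The left neighbour is written with real subtraction: for k = 0 it is negative, so
      the lower constraint holds automatically and \<sigma> = 0 is included.\<close>
    define C where "C k = ({\<omega>\<in>A. \<sigma> \<omega> \<le> grid_point n k} \<inter> {\<omega>\<in>space M. (real k - 1) * T / Suc n < \<sigma> \<omega>})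
        \<inter> {\<omega>\<in>space M. grid_point n k < D \<omega>}" for k
    have "(real k - 1) * T / Suc n \<le> grid_point n k" for k
      unfolding grid_point_def using T_pos by (intro divide_right_mono mult_right_mono) auto
    then have C: "C k \<in> sets (F (grid_point n k))" for k
      unfolding C_def
      using sets_pre_sigmaD[OF stopsD(1)[OF \<sigma>] A] stopping_timeD2[OF stopsD(1)[OF Ds], of "grid_point n k"]
        stopping_timeD2[OF stopsD(1)[OF \<sigma>], of "(real k - 1) * T / Suc n"] sets_filt_mono[of "(real k - 1) * T / Suc n" "grid_point n k"]
      by (intro sets.Int) (auto simp: pred_def space_filt)
    have CM: "C k \<in> sets M" for k using C sets_filt by blast
    have C_iff: "\<omega> \<in> C k \<longleftrightarrow> \<omega> \<in> Bn n \<and> grid_index n (\<sigma> \<omega>) = k" if \<omega>: "\<omega> \<in> space M" for \<omega> k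
    proof -
      have "(real k - 1) * T / Suc n < \<sigma> \<omega> \<longleftrightarrow> k \<le> grid_index n (\<sigma> \<omega>)" if "\<sigma> \<omega> \<le> grid_point n k"
      proof (cases k)
        case 0
        have "- T / Suc n < 0" using T_pos by simp
        then show ?thesis using 0 stopsD(2)[OF \<sigma> \<omega>] by simp
      next
        case (Suc j)
        then show ?thesis using grid_index_greater_iff[of j n "\<sigma> \<omega>"] by (auto simp: grid_point_def)
      qed
      then have "\<sigma> \<omega> \<le> grid_point n k \<and> (real k - 1) * T / Suc n < \<sigma> \<omega> \<longleftrightarrow> grid_index n (\<sigma> \<omega>) = k"
        using grid_index_le_iff[of n "\<sigma> \<omega>" k] by auto
      then show ?thesis using \<omega> by (auto simp: C_def Bn_def grid_up_def)
    qed
    have decomp: "(\<integral>\<omega>. indicator (Bn n) \<omega> * h \<omega> \<partial>M) = (\<Sum>k\<le>Suc n. \<integral>\<omega>. indicator (C k) \<omega> * h \<omega> \<partial>M)"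
      if h: "\<And>k. k \<le> Suc n \<Longrightarrow> integrable M (\<lambda>\<omega>. indicator (C k) \<omega> * h \<omega>)" for h :: "'a \<Rightarrow> real"
    proof -
      have "(\<integral>\<omega>. indicator (Bn n) \<omega> * h \<omega> \<partial>M) = (\<integral>\<omega>. (\<Sum>k\<le>Suc n. indicator (C k) \<omega> * h \<omega>) \<partial>M)"
      proof (rule Bochner_Integration.integral_cong[OF refl])
        fix \<omega> assume \<omega>: "\<omega> \<in> space M"
        have "(\<Sum>k\<le>Suc n. indicator (C k) \<omega> * h \<omega>) = (\<Sum>k\<le>Suc n. if k = grid_index n (\<sigma> \<omega>) then indicator (Bn n) \<omega> * h \<omega> else 0)"
          using C_iff[OF \<omega>] by (intro sum.cong refl) (auto simp: indicator_def)
        then show "indicator (Bn n) \<omega> * h \<omega> = (\<Sum>k\<le>Suc n. indicator (C k) \<omega> * h \<omega>)"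
          using grid_index_le[OF stopsD(3)[OF \<sigma> \<omega>], of n] by simp
      qed
      also have "\<dots> = (\<Sum>k\<le>Suc n. \<integral>\<omega>. indicator (C k) \<omega> * h \<omega> \<partial>M)"
        by (rule Bochner_Integration.integral_sum) (use h in auto)
      finally show ?thesis .
    qed
    have grid_int: "integrable M (\<lambda>\<omega>. indicator (C k) \<omega> * V (grid_point n k) \<omega>)" if "k \<le> Suc n" for k
      using dominated_process_indicator_integrable[OF V_dom stops_const[OF grid_point_mem[OF that]] CM] by simp
    have up_eq: "indicator (C k) \<omega> * V (grid_up n (\<sigma> \<omega>)) \<omega> = indicator (C k) \<omega> * V (grid_point n k) \<omega>" if "\<omega> \<in> space M" for \<omega> k
      using C_iff[OF that] by (auto simp: indicator_def grid_up_def)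
    have D_eq: "indicator (C k) \<omega> * V (D \<omega>) \<omega> = indicator (C k) \<omega> * V (first_meet T Y L (\<lambda>_. grid_point n k) \<omega>) \<omega>" for \<omega> k
      using first_meet_restart[of \<sigma> \<omega> "grid_point n k" T Y L] by (auto simp: indicator_def C_def D_def)
    have "(\<integral>\<omega>. indicator (Bn n) \<omega> * V (D \<omega>) \<omega> \<partial>M) = (\<Sum>k\<le>Suc n. \<integral>\<omega>. indicator (C k) \<omega> * V (D \<omega>) \<omega> \<partial>M)"
      by (rule decomp, rule dominated_process_indicator_integrable[OF V_dom Ds CM])
    also have "\<dots> = (\<Sum>k\<le>Suc n. \<integral>\<omega>. indicator (C k) \<omega> * V (grid_point n k) \<omega> \<partial>M)"
      unfolding D_eq by (intro sum.cong refl meet_martingale_const[OF _ C] grid_point_mem) simp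
    also have "\<dots> = (\<Sum>k\<le>Suc n. \<integral>\<omega>. indicator (C k) \<omega> * V (grid_up n (\<sigma> \<omega>)) \<omega> \<partial>M)"
      by (intro sum.cong refl Bochner_Integration.integral_cong) (simp add: up_eq)
    also have "\<dots> = (\<integral>\<omega>. indicator (Bn n) \<omega> * V (grid_up n (\<sigma> \<omega>)) \<omega> \<partial>M)"
      by (rule decomp[symmetric], subst Bochner_Integration.integrable_cong[OF refl up_eq], assumption, rule grid_int)
    finally show ?thesis .
  qed
  ultimately have eqB: "(\<integral>\<omega>. indicator B \<omega> * V (D \<omega>) \<omega> \<partial>M) = (\<integral>\<omega>. indicator B \<omega> * V (\<sigma> \<omega>) \<omega> \<partial>M)"
    using LIMSEQ_unique by force
  have split: "(\<integral>\<omega>. indicator A \<omega> * V (\<theta> \<omega>) \<omega> \<partial>M) =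
      (\<integral>\<omega>. indicator B \<omega> * V (\<theta> \<omega>) \<omega> \<partial>M) + (\<integral>\<omega>. indicator (A - B) \<omega> * V (\<theta> \<omega>) \<omega> \<partial>M)" if "\<theta> \<in> stops" for \<theta>
  proof -
    have "(\<integral>\<omega>. indicator A \<omega> * V (\<theta> \<omega>) \<omega> \<partial>M) = (\<integral>\<omega>. indicator B \<omega> * V (\<theta> \<omega>) \<omega> + indicator (A - B) \<omega> * V (\<theta> \<omega>) \<omega> \<partial>M)"
      by (intro Bochner_Integration.integral_cong refl) (auto simp: indicator_def B_def)
    then show ?thesis
      using dominated_process_indicator_integrable[OF V_dom that B]
        dominated_process_indicator_integrable[OF V_dom that, of "A - B"] AM B by auto
  qed
  have "(\<integral>\<omega>. indicator (A - B) \<omega> * V (D \<omega>) \<omega> \<partial>M) = (\<integral>\<omega>. indicator (A - B) \<omega> * V (\<sigma> \<omega>) \<omega> \<partial>M)"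
    using D_ge by (intro Bochner_Integration.integral_cong refl) (fastforce simp: B_def indicator_def not_less)
  then show ?thesis using eqB split[OF Ds] split[OF \<sigma>] unfolding D_def by simp
qed

end

section \<open>Optimal switching\<close>

text \<open>An integrable majorant makes the positive part finite while the negative part may be
  infinite. The expected payoff of an arbitrary strategy can thus be -\<infinity>, but both parts
  are never infinite together.\<close>

lemma ext_expectation_le:
  assumes "AE \<omega> in M. Z \<omega> \<le> W \<omega>" and W: "integrable M W"
  shows "ext_expectation M Z \<le> ereal (\<integral>\<omega>. W \<omega> \<partial>M)"
proof -
  define p where "p f = (\<integral>\<^sup>+\<omega>. ennreal (f \<omega>) \<partial>M)" for f :: "'a \<Rightarrow> real"
  have W': "integrable M (\<lambda>\<omega>. - W \<omega>)" using W by simp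
  have pW: "p W < \<infinity>" "p (\<lambda>\<omega>. - W \<omega>) < \<infinity>"
    using W W' by (auto simp: p_def real_integrable_def top.not_eq_extremum)
  have eW: "ereal (\<integral>\<omega>. W \<omega> \<partial>M) = enn2ereal (p W) - enn2ereal (p (\<lambda>\<omega>. - W \<omega>))"
  proof -
    obtain a b where "p W = ennreal a" "0 \<le> a" "p (\<lambda>\<omega>. - W \<omega>) = ennreal b" "0 \<le> b"
      using pW by (metis ennreal_cases less_irrefl infinity_ennreal_def)
    then show ?thesis using real_lebesgue_integral_def[OF W] by (simp add: p_def)
  qed
  have "p Z \<le> p W" unfolding p_def
    using assms(1) by (intro nn_integral_mono_AE) (auto elim!: eventually_mono intro: ennreal_leI)
  moreover have "p (\<lambda>\<omega>. - W \<omega>) \<le> p (\<lambda>\<omega>. - Z \<omega>)" unfolding p_def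
    using assms(1) by (intro nn_integral_mono_AE) (auto elim!: eventually_mono intro: ennreal_leI)
  ultimately have "enn2ereal (p Z) - enn2ereal (p (\<lambda>\<omega>. - Z \<omega>)) \<le> enn2ereal (p W) - enn2ereal (p (\<lambda>\<omega>. - W \<omega>))"
    by (intro ereal_minus_mono) (simp_all add: less_eq_ennreal.rep_eq)
  then show ?thesis by (auto simp: ext_expectation_def Let_def eW p_def[symmetric])
qed

lemma ext_expectation_eq:
  assumes "AE \<omega> in M. Z \<omega> = W \<omega>" and W: "integrable M W"
  shows "ext_expectation M Z = ereal (\<integral>\<omega>. W \<omega> \<partial>M)"
proof -
  define p where "p f = (\<integral>\<^sup>+\<omega>. ennreal (f \<omega>) \<partial>M)" for f :: "'a \<Rightarrow> real"
  have pW: "p W < \<infinity>" "p (\<lambda>\<omega>. - W \<omega>) < \<infinity>"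
    using W by (auto simp: p_def real_integrable_def top.not_eq_extremum)
  then obtain a b where ab: "p W = ennreal a" "0 \<le> a" "p (\<lambda>\<omega>. - W \<omega>) = ennreal b" "0 \<le> b"
    by (metis ennreal_cases less_irrefl infinity_ennreal_def)
  have "p Z = p W" "p (\<lambda>\<omega>. - Z \<omega>) = p (\<lambda>\<omega>. - W \<omega>)"
    unfolding p_def using assms(1) by (auto intro!: nn_integral_cong_AE elim!: eventually_mono)
  then show ?thesis
    using ab real_lebesgue_integral_def[OF W] by (simp add: ext_expectation_def Let_def p_def[symmetric])
qed

text \<open>Serves to cancel the values of \<open>Y\<close> around a closed loop of modes.\<close>

lemma sum_cyclic_shift:
  fixes f :: "nat \<Rightarrow> 'b::comm_monoid_add"
  assumes "0 < n"
  shows "(\<Sum>j<n. f (Suc j mod n)) = (\<Sum>j<n. f j)"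
proof -
  obtain k where n: "n = Suc k" using assms by (cases n) auto
  have "(\<Sum>j<n. f (Suc j mod n)) = (\<Sum>j<k. f (Suc j)) + f 0"
    unfolding n by (simp)
  also have "\<dots> = (\<Sum>j<n. f j)" unfolding n by (subst sum.lessThan_Suc_shift) (simp add: add.commute)
  finally show ?thesis .
qed

text \<open>Two pigeonhole arguments. Beyond every N some mode recurs, and a recurrence of minimal
  length closes a loop without repeated modes. Only finitely many words of length at most m exist,
  so one and the same loop is traversed from infinitely many positions.\<close>

lemma recurrent_simple_loop:
  fixes a :: "nat \<Rightarrow> nat"
  assumes range: "\<And>n. a n \<in> {1..m}" and neq: "\<And>n. a (Suc n) \<noteq> a n"
  obtains l where "set l \<subseteq> {1..m}" "distinct l" "2 \<le> length l"
    "\<exists>\<^sub>F n in sequentially. \<forall>j<length l. a (n + j) = l ! j \<and> a (n + Suc j) = l ! (Suc j mod length l)"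
proof -
  have ex: "\<exists>p d. N \<le> p \<and> 2 \<le> d \<and> d \<le> m \<and> a (p + d) = a p \<and> inj_on a {p..<p+d}" for N
  proof -
    have "\<not> inj_on a {N..N+m}"
    proof
      assume "inj_on a {N..N+m}"
      then have "card {N..N+m} \<le> card {1..m}" using range by (intro card_inj_on_le) auto
      then show False by simp
    qed
    then obtain p q where pq: "N \<le> p" "p < q" "a p = a q"
      using linorder_inj_onI'[of "{N..N+m}" a] by auto
    \<comment> \<open>The minimum is later taken over all starting positions beyond \<open>N\<close>
      at once, so a repetition inside the window would be a shorter recurrence.\<close>
    define P where "P d \<longleftrightarrow> 0 < d \<and> (\<exists>p\<ge>N. a (p + d) = a p)" for d
    have "P (q - p)" using pq by (auto simp: P_def intro!: exI[of _ p])
    define d where "d = (LEAST d. P d)"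
    have "P d" unfolding d_def by (rule LeastI[of P, OF \<open>P (q - p)\<close>])
    then obtain p where p: "N \<le> p" "a (p + d) = a p" "0 < d" by (auto simp: P_def)
    have inj: "inj_on a {p..<p+d}"
    proof (rule linorder_inj_onI')
      fix x y assume xy: "x \<in> {p..<p+d}" "y \<in> {p..<p+d}" "x < y"
      show "a x \<noteq> a y"
      proof
        assume "a x = a y"
        then have "P (y - x)" using xy p by (auto simp: P_def intro!: exI[of _ x])
        then have "d \<le> y - x" unfolding d_def by (rule Least_le)
        then show False using xy by auto
      qed
    qed
    have "d \<noteq> 1" using neq[of p] p by auto
    moreover have "card {p..<p+d} \<le> card {1..m}"
      by (rule card_inj_on_le[OF inj]) (use range in auto)
    ultimately show ?thesis using p inj by (intro exI[of _ p] exI[of _ d]) auto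
  qed
  then obtain p d where pd: "\<And>N. N \<le> p N" "\<And>N. 2 \<le> d N" "\<And>N. d N \<le> m" "\<And>N. a (p N + d N) = a (p N)"
    "\<And>N. inj_on a {p N..<p N+d N}" by metis
  define w where "w N = map a [p N..<p N + d N]" for N
  have "finite (range w)"
  proof (rule finite_subset)
    show "range w \<subseteq> {xs. set xs \<subseteq> {1..m} \<and> length xs \<le> m}"
      using range pd(3) by (auto simp: w_def simp del: atLeastAtMost_iff)
  qed (intro finite_lists_length_le finite_atLeastAtMost)
  then obtain N0 where inf: "infinite {N. w N = w N0}"
    using pigeonhole_infinite[of UNIV w] by auto
  let ?l = "w N0"
  have freq: "\<exists>\<^sub>F n in sequentially. \<forall>j<length ?l. a (n + j) = ?l ! j \<and> a (n + Suc j) = ?l ! (Suc j mod length ?l)"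
    unfolding frequently_sequentially
  proof
    fix n
    obtain N where N: "n \<le> N" "w N = ?l" using inf unfolding infinite_nat_iff_unbounded_le by blast
    have len: "length ?l = d N" using N(2)[symmetric] by (simp add: w_def)
    have nth: "?l ! j = a (p N + j)" if "j < d N" for j
      using N(2)[symmetric] that by (simp add: w_def)
    have "a (p N + Suc j) = ?l ! (Suc j mod d N)" if "j < d N" for j
    proof (cases "Suc j = d N")
      case True
      then show ?thesis using pd(4)[of N] nth[of 0] pd(2)[of N] by simp
    next
      case False
      then show ?thesis using that nth[of "Suc j"] by simp
    qed
    then show "\<exists>n'\<ge>n. \<forall>j<length ?l. a (n' + j) = ?l ! j \<and> a (n' + Suc j) = ?l ! (Suc j mod length ?l)"
      using nth len N(1) pd(1)[of N] by (intro exI[of _ "p N"]) auto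
  qed
  show thesis
  proof (rule that[OF _ _ _ freq])
    show "set ?l \<subseteq> {1..m}" using range by (auto simp: w_def simp del: atLeastAtMost_iff)
    show "distinct ?l" using pd(5) by (simp add: w_def distinct_map)
    show "2 \<le> length ?l" using pd(2) by (simp add: w_def)
  qed
qed

text \<open>The intervals between consecutive switching times are half open and disjoint, so exactly
  one term of \<open>mode_indicator\<close> survives; simultaneous switches only produce empty
  intervals.\<close>

lemma mode_indicator_eq:
  assumes mono: "\<And>k. \<tau> k \<omega> \<le> \<tau> (Suc k) \<omega>" and s: "\<tau> n \<omega> < s" "s \<le> \<tau> (Suc n) \<omega>" and "\<xi> 0 \<omega> = 1"
  shows "mode_indicator \<tau> \<xi> s \<omega> = \<xi> n \<omega>"
proof -
  have mono': "\<tau> k \<omega> \<le> \<tau> l \<omega>" if "k \<le> l" for k l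
    using lift_Suc_mono_le[of "\<lambda>k. \<tau> k \<omega>", OF mono that] .
  show ?thesis
  proof (cases n)
    case 0
    have "\<not> \<tau> (Suc k) \<omega> < s" for k using mono'[of "Suc 0" "Suc k"] s 0 by auto
    then have empty: "{k. \<tau> (Suc k) \<omega> < s \<and> s \<le> \<tau> (Suc (Suc k)) \<omega>} = {}" by blast
    show ?thesis unfolding mode_indicator_def empty using 0 s assms(4) by simp
  next
    case (Suc n')
    have "k = n'" if "\<tau> (Suc k) \<omega> < s" "s \<le> \<tau> (Suc (Suc k)) \<omega>" for k
    proof (rule antisym)
      show "k \<le> n'"
      proof (rule ccontr)
        assume "\<not> k \<le> n'"
        then have "\<tau> (Suc n) \<omega> \<le> \<tau> (Suc k) \<omega>" using Suc by (intro mono') simp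
        then show False using that(1) s(2) by linarith
      qed
      show "n' \<le> k"
      proof (rule ccontr)
        assume "\<not> n' \<le> k"
        then have "\<tau> (Suc (Suc k)) \<omega> \<le> \<tau> n \<omega>" using Suc by (intro mono') simp
        then show False using that(2) s(1) by linarith
      qed
    qed
    then have single: "{k. \<tau> (Suc k) \<omega> < s \<and> s \<le> \<tau> (Suc (Suc k)) \<omega>} = {n'}" using s[unfolded Suc] by blast
    have "\<not> s \<le> \<tau> 1 \<omega>" using mono'[of 1 n] s Suc by auto
    then show ?thesis unfolding mode_indicator_def single using Suc by simp
  qed
qed

text \<open>The hypotheses on profits and costs are stated along the paths of \<open>X\<close>. Of
  these, \<open>psi_abs_le\<close> controls the running profit under arbitrary changes of mode and
  \<open>g_loop\<close> drives admissibility of the optimal rule; \<open>filt_0_trivial\<close>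
  makes the initial value constant up to a null set.\<close>

locale switching = filtered_prob_space M F T for M :: "'a measure" and F T +
  fixes m :: nat and X :: "real \<Rightarrow> 'a \<Rightarrow> 'x" and \<psi> :: "nat \<Rightarrow> real \<Rightarrow> 'x \<Rightarrow> real"
    and g :: "nat \<Rightarrow> nat \<Rightarrow> real \<Rightarrow> 'x \<Rightarrow> real" and Y :: "nat \<Rightarrow> real \<Rightarrow> 'a \<Rightarrow> real"
    and UI UY :: "nat \<Rightarrow> 'a \<Rightarrow> real" and Ug :: "nat \<Rightarrow> nat \<Rightarrow> 'a \<Rightarrow> real"
  assumes m_ge: "2 \<le> m"
    and psi_cont: "\<And>i \<omega>. i \<in> {1..m} \<Longrightarrow> \<omega> \<in> space M \<Longrightarrow> continuous_on {0..T} (\<lambda>t. \<psi> i t (X t \<omega>))"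
    and I_dom: "\<And>i. i \<in> {1..m} \<Longrightarrow> dominated_process (\<lambda>t \<omega>. integral {0..t} (\<lambda>s. \<psi> i s (X s \<omega>))) (UI i)"
    and psi_abs_le: "\<And>i \<omega>. i \<in> {1..m} \<Longrightarrow> \<omega> \<in> space M \<Longrightarrow> integral {0..T} (\<lambda>s. \<bar>\<psi> i s (X s \<omega>)\<bar>) \<le> UI i \<omega>"
    and g_dom: "\<And>i j. i \<in> {1..m} \<Longrightarrow> j \<in> {1..m} \<Longrightarrow> dominated_process (\<lambda>t \<omega>. g i j t (X t \<omega>)) (Ug i j)"
    and Y_dom: "\<And>i. i \<in> {1..m} \<Longrightarrow> dominated_process (Y i) (UY i)"
    and g_diag: "\<And>i t \<omega>. i \<in> {1..m} \<Longrightarrow> t \<in> {0..T} \<Longrightarrow> \<omega> \<in> space M \<Longrightarrow> g i i t (X t \<omega>) = 0"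
    and g_loop: "\<And>l t \<omega>. set l \<subseteq> {1..m} \<Longrightarrow> distinct l \<Longrightarrow> 2 \<le> length l \<Longrightarrow> t \<in> {0..T} \<Longrightarrow> \<omega> \<in> space M \<Longrightarrow>
        0 < (\<Sum>n<length l. g (l ! n) (l ! (Suc n mod length l)) t (X t \<omega>))"
    and g_terminal: "\<And>i j \<omega>. i \<in> {1..m} \<Longrightarrow> j \<in> {1..m} \<Longrightarrow> \<omega> \<in> space M \<Longrightarrow> 0 \<le> g i j T (X T \<omega>)"
    and Y_T: "\<And>i \<omega>. i \<in> {1..m} \<Longrightarrow> \<omega> \<in> space M \<Longrightarrow> Y i T \<omega> = 0"
    and Y_snell: "\<And>i t. i \<in> {1..m} \<Longrightarrow> t \<in> {0..T} \<Longrightarrow> is_ess_sup M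
        {real_cond_exp M (F t)
           (\<lambda>\<omega>. integral {t..\<theta> \<omega>} (\<lambda>s. \<psi> i s (X s \<omega>)) +
                 (if \<theta> \<omega> < T
                  then Max ((\<lambda>j. - g i j (\<theta> \<omega>) (X (\<theta> \<omega>) \<omega>) + Y j (\<theta> \<omega>) \<omega>) ` ({1..m} - {i}))
                  else 0))
         | \<theta>. \<theta> \<in> stopping_times_from M F T (\<lambda>_. t)}
        (Y i t)"
    and filt_0_trivial: "\<And>A. A \<in> sets (F 0) \<Longrightarrow> prob A = 0 \<or> prob A = 1"
begin

section \<open>Obstacles and supermartingales of the individual modes\<close>

definition L :: "nat \<Rightarrow> real \<Rightarrow> 'a \<Rightarrow> real" where
  "L i t \<omega> = Max ((\<lambda>j. - g i j t (X t \<omega>) + Y j t \<omega>) ` ({1..m} - {i}))"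

definition V :: "nat \<Rightarrow> real \<Rightarrow> 'a \<Rightarrow> real" where
  "V i t \<omega> = Y i t \<omega> + integral {0..t} (\<lambda>s. \<psi> i s (X s \<omega>))"

lemma others_nonempty: "{1..m} - {i} \<noteq> {}"
proof -
  have "1 \<in> {1..m} - {i} \<or> 2 \<in> {1..m} - {i}" using m_ge by auto
  then show ?thesis by blast
qed

lemma L_in: "\<exists>j\<in>{1..m} - {i}. L i t \<omega> = - g i j t (X t \<omega>) + Y j t \<omega>"
proof -
  have "L i t \<omega> \<in> (\<lambda>j. - g i j t (X t \<omega>) + Y j t \<omega>) ` ({1..m} - {i})"
    unfolding L_def using others_nonempty by (intro Max_in) auto
  then show ?thesis by auto
qed

lemma L_ge: "j \<in> {1..m} - {i} \<Longrightarrow> - g i j t (X t \<omega>) + Y j t \<omega> \<le> L i t \<omega>"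
  unfolding L_def by (intro Max_ge) auto

lemma L_dom:
  assumes i: "i \<in> {1..m}"
  shows "dominated_process (L i) (\<lambda>\<omega>. \<Sum>j\<in>{1..m}. Ug i j \<omega> + UY j \<omega>)"
  unfolding dominated_process_def
proof (intro conjI ballI)
  have prog: "progressive F T (\<lambda>t \<omega>. - g i j t (X t \<omega>) + Y j t \<omega>)" if "j \<in> {1..m}" for j
    using progressive_sub[OF dominated_processD(1)[OF Y_dom[OF that]] dominated_processD(1)[OF g_dom[OF i that]]]
    by simp
  show "progressive F T (L i)"
    unfolding L_def[abs_def] using prog by (intro progressive_Max) auto
  show "square_integrable M (\<lambda>\<omega>. \<Sum>j\<in>{1..m}. Ug i j \<omega> + UY j \<omega>)"
    by (intro square_integrable_sum square_integrable_add dominated_processD(3)[OF g_dom] dominated_processD(3)[OF Y_dom] i)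
  fix \<omega> assume \<omega>: "\<omega> \<in> space M"
  show "continuous_on {0..T} (\<lambda>t. L i t \<omega>)"
    unfolding L_def using others_nonempty i \<omega>
    by (intro continuous_on_Max_image continuous_on_add continuous_on_minus
        dominated_processD(2)[OF g_dom] dominated_processD(2)[OF Y_dom]) auto
  fix t assume t: "t \<in> {0..T}"
  obtain j where j: "j \<in> {1..m} - {i}" "L i t \<omega> = - g i j t (X t \<omega>) + Y j t \<omega>" using L_in by blast
  have bound: "\<bar>g i j t (X t \<omega>)\<bar> \<le> Ug i j \<omega>" "\<bar>Y j t \<omega>\<bar> \<le> UY j \<omega>" if "j \<in> {1..m}" for j
    using dominated_processD(4)[OF g_dom[OF i that] \<omega>, of t] dominated_processD(4)[OF Y_dom[OF that] \<omega>, of t] t by auto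
  have "\<bar>L i t \<omega>\<bar> \<le> Ug i j \<omega> + UY j \<omega>"
    using bound[of j] j by auto
  also have "\<dots> \<le> (\<Sum>j\<in>{1..m}. Ug i j \<omega> + UY j \<omega>)"
    using j(1)
  proof (intro member_le_sum[where f="\<lambda>j. Ug i j \<omega> + UY j \<omega>"])
    fix k assume "k \<in> {1..m} - {j}"
    then have k: "k \<in> {1..m}" by auto
    show "0 \<le> Ug i k \<omega> + UY k \<omega>" using bound[OF k] by linarith
  qed auto
  finally show "\<bar>L i t \<omega>\<bar> \<le> (\<Sum>j\<in>{1..m}. Ug i j \<omega> + UY j \<omega>)" .
qed

lemma optimal_stopping:
  assumes i: "i \<in> {1..m}"
  shows "optimal_stopping M F T (\<lambda>t \<omega>. \<psi> i t (X t \<omega>)) (L i) (Y i) (UI i)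
    (\<lambda>\<omega>. \<Sum>j\<in>{1..m}. Ug i j \<omega> + UY j \<omega>) (UY i)"
proof unfold_locales
  fix \<omega> assume \<omega>: "\<omega> \<in> space M"
  show "continuous_on {0..T} (\<lambda>t. \<psi> i t (X t \<omega>))" by (rule psi_cont[OF i \<omega>])
  show "Y i T \<omega> = 0" by (rule Y_T[OF i \<omega>])
  obtain j where j: "j \<in> {1..m} - {i}" "L i T \<omega> = - g i j T (X T \<omega>) + Y j T \<omega>" using L_in by blast
  then show "L i T \<omega> \<le> 0" using g_terminal[OF i _ \<omega>, of j] Y_T[OF _ \<omega>, of j] by auto
next
  show "dominated_process (\<lambda>t \<omega>. integral {0..t} (\<lambda>s. \<psi> i s (X s \<omega>))) (UI i)" by (rule I_dom[OF i])
  show "dominated_process (L i) (\<lambda>\<omega>. \<Sum>j\<in>{1..m}. Ug i j \<omega> + UY j \<omega>)" by (rule L_dom[OF i])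
  show "dominated_process (Y i) (UY i)" by (rule Y_dom[OF i])
  fix t assume "t \<in> {0..T}"
  from Y_snell[OF i this] show "is_ess_sup M
      {real_cond_exp M (F t) (\<lambda>\<omega>. integral {t..\<theta> \<omega>} (\<lambda>s. \<psi> i s (X s \<omega>)) + (if \<theta> \<omega> < T then L i (\<theta> \<omega>) \<omega> else 0)) |\<theta>.
        \<theta> \<in> stopping_times_from M F T (\<lambda>_. t)} (Y i t)"
    unfolding L_def .
qed

lemma V_eq:
  assumes "i \<in> {1..m}"
  shows "optimal_stopping.V (\<lambda>t \<omega>. \<psi> i t (X t \<omega>)) (Y i) = V i"
  unfolding V_def[abs_def] optimal_stopping.V_def[OF optimal_stopping[OF assms], abs_def]
    optimal_stopping.I_def[OF optimal_stopping[OF assms], abs_def] ..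

lemma V_dom:
  assumes "i \<in> {1..m}"
  shows "dominated_process (V i) (\<lambda>\<omega>. UY i \<omega> + UI i \<omega>)"
  using optimal_stopping.V_dom[OF optimal_stopping[OF assms]] unfolding V_eq[OF assms] .

lemma V_supermartingale:
  assumes "i \<in> {1..m}"
  shows "supermartingale (V i)"
  using optimal_stopping.V_supermartingale[OF optimal_stopping[OF assms]] unfolding V_eq[OF assms] .

lemma V_meet_martingale:
  assumes "i \<in> {1..m}" "\<sigma> \<in> stops" "A \<in> sets (pre_sigma \<sigma>)"
  shows "(\<integral>\<omega>. indicator A \<omega> * V i (first_meet T (Y i) (L i) \<sigma> \<omega>) \<omega> \<partial>M) = (\<integral>\<omega>. indicator A \<omega> * V i (\<sigma> \<omega>) \<omega> \<partial>M)"
  using optimal_stopping.meet_martingale[OF optimal_stopping[OF assms(1)] assms(2,3)] unfolding V_eq[OF assms(1)] .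

text \<open>The case i = j is included because an admissible strategy may keep its mode at a
  switching time; there the inequality reduces to the vanishing of the diagonal costs.\<close>

lemma Y_ge_switch:
  "AE \<omega> in M. \<forall>i\<in>{1..m}. \<forall>j\<in>{1..m}. \<forall>t\<in>{0..T}. - g i j t (X t \<omega>) + Y j t \<omega> \<le> Y i t \<omega>"
proof -
  have "AE \<omega> in M. \<forall>i\<in>{1..m}. \<forall>t\<in>{0..T}. L i t \<omega> \<le> Y i t \<omega>"
    by (rule AE_finite_allI) (simp, erule optimal_stopping.Y_ge_L[OF optimal_stopping])
  with AE_space show ?thesis
  proof eventually_elim
    case (elim \<omega>)
    show ?case
    proof (intro ballI)
      fix i j t assume *: "i \<in> {1..m}" "j \<in> {1..m}" "t \<in> {0..T}"
      show "- g i j t (X t \<omega>) + Y j t \<omega> \<le> Y i t \<omega>"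
      proof (cases "i = j")
        case True
        then show ?thesis using g_diag * elim by simp
      next
        case False
        then have "- g i j t (X t \<omega>) + Y j t \<omega> \<le> L i t \<omega>" using * by (intro L_ge) auto
        then show ?thesis using elim * by force
      qed
    qed
  qed
qed

text \<open>The events that the initial value lies below or above its mean are known at time zero,
  so each has probability 0 or 1; probability 1 would contradict the mean.\<close>

lemma Y_0_const: "AE \<omega> in M. Y 1 0 \<omega> = (\<integral>\<omega>. Y 1 0 \<omega> \<partial>M)"
proof -
  define y where "y = (\<integral>\<omega>. Y 1 0 \<omega> \<partial>M)"
  have 1: "1 \<in> {1..m}" and 0: "0 \<in> {0..T}" using m_ge T_pos by auto
  have [measurable]: "Y 1 0 \<in> borel_measurable (F 0)"
    by (rule progressive_adapted[OF dominated_processD(1)[OF Y_dom[OF 1]] 0])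
  have int: "integrable M (Y 1 0)"
    using square_integrable_integrable[OF dominated_process_stopped[OF Y_dom[OF 1] stops_const[OF 0]]] by simp
  have ne: "emeasure M (space M) \<noteq> 0" by (simp add: emeasure_space_1)
  have zero_one: "(AE \<omega> in M. \<not> P \<omega>) \<or> (AE \<omega> in M. P \<omega>)" if "Measurable.pred (F 0) P" for P
  proof -
    have A: "{\<omega>\<in>space M. P \<omega>} \<in> sets (F 0)" using that by (simp add: pred_def space_filt)
    then have AM: "{\<omega>\<in>space M. P \<omega>} \<in> events" using sets_filt by blast
    have "AE \<omega> in M. \<not> P \<omega>" if "prob {\<omega>\<in>space M. P \<omega>} = 0"
      using that AM by (subst (asm) prob_eq_0[OF AM]) (auto elim!: eventually_mono[OF eventually_conj[OF _ AE_space]])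
    moreover have "AE \<omega> in M. P \<omega>" if "prob {\<omega>\<in>space M. P \<omega>} = 1"
      using that AM by (subst (asm) prob_eq_1[OF AM]) (auto elim!: eventually_mono)
    ultimately show ?thesis using filt_0_trivial[OF A] by blast
  qed
  have "AE \<omega> in M. \<not> Y 1 0 \<omega> < y"
  proof -
    have "\<not> (AE \<omega> in M. Y 1 0 \<omega> < y)"
      using integral_less_AE_space[OF int _ _ ne, of "\<lambda>_. y"] by (auto simp: y_def prob_space)
    moreover have "Measurable.pred (F 0) (\<lambda>\<omega>. Y 1 0 \<omega> < y)" by measurable
    ultimately show ?thesis using zero_one by blast
  qed
  moreover have "AE \<omega> in M. \<not> y < Y 1 0 \<omega>"
  proof -
    have "\<not> (AE \<omega> in M. y < Y 1 0 \<omega>)"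
      using integral_less_AE_space[OF _ int _ ne, of "\<lambda>_. y"] by (auto simp: y_def prob_space)
    moreover have "Measurable.pred (F 0) (\<lambda>\<omega>. y < Y 1 0 \<omega>)" by measurable
    ultimately show ?thesis using zero_one by blast
  qed
  ultimately show ?thesis unfolding y_def[symmetric] by eventually_elim simp
qed


section \<open>Supermartingale transforms along a strategy\<close>

definition mode_set :: "(nat \<Rightarrow> 'a \<Rightarrow> nat) \<Rightarrow> nat \<Rightarrow> nat \<Rightarrow> 'a set" where
  "mode_set \<xi> k i = {\<omega>\<in>space M. \<xi> k \<omega> = i}"

text \<open>The increments of the single process \<open>V i\<close> over those switching intervals
  on which i is the active mode. Summing over i recovers the increments collected along the
  strategy, see \<open>transform_sum\<close>.\<close>

definition transform :: "nat \<Rightarrow> (nat \<Rightarrow> 'a \<Rightarrow> real) \<Rightarrow> (nat \<Rightarrow> 'a \<Rightarrow> nat) \<Rightarrow> nat \<Rightarrow> 'a \<Rightarrow> real" where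
  "transform i \<tau> \<xi> n \<omega> =
     (\<Sum>k<n. indicator (mode_set \<xi> k i) \<omega> * (V i (\<tau> (Suc k) \<omega>) \<omega> - V i (\<tau> k \<omega>) \<omega>))"

lemma admissibleD:
  assumes "admissible M F T m \<tau> \<xi>"
  shows "\<tau> n \<in> stops" "\<xi> n \<in> measurable (pre_sigma (\<tau> n)) (count_space {1..m})"
    "\<omega> \<in> space M \<Longrightarrow> \<tau> 0 \<omega> = 0" "\<omega> \<in> space M \<Longrightarrow> \<xi> 0 \<omega> = 1"
    "\<omega> \<in> space M \<Longrightarrow> \<tau> n \<omega> \<le> \<tau> (Suc n) \<omega>" "\<omega> \<in> space M \<Longrightarrow> \<tau> n \<omega> \<in> {0..T}"
    "\<omega> \<in> space M \<Longrightarrow> \<xi> n \<omega> \<in> {1..m}"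
proof -
  show "\<tau> n \<in> stops" using assms by (auto simp: admissible_def intro!: stopsI)
  show meas: "\<xi> n \<in> measurable (pre_sigma (\<tau> n)) (count_space {1..m})"
    using assms by (simp add: admissible_def)
  show "\<omega> \<in> space M \<Longrightarrow> \<xi> n \<omega> \<in> {1..m}"
    using measurable_space[OF meas] by (simp add: space_pre_sigma)
qed (use assms in \<open>auto simp: admissible_def\<close>)

lemma mode_set_sets:
  assumes "\<xi> k \<in> measurable N (count_space {1..m})" "space N = space M"
  shows "mode_set \<xi> k i \<in> sets N"
proof (cases "i \<in> {1..m}")
  case True
  have "mode_set \<xi> k i = \<xi> k -` {i} \<inter> space N" by (auto simp: mode_set_def assms(2))
  then show ?thesis using measurable_sets[OF assms(1), of "{i}"] True by simp
next
  case False
  then have "mode_set \<xi> k i = {}"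
    using measurable_space[OF assms(1)] by (auto simp: mode_set_def assms(2))
  then show ?thesis by simp
qed

lemma admissible_reaches_T:
  assumes "admissible M F T m \<tau> \<xi>"
  shows "AE \<omega> in M. \<exists>n. \<tau> n \<omega> = T"
proof -
  note D = admissibleD[OF assms]
  note [measurable] = stops_measurable[OF D(1)]
  have eq: "{\<omega>\<in>space M. \<not> (\<exists>n. \<tau> n \<omega> = T)} = {\<omega>\<in>space M. \<forall>n. \<tau> n \<omega> < T}"
    using D(6) by (force simp: order.order_iff_strict)
  have meas: "{\<omega>\<in>space M. \<forall>n. \<tau> n \<omega> < T} \<in> sets M" by measurable
  show ?thesis unfolding AE_iff_measurable[OF meas eq] using assms by (simp add: admissible_def)
qed

lemma admissible_after_T:
  assumes "admissible M F T m \<tau> \<xi>" "\<omega> \<in> space M" "\<tau> n \<omega> = T" "n \<le> k"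
  shows "\<tau> k \<omega> = T"
proof -
  note D = admissibleD[OF assms(1)]
  have "\<tau> n \<omega> \<le> \<tau> k \<omega>"
    using lift_Suc_mono_le[of "\<lambda>k. \<tau> k \<omega>", OF D(5)[OF assms(2)] assms(4)] .
  then show ?thesis using D(6)[OF assms(2), of k] assms(3) by auto
qed

text \<open>Almost every path reaches T after finitely many steps, whereupon the partial sums stay
  constant; the L2 bound does not depend on n, so expectations converge as well. The conditional
  third conclusion is the martingale case used for the optimal rule.\<close>

lemma transform_limit:
  assumes adm: "admissible M F T m \<tau> \<xi>" and i: "i \<in> {1..m}"
  obtains h where "square_integrable M h" "(\<integral>\<omega>. h \<omega> \<partial>M) \<le> 0"
    "(\<And>k. (\<integral>\<omega>. indicator (mode_set \<xi> k i) \<omega> * V i (\<tau> (Suc k) \<omega>) \<omega> \<partial>M)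
          = (\<integral>\<omega>. indicator (mode_set \<xi> k i) \<omega> * V i (\<tau> k \<omega>) \<omega> \<partial>M)) \<Longrightarrow> (\<integral>\<omega>. h \<omega> \<partial>M) = 0"
    "\<And>\<omega> n. \<omega> \<in> space M \<Longrightarrow> \<tau> n \<omega> = T \<Longrightarrow> transform i \<tau> \<xi> n \<omega> = h \<omega>"
proof -
  note D = admissibleD[OF adm] and VD = dominated_processD[OF V_dom[OF i]]
  \<comment> \<open>Taking the formal limit everywhere gives a measurable function; its value on the
    null set of paths that never reach T is arbitrary.\<close>
  define h where "h \<omega> = lim (\<lambda>n. transform i \<tau> \<xi> n \<omega>)" for \<omega>
  let ?U = "\<lambda>\<omega>. UY i \<omega> + UI i \<omega>"
  have mono: "sets (pre_sigma (\<tau> k)) \<subseteq> sets (pre_sigma (\<tau> (Suc k)))" for k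
    by (rule mono_pre_sigma[OF stopsD(1)[OF D(1)] stopsD(1)[OF D(1)] D(5)])
  have mode: "mode_set \<xi> k i \<in> sets (pre_sigma (\<tau> k))" for k
    by (rule mode_set_sets[OF D(2) space_pre_sigma])
  have modeM: "mode_set \<xi> k i \<in> sets M" for k by (rule pre_sigma_sets_M[OF D(1) mode])
  have bd: "\<bar>V i (\<tau> k \<omega>) \<omega>\<bar> \<le> ?U \<omega>" if "\<omega> \<in> space M" for k \<omega>
    using VD(4)[OF that, of "\<tau> k \<omega>"] D(6)[OF that, of k] by auto
  have super: "(\<integral>\<omega>. indicator B \<omega> * V i (\<tau> (Suc k) \<omega>) \<omega> \<partial>M) \<le> (\<integral>\<omega>. indicator B \<omega> * V i (\<tau> k \<omega>) \<omega> \<partial>M)"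
    if "B \<in> sets (pre_sigma (\<tau> k))" for k B
    by (rule optional_sampling[OF V_dom[OF i] V_supermartingale[OF i] D(1) D(1) D(5) that])
  note L2 = supermartingale_transform_L2_bound[where G="\<lambda>k. pre_sigma (\<tau> k)" and V="\<lambda>k \<omega>. V i (\<tau> k \<omega>) \<omega>"
      and A="\<lambda>k. mode_set \<xi> k i", OF subalgebra_pre_sigma[OF D(1)] mono progressive_stopped[OF VD(1) D(1)] VD(3) bd super mode,
      folded transform_def]
  have sq: "square_integrable M (transform i \<tau> \<xi> n)" for n
    using L2(1)[of n] by (simp add: transform_def[abs_def])
  have bound: "(\<integral>\<omega>. (transform i \<tau> \<xi> n \<omega>)\<^sup>2 \<partial>M) \<le> 112 * (\<integral>\<omega>. (?U \<omega>)\<^sup>2 \<partial>M)" for n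
    using L2(2)[of n] by (simp add: transform_def)
  have const: "transform i \<tau> \<xi> k \<omega> = transform i \<tau> \<xi> n \<omega>" if "\<omega> \<in> space M" "\<tau> n \<omega> = T" "n \<le> k" for \<omega> n k
    using that(3)
  proof (induction k rule: dec_induct)
    case (step k)
    then show ?case
      using admissible_after_T[OF adm that(1,2), of k] admissible_after_T[OF adm that(1,2), of "Suc k"]
      by (simp add: transform_def)
  qed simp
  have lim: "(\<lambda>k. transform i \<tau> \<xi> k \<omega>) \<longlonglongrightarrow> transform i \<tau> \<xi> n \<omega>" if "\<omega> \<in> space M" "\<tau> n \<omega> = T" for \<omega> n
    by (intro tendsto_eventually eventually_sequentiallyI[of n]) (rule const[OF that])
  have h_eq: "h \<omega> = transform i \<tau> \<xi> n \<omega>" if "\<omega> \<in> space M" "\<tau> n \<omega> = T" for \<omega> n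
    unfolding h_def by (rule limI[OF lim[OF that]])
  have h_meas: "h \<in> borel_measurable M"
    unfolding h_def[abs_def] using square_integrableD(1)[OF sq] by measurable
  have h_lim: "AE \<omega> in M. (\<lambda>n. transform i \<tau> \<xi> n \<omega>) \<longlonglongrightarrow> h \<omega>"
    using admissible_reaches_T[OF adm] AE_space by eventually_elim (use lim h_eq in auto)
  note conv = tendsto_integral_L2_bounded[OF sq bound h_meas h_lim]
  have int: "integrable M (\<lambda>\<omega>. indicator (mode_set \<xi> k i) \<omega> * V i (\<tau> l \<omega>) \<omega>)" for k l
    by (rule dominated_process_indicator_integrable[OF V_dom[OF i] D(1) modeM])
  have E: "(\<integral>\<omega>. transform i \<tau> \<xi> n \<omega> \<partial>M) = (\<Sum>k<n. (\<integral>\<omega>. indicator (mode_set \<xi> k i) \<omega> * V i (\<tau> (Suc k) \<omega>) \<omega> \<partial>M)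
      - (\<integral>\<omega>. indicator (mode_set \<xi> k i) \<omega> * V i (\<tau> k \<omega>) \<omega> \<partial>M))" for n
    unfolding transform_def right_diff_distrib
    by (subst Bochner_Integration.integral_sum)
      (auto intro!: sum.cong Bochner_Integration.integrable_diff Bochner_Integration.integral_diff int)
  show thesis
  proof
    show "square_integrable M h" by (rule conv(1))
    show "(\<integral>\<omega>. h \<omega> \<partial>M) \<le> 0"
      by (rule LIMSEQ_le_const2[OF conv(2)]) (use super[OF mode] in \<open>auto simp: E intro!: sum_nonpos\<close>)
    show "(\<integral>\<omega>. h \<omega> \<partial>M) = 0"
      if "\<And>k. (\<integral>\<omega>. indicator (mode_set \<xi> k i) \<omega> * V i (\<tau> (Suc k) \<omega>) \<omega> \<partial>M)
          = (\<integral>\<omega>. indicator (mode_set \<xi> k i) \<omega> * V i (\<tau> k \<omega>) \<omega> \<partial>M)"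
    proof (rule LIMSEQ_unique[OF conv(2)])
      show "(\<lambda>n. \<integral>\<omega>. transform i \<tau> \<xi> n \<omega> \<partial>M) \<longlonglongrightarrow> 0" unfolding E that by simp
    qed
    show "transform i \<tau> \<xi> n \<omega> = h \<omega>" if "\<omega> \<in> space M" "\<tau> n \<omega> = T" for \<omega> n
      using h_eq[OF that] by simp
  qed
qed

lemma transform_sum:
  assumes adm: "admissible M F T m \<tau> \<xi>" and \<omega>: "\<omega> \<in> space M"
  shows "(\<Sum>i\<in>{1..m}. transform i \<tau> \<xi> n \<omega>) = (\<Sum>k<n. V (\<xi> k \<omega>) (\<tau> (Suc k) \<omega>) \<omega> - V (\<xi> k \<omega>) (\<tau> k \<omega>) \<omega>)"
proof -
  note D = admissibleD[OF adm]
  have "(\<Sum>i\<in>{1..m}. transform i \<tau> \<xi> n \<omega>)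
    = (\<Sum>k<n. \<Sum>i\<in>{1..m}. indicator (mode_set \<xi> k i) \<omega> * (V i (\<tau> (Suc k) \<omega>) \<omega> - V i (\<tau> k \<omega>) \<omega>))"
    unfolding transform_def by (rule sum.swap)
  also have "\<dots> = (\<Sum>k<n. \<Sum>i\<in>{1..m}. if i = \<xi> k \<omega> then V (\<xi> k \<omega>) (\<tau> (Suc k) \<omega>) \<omega> - V (\<xi> k \<omega>) (\<tau> k \<omega>) \<omega> else 0)"
    using \<omega> by (intro sum.cong refl) (auto simp: mode_set_def indicator_def)
  also have "\<dots> = (\<Sum>k<n. V (\<xi> k \<omega>) (\<tau> (Suc k) \<omega>) \<omega> - V (\<xi> k \<omega>) (\<tau> k \<omega>) \<omega>)"
    using D(7)[OF \<omega>] by (intro sum.cong refl) (subst sum.delta, simp_all)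
  finally show ?thesis .
qed

section \<open>Running profit and the decomposition of the payoff\<close>

lemma psi_integrable_on:
  assumes "i \<in> {1..m}" "\<omega> \<in> space M" "0 \<le> a" "b \<le> T"
  shows "(\<lambda>s. \<psi> i s (X s \<omega>)) integrable_on {a..b}"
  using assms by (intro integrable_continuous_real continuous_on_subset[OF psi_cont]) auto

lemma psi_integral_diff:
  assumes "i \<in> {1..m}" "\<omega> \<in> space M" "0 \<le> a" "a \<le> b" "b \<le> T"
  shows "integral {a..b} (\<lambda>s. \<psi> i s (X s \<omega>))
    = integral {0..b} (\<lambda>s. \<psi> i s (X s \<omega>)) - integral {0..a} (\<lambda>s. \<psi> i s (X s \<omega>))"
  using Henstock_Kurzweil_Integration.integral_combine[of 0 a b "\<lambda>s. \<psi> i s (X s \<omega>)"]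
    psi_integrable_on[OF assms(1,2), of 0 b] assms by simp

lemma running_has_integral:
  assumes adm: "admissible M F T m \<tau> \<xi>" and \<omega>: "\<omega> \<in> space M"
  shows "((\<lambda>s. \<psi> (mode_indicator \<tau> \<xi> s \<omega>) s (X s \<omega>)) has_integral
    (\<Sum>k<n. integral {\<tau> k \<omega>..\<tau> (Suc k) \<omega>} (\<lambda>s. \<psi> (\<xi> k \<omega>) s (X s \<omega>)))) {0..\<tau> n \<omega>}"
proof (induction n)
  case 0
  then show ?case using admissibleD(3)[OF adm \<omega>] by (simp add: has_integral_refl)
next
  case (Suc n)
  note D = admissibleD[OF adm]
  have "((\<lambda>s. \<psi> (mode_indicator \<tau> \<xi> s \<omega>) s (X s \<omega>)) has_integral
     integral {\<tau> n \<omega>..\<tau> (Suc n) \<omega>} (\<lambda>s. \<psi> (\<xi> n \<omega>) s (X s \<omega>))) {\<tau> n \<omega>..\<tau> (Suc n) \<omega>}"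
  \<comment> \<open>The left end point does not belong to the half open interval on which mode
    \<open>\<xi> n \<omega>\<close> is active, so the integrands are compared off one point.\<close>
  proof (rule has_integral_spike_finite[of "{\<tau> n \<omega>}"])
    show "((\<lambda>s. \<psi> (\<xi> n \<omega>) s (X s \<omega>)) has_integral
     integral {\<tau> n \<omega>..\<tau> (Suc n) \<omega>} (\<lambda>s. \<psi> (\<xi> n \<omega>) s (X s \<omega>))) {\<tau> n \<omega>..\<tau> (Suc n) \<omega>}"
      using D(6)[OF \<omega>, of n] D(6)[OF \<omega>, of "Suc n"]
      by (intro integrable_integral psi_integrable_on D(7) \<omega>) auto
    fix s assume "s \<in> {\<tau> n \<omega>..\<tau> (Suc n) \<omega>} - {\<tau> n \<omega>}"
    then show "\<psi> (mode_indicator \<tau> \<xi> s \<omega>) s (X s \<omega>) = \<psi> (\<xi> n \<omega>) s (X s \<omega>)"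
      using mode_indicator_eq[of \<tau> \<omega> n s \<xi>] D(4)[OF \<omega>] D(5)[OF \<omega>] by auto
  qed simp
  then show ?case
    using has_integral_combine[OF _ D(5)[OF \<omega>] Suc.IH] D(6)[OF \<omega>, of n] by simp
qed

text \<open>The bound adds up the absolute profits of all modes and hence does not depend on the
  strategy. Together with a bound on the payoff it will control the total switching cost.\<close>

lemma running_integral_le:
  assumes adm: "admissible M F T m \<tau> \<xi>" and \<omega>: "\<omega> \<in> space M" and n: "\<tau> n \<omega> = T"
  shows "\<bar>integral {0..T} (\<lambda>s. \<psi> (mode_indicator \<tau> \<xi> s \<omega>) s (X s \<omega>))\<bar> \<le> (\<Sum>i\<in>{1..m}. UI i \<omega>)"
proof -
  note D = admissibleD[OF adm]
  define \<phi> where "\<phi> s = (\<Sum>i\<in>{1..m}. \<bar>\<psi> i s (X s \<omega>)\<bar>)" for s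
  have \<phi>_cont: "continuous_on {0..T} \<phi>"
    unfolding \<phi>_def by (intro continuous_on_sum continuous_on_rabs psi_cont \<omega>)
  have \<phi>_int: "\<phi> integrable_on {a..b}" if "0 \<le> a" "b \<le> T" for a b
    using that by (intro integrable_continuous_real continuous_on_subset[OF \<phi>_cont]) auto
  have "\<bar>\<Sum>k<n. integral {\<tau> k \<omega>..\<tau> (Suc k) \<omega>} (\<lambda>s. \<psi> (\<xi> k \<omega>) s (X s \<omega>))\<bar> \<le> integral {0..\<tau> n \<omega>} \<phi>" for n
  proof (induction n)
    case 0
    then show ?case using D(3)[OF \<omega>] by simp
  next
    case (Suc n)
    have \<tau>: "0 \<le> \<tau> n \<omega>" "\<tau> n \<omega> \<le> \<tau> (Suc n) \<omega>" "\<tau> (Suc n) \<omega> \<le> T"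
      using D(5,6)[OF \<omega>] by auto
    have "norm (integral {\<tau> n \<omega>..\<tau> (Suc n) \<omega>} (\<lambda>s. \<psi> (\<xi> n \<omega>) s (X s \<omega>))) \<le> integral {\<tau> n \<omega>..\<tau> (Suc n) \<omega>} \<phi>"
    proof (rule integral_norm_bound_integral)
      fix s
      show "norm (\<psi> (\<xi> n \<omega>) s (X s \<omega>)) \<le> \<phi> s"
        unfolding \<phi>_def using member_le_sum[of "\<xi> n \<omega>" "{1..m}" "\<lambda>i. \<bar>\<psi> i s (X s \<omega>)\<bar>"] D(7)[OF \<omega>, of n] by simp
    qed (use \<tau> in \<open>auto intro!: psi_integrable_on D(7) \<omega> \<phi>_int simp del: atLeastAtMost_iff\<close>)
    moreover have "integral {0..\<tau> n \<omega>} \<phi> + integral {\<tau> n \<omega>..\<tau> (Suc n) \<omega>} \<phi> = integral {0..\<tau> (Suc n) \<omega>} \<phi>"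
      using \<tau> by (intro Henstock_Kurzweil_Integration.integral_combine \<phi>_int) auto
    ultimately show ?case using Suc by simp
  qed
  from this[of n] have "\<bar>integral {0..T} (\<lambda>s. \<psi> (mode_indicator \<tau> \<xi> s \<omega>) s (X s \<omega>))\<bar> \<le> integral {0..T} \<phi>"
    using integral_unique[OF running_has_integral[OF adm \<omega>, of n]] n by simp
  also have "integral {0..T} \<phi> = (\<Sum>i\<in>{1..m}. integral {0..T} (\<lambda>s. \<bar>\<psi> i s (X s \<omega>)\<bar>))"
    unfolding \<phi>_def by (rule integral_sum)
      (auto intro!: integrable_continuous_real continuous_on_rabs psi_cont \<omega> simp del: atLeastAtMost_iff)
  also have "\<dots> \<le> (\<Sum>i\<in>{1..m}. UI i \<omega>)" by (intro sum_mono psi_abs_le \<omega>)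
  finally show ?thesis .
qed

definition switch_cost_at :: "(nat \<Rightarrow> 'a \<Rightarrow> real) \<Rightarrow> (nat \<Rightarrow> 'a \<Rightarrow> nat) \<Rightarrow> nat \<Rightarrow> 'a \<Rightarrow> real" where
  "switch_cost_at \<tau> \<xi> k \<omega> = (if \<tau> (Suc k) \<omega> < T
     then g (\<xi> k \<omega>) (\<xi> (Suc k) \<omega>) (\<tau> (Suc k) \<omega>) (X (\<tau> (Suc k) \<omega>) \<omega>) else 0)"

text \<open>The value lost by the switch: the excess of the old mode's value over the new mode's
  value net of the cost. At T it vanishes, since all values are zero there and no cost is
  charged.\<close>

definition slack :: "(nat \<Rightarrow> 'a \<Rightarrow> real) \<Rightarrow> (nat \<Rightarrow> 'a \<Rightarrow> nat) \<Rightarrow> nat \<Rightarrow> 'a \<Rightarrow> real" where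
  "slack \<tau> \<xi> k \<omega> = Y (\<xi> k \<omega>) (\<tau> (Suc k) \<omega>) \<omega> - Y (\<xi> (Suc k) \<omega>) (\<tau> (Suc k) \<omega>) \<omega> + switch_cost_at \<tau> \<xi> k \<omega>"

text \<open>On each interval the profit is the increment of \<open>V\<close> minus that of
  \<open>Y\<close> for the active mode. Regrouping the \<open>Y\<close> terms at the switching times
  leaves the slacks and a telescoping sum, which starts at \<open>Y 1 0\<close> and ends at 0 since
  \<open>Y\<close> vanishes at T.\<close>

lemma payoff_decomposition:
  assumes adm: "admissible M F T m \<tau> \<xi>" and \<omega>: "\<omega> \<in> space M" and n: "\<tau> n \<omega> = T"
  shows "switching_payoff T X \<psi> g \<tau> \<xi> \<omega> =
    Y 1 0 \<omega> + (\<Sum>i\<in>{1..m}. transform i \<tau> \<xi> n \<omega>) - (\<Sum>k<n. slack \<tau> \<xi> k \<omega>)"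
proof -
  note D = admissibleD[OF adm]
  have run: "integral {0..T} (\<lambda>s. \<psi> (mode_indicator \<tau> \<xi> s \<omega>) s (X s \<omega>))
    = (\<Sum>k<n. integral {\<tau> k \<omega>..\<tau> (Suc k) \<omega>} (\<lambda>s. \<psi> (\<xi> k \<omega>) s (X s \<omega>)))"
    using integral_unique[OF running_has_integral[OF adm \<omega>, of n]] n by simp
  have cost: "switching_cost T X g \<tau> \<xi> \<omega> = (\<Sum>k<n. switch_cost_at \<tau> \<xi> k \<omega>)"
    unfolding switching_cost_def switch_cost_at_def
    by (rule suminf_finite) (use admissible_after_T[OF adm \<omega> n] in auto)
  have V_diff: "V (\<xi> k \<omega>) (\<tau> (Suc k) \<omega>) \<omega> - V (\<xi> k \<omega>) (\<tau> k \<omega>) \<omega>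
    = integral {\<tau> k \<omega>..\<tau> (Suc k) \<omega>} (\<lambda>s. \<psi> (\<xi> k \<omega>) s (X s \<omega>))
      + (slack \<tau> \<xi> k \<omega> - switch_cost_at \<tau> \<xi> k \<omega>)
      + (Y (\<xi> (Suc k) \<omega>) (\<tau> (Suc k) \<omega>) \<omega> - Y (\<xi> k \<omega>) (\<tau> k \<omega>) \<omega>)" for k
  proof -
    have "0 \<le> \<tau> k \<omega>" "\<tau> k \<omega> \<le> \<tau> (Suc k) \<omega>" "\<tau> (Suc k) \<omega> \<le> T" using D(5,6)[OF \<omega>] by auto
    from psi_integral_diff[OF D(7)[OF \<omega>] \<omega> this] show ?thesis by (simp add: V_def slack_def)
  qed
  have "(\<Sum>k<n. Y (\<xi> (Suc k) \<omega>) (\<tau> (Suc k) \<omega>) \<omega> - Y (\<xi> k \<omega>) (\<tau> k \<omega>) \<omega>)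
    = Y (\<xi> n \<omega>) (\<tau> n \<omega>) \<omega> - Y (\<xi> 0 \<omega>) (\<tau> 0 \<omega>) \<omega>"
    by (rule sum_lessThan_telescope)
  also have "\<dots> = - Y 1 0 \<omega>" using Y_T[OF D(7)[OF \<omega>] \<omega>] n D(3,4)[OF \<omega>] by simp
  finally show ?thesis
    unfolding switching_payoff_def run cost transform_sum[OF adm \<omega>] V_diff sum.distrib sum_subtractf by simp
qed

lemma slack_nonneg:
  assumes adm: "admissible M F T m \<tau> \<xi>"
  shows "AE \<omega> in M. \<forall>k. 0 \<le> slack \<tau> \<xi> k \<omega>"
  using Y_ge_switch AE_space
proof eventually_elim
  case (elim \<omega>)
  note D = admissibleD[OF adm]
  show ?case
  proof
    fix k
    show "0 \<le> slack \<tau> \<xi> k \<omega>"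
    proof (cases "\<tau> (Suc k) \<omega> < T")
      case True
      then show ?thesis
        using elim(1)[rule_format, OF D(7)[OF elim(2)] D(7)[OF elim(2)] D(6)[OF elim(2)], of k "Suc k" "Suc k"]
        by (simp add: slack_def switch_cost_at_def)
    next
      case False
      then have "\<tau> (Suc k) \<omega> = T" using D(6)[OF elim(2), of "Suc k"] by auto
      then show ?thesis using Y_T[OF D(7)[OF elim(2)] elim(2)] by (simp add: slack_def switch_cost_at_def)
    qed
  qed
qed

text \<open>\<open>H\<close> is the initial value plus the limits of the m transforms. It is square
  integrable even when the payoff is not integrable, so an arbitrary payoff can be compared with
  it.\<close>

lemma switching_value:
  assumes adm: "admissible M F T m \<tau> \<xi>"
  obtains H where "square_integrable M H" "(\<integral>\<omega>. H \<omega> \<partial>M) \<le> (\<integral>\<omega>. Y 1 0 \<omega> \<partial>M)"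
    "(\<And>i k. i \<in> {1..m} \<Longrightarrow> (\<integral>\<omega>. indicator (mode_set \<xi> k i) \<omega> * V i (\<tau> (Suc k) \<omega>) \<omega> \<partial>M)
          = (\<integral>\<omega>. indicator (mode_set \<xi> k i) \<omega> * V i (\<tau> k \<omega>) \<omega> \<partial>M)) \<Longrightarrow> (\<integral>\<omega>. H \<omega> \<partial>M) = (\<integral>\<omega>. Y 1 0 \<omega> \<partial>M)"
    "AE \<omega> in M. \<exists>n. \<tau> n \<omega> = T \<and> switching_payoff T X \<psi> g \<tau> \<xi> \<omega> = H \<omega> - (\<Sum>k<n. slack \<tau> \<xi> k \<omega>)"
proof -
  have "\<exists>h. square_integrable M h \<and> (\<integral>\<omega>. h \<omega> \<partial>M) \<le> 0 \<and>
    ((\<forall>k. (\<integral>\<omega>. indicator (mode_set \<xi> k i) \<omega> * V i (\<tau> (Suc k) \<omega>) \<omega> \<partial>M)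
          = (\<integral>\<omega>. indicator (mode_set \<xi> k i) \<omega> * V i (\<tau> k \<omega>) \<omega> \<partial>M)) \<longrightarrow> (\<integral>\<omega>. h \<omega> \<partial>M) = 0) \<and>
    (\<forall>\<omega> n. \<omega> \<in> space M \<longrightarrow> \<tau> n \<omega> = T \<longrightarrow> transform i \<tau> \<xi> n \<omega> = h \<omega>)" if "i \<in> {1..m}" for i
    by (rule transform_limit[OF adm that]) blast
  then have "\<forall>i\<in>{1..m}. \<exists>h. square_integrable M h \<and> (\<integral>\<omega>. h \<omega> \<partial>M) \<le> 0 \<and>
    ((\<forall>k. (\<integral>\<omega>. indicator (mode_set \<xi> k i) \<omega> * V i (\<tau> (Suc k) \<omega>) \<omega> \<partial>M)
          = (\<integral>\<omega>. indicator (mode_set \<xi> k i) \<omega> * V i (\<tau> k \<omega>) \<omega> \<partial>M)) \<longrightarrow> (\<integral>\<omega>. h \<omega> \<partial>M) = 0) \<and>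
    (\<forall>\<omega> n. \<omega> \<in> space M \<longrightarrow> \<tau> n \<omega> = T \<longrightarrow> transform i \<tau> \<xi> n \<omega> = h \<omega>)" by blast
  from bchoice[OF this] obtain h where h0: "\<forall>i\<in>{1..m}. square_integrable M (h i) \<and> (\<integral>\<omega>. h i \<omega> \<partial>M) \<le> 0 \<and>
    ((\<forall>k. (\<integral>\<omega>. indicator (mode_set \<xi> k i) \<omega> * V i (\<tau> (Suc k) \<omega>) \<omega> \<partial>M)
          = (\<integral>\<omega>. indicator (mode_set \<xi> k i) \<omega> * V i (\<tau> k \<omega>) \<omega> \<partial>M)) \<longrightarrow> (\<integral>\<omega>. h i \<omega> \<partial>M) = 0) \<and>
    (\<forall>\<omega> n. \<omega> \<in> space M \<longrightarrow> \<tau> n \<omega> = T \<longrightarrow> transform i \<tau> \<xi> n \<omega> = h i \<omega>)" ..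
  have h: "square_integrable M (h i)" "(\<integral>\<omega>. h i \<omega> \<partial>M) \<le> 0"
    "(\<And>k. (\<integral>\<omega>. indicator (mode_set \<xi> k i) \<omega> * V i (\<tau> (Suc k) \<omega>) \<omega> \<partial>M)
          = (\<integral>\<omega>. indicator (mode_set \<xi> k i) \<omega> * V i (\<tau> k \<omega>) \<omega> \<partial>M)) \<Longrightarrow> (\<integral>\<omega>. h i \<omega> \<partial>M) = 0"
    "\<And>\<omega> n. \<omega> \<in> space M \<Longrightarrow> \<tau> n \<omega> = T \<Longrightarrow> transform i \<tau> \<xi> n \<omega> = h i \<omega>"
    if "i \<in> {1..m}" for i
    using h0[rule_format, OF that] by blast+
  have 1: "1 \<in> {1..m}" and 0: "0 \<in> {0..T}" using m_ge T_pos by auto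
  have Y0: "square_integrable M (Y 1 0)"
    using dominated_process_stopped[OF Y_dom[OF 1] stops_const[OF 0]] by simp
  define H where "H \<omega> = Y 1 0 \<omega> + (\<Sum>i\<in>{1..m}. h i \<omega>)" for \<omega>
  have h_int: "integrable M (h i)" if "i \<in> {1..m}" for i by (rule square_integrable_integrable[OF h(1)[OF that]])
  have "(\<integral>\<omega>. H \<omega> \<partial>M) = (\<integral>\<omega>. Y 1 0 \<omega> \<partial>M) + (\<integral>\<omega>. (\<Sum>i\<in>{1..m}. h i \<omega>) \<partial>M)"
    unfolding H_def
    by (rule Bochner_Integration.integral_add[OF square_integrable_integrable[OF Y0] Bochner_Integration.integrable_sum[OF h_int]])
  also have "(\<integral>\<omega>. (\<Sum>i\<in>{1..m}. h i \<omega>) \<partial>M) = (\<Sum>i\<in>{1..m}. \<integral>\<omega>. h i \<omega> \<partial>M)"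
    by (rule Bochner_Integration.integral_sum[OF h_int])
  finally have E: "(\<integral>\<omega>. H \<omega> \<partial>M) = (\<integral>\<omega>. Y 1 0 \<omega> \<partial>M) + (\<Sum>i\<in>{1..m}. \<integral>\<omega>. h i \<omega> \<partial>M)" .
  show thesis
  proof
    show "square_integrable M H" unfolding H_def[abs_def]
      by (intro square_integrable_add Y0 square_integrable_sum h(1))
    show "(\<integral>\<omega>. H \<omega> \<partial>M) \<le> (\<integral>\<omega>. Y 1 0 \<omega> \<partial>M)" unfolding E using sum_nonpos[of "{1..m}" "\<lambda>i. \<integral>\<omega>. h i \<omega> \<partial>M", OF h(2)] by linarith
    show "(\<integral>\<omega>. H \<omega> \<partial>M) = (\<integral>\<omega>. Y 1 0 \<omega> \<partial>M)"
      if "\<And>i k. i \<in> {1..m} \<Longrightarrow> (\<integral>\<omega>. indicator (mode_set \<xi> k i) \<omega> * V i (\<tau> (Suc k) \<omega>) \<omega> \<partial>M)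
          = (\<integral>\<omega>. indicator (mode_set \<xi> k i) \<omega> * V i (\<tau> k \<omega>) \<omega> \<partial>M)"
      unfolding E using h(3)[OF _ that] by simp
    show "AE \<omega> in M. \<exists>n. \<tau> n \<omega> = T \<and> switching_payoff T X \<psi> g \<tau> \<xi> \<omega> = H \<omega> - (\<Sum>k<n. slack \<tau> \<xi> k \<omega>)"
      using admissible_reaches_T[OF adm] AE_space
    proof eventually_elim
      case (elim \<omega>)
      then obtain n where n: "\<tau> n \<omega> = T" by blast
      then show ?case using payoff_decomposition[OF adm elim(2) n] h(4)[OF _ elim(2) n]
        by (intro exI[of _ n]) (simp add: H_def)
    qed
  qed
qed

theorem switching_upper_bound:
  assumes adm: "admissible M F T m \<tau> \<xi>"
  shows "J M T X \<psi> g \<tau> \<xi> \<le> ereal (\<integral>\<omega>. Y 1 0 \<omega> \<partial>M)"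
proof (rule switching_value[OF adm])
  fix H assume H: "square_integrable M H" "(\<integral>\<omega>. H \<omega> \<partial>M) \<le> (\<integral>\<omega>. Y 1 0 \<omega> \<partial>M)"
    "AE \<omega> in M. \<exists>n. \<tau> n \<omega> = T \<and> switching_payoff T X \<psi> g \<tau> \<xi> \<omega> = H \<omega> - (\<Sum>k<n. slack \<tau> \<xi> k \<omega>)"
  have "AE \<omega> in M. switching_payoff T X \<psi> g \<tau> \<xi> \<omega> \<le> H \<omega>"
    using H(3) slack_nonneg[OF adm]
  proof eventually_elim
    case (elim \<omega>)
    then obtain n where "switching_payoff T X \<psi> g \<tau> \<xi> \<omega> = H \<omega> - (\<Sum>k<n. slack \<tau> \<xi> k \<omega>)" by blast
    moreover have "0 \<le> (\<Sum>k<n. slack \<tau> \<xi> k \<omega>)" using elim(2) by (intro sum_nonneg) simp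
    ultimately show ?case by simp
  qed
  from ext_expectation_le[OF this square_integrable_integrable[OF H(1)]]
  have "J M T X \<psi> g \<tau> \<xi> \<le> ereal (\<integral>\<omega>. H \<omega> \<partial>M)" by (simp add: J_def)
  also have "\<dots> \<le> ereal (\<integral>\<omega>. Y 1 0 \<omega> \<partial>M)" using H(2) by simp
  finally show ?thesis .
qed

section \<open>Strategies that switch at first meetings with the obstacle\<close>

definition optimal_rule :: "(nat \<Rightarrow> 'a \<Rightarrow> real) \<Rightarrow> (nat \<Rightarrow> 'a \<Rightarrow> nat) \<Rightarrow> bool" where
  "optimal_rule \<tau> \<xi> \<longleftrightarrow>
     (\<forall>\<omega>\<in>space M. \<tau> 0 \<omega> = 0 \<and> \<xi> 0 \<omega> = 1) \<and>
     (\<forall>n. \<forall>\<omega>\<in>space M. \<tau> (Suc n) \<omega> = first_meet T (Y (\<xi> n \<omega>)) (L (\<xi> n \<omega>)) (\<tau> n) \<omega>) \<and>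
     (\<forall>n. \<xi> (Suc n) \<in> measurable (pre_sigma (\<tau> (Suc n))) (count_space {1..m})) \<and>
     (\<forall>n. \<forall>\<omega>\<in>space M. \<xi> (Suc n) \<omega> \<in> {1..m} - {\<xi> n \<omega>} \<and>
        - g (\<xi> n \<omega>) (\<xi> (Suc n) \<omega>) (\<tau> (Suc n) \<omega>) (X (\<tau> (Suc n) \<omega>) \<omega>) + Y (\<xi> (Suc n) \<omega>) (\<tau> (Suc n) \<omega>) \<omega>
          = L (\<xi> n \<omega>) (\<tau> (Suc n) \<omega>) \<omega>)"

text \<open>To have stopped by t means that for some i the index is i and \<open>D i\<close> has
  occurred. Since \<sigma> \<le> \<open>D i\<close>, one may add that \<sigma> has occurred too, and
  with this addition the event about the index is known at t.\<close>

lemma stops_select: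
  assumes \<sigma>: "\<sigma> \<in> stops" and \<eta>: "\<eta> \<in> measurable (pre_sigma \<sigma>) (count_space {1..m})"
    and D: "\<And>i. i \<in> {1..m} \<Longrightarrow> D i \<in> stops" and le: "\<And>i \<omega>. i \<in> {1..m} \<Longrightarrow> \<omega> \<in> space M \<Longrightarrow> \<sigma> \<omega> \<le> D i \<omega>"
    and \<theta>: "\<And>\<omega>. \<omega> \<in> space M \<Longrightarrow> \<theta> \<omega> = D (\<eta> \<omega>) \<omega>"
  shows "\<theta> \<in> stops"
proof (rule stopsI_le)
  have \<eta>_in: "\<eta> \<omega> \<in> {1..m}" if "\<omega> \<in> space M" for \<omega>
    using measurable_space[OF \<eta>] that by (simp add: space_pre_sigma)
  show "0 \<le> \<theta> \<omega>" "\<theta> \<omega> \<le> T" if "\<omega> \<in> space M" for \<omega>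
    using stopsD[OF D[OF \<eta>_in[OF that]]] \<theta> that by auto
  fix t
  have "{\<omega>\<in>space M. \<theta> \<omega> \<le> t} = (\<Union>i\<in>{1..m}. {\<omega>\<in>mode_set (\<lambda>_. \<eta>) 0 i. \<sigma> \<omega> \<le> t} \<inter> {\<omega>\<in>space M. D i \<omega> \<le> t})"
  proof (intro equalityI subsetI)
    fix \<omega> assume "\<omega> \<in> {\<omega>\<in>space M. \<theta> \<omega> \<le> t}"
    then have \<omega>: "\<omega> \<in> space M" "D (\<eta> \<omega>) \<omega> \<le> t" using \<theta> by auto
    moreover have "\<sigma> \<omega> \<le> t" using le[OF \<eta>_in \<omega>(1)] \<omega> by fastforce
    ultimately show "\<omega> \<in> (\<Union>i\<in>{1..m}. {\<omega>\<in>mode_set (\<lambda>_. \<eta>) 0 i. \<sigma> \<omega> \<le> t} \<inter> {\<omega>\<in>space M. D i \<omega> \<le> t})"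
      using \<eta>_in[OF \<omega>(1)] by (intro UN_I[of "\<eta> \<omega>"]) (auto simp: mode_set_def)
  qed (auto simp: mode_set_def \<theta>)
  also have "\<dots> \<in> sets (F t)"
  proof (intro sets.finite_UN sets.Int finite_atLeastAtMost)
    fix i assume i: "i \<in> {1..m}"
    show "{\<omega>\<in>mode_set (\<lambda>_. \<eta>) 0 i. \<sigma> \<omega> \<le> t} \<in> sets (F t)"
      by (rule sets_pre_sigmaD[OF stopsD(1)[OF \<sigma>] mode_set_sets[OF _ space_pre_sigma]]) (rule \<eta>)
    show "{\<omega>\<in>space M. D i \<omega> \<le> t} \<in> sets (F t)"
      using stopping_timeD[OF stopsD(1)[OF D[OF i]], of t] by (simp add: pred_def space_filt)
  qed
  finally show "{\<omega>\<in>space M. \<theta> \<omega> \<le> t} \<in> sets (F t)" .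
qed

lemma meet_stops:
  assumes "i \<in> {1..m}" "\<sigma> \<in> stops"
  shows "first_meet T (Y i) (L i) \<sigma> \<in> stops"
  using dominated_processD[OF Y_dom[OF assms(1)]] dominated_processD[OF L_dom[OF assms(1)]]
  by (intro first_meet_stops assms(2))

lemma meet_select_stops:
  assumes \<sigma>: "\<sigma> \<in> stops" and \<eta>: "\<eta> \<in> measurable (pre_sigma \<sigma>) (count_space {1..m})"
    and \<theta>: "\<And>\<omega>. \<omega> \<in> space M \<Longrightarrow> \<theta> \<omega> = first_meet T (Y (\<eta> \<omega>)) (L (\<eta> \<omega>)) \<sigma> \<omega>"
  shows "\<theta> \<in> stops"
  by (rule stops_select[OF \<sigma> \<eta> meet_stops[OF _ \<sigma>] _ \<theta>])
    (auto intro!: first_meet_ge stopsD(3)[OF \<sigma>])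

lemma optimal_rule_stops:
  assumes "optimal_rule \<tau> \<xi>"
  shows "\<tau> n \<in> stops \<and> \<xi> n \<in> measurable (pre_sigma (\<tau> n)) (count_space {1..m})"
proof (induction n)
  case 0
  have "\<tau> 0 \<in> stops"
  proof (rule stopsI_le)
    fix t assume "t \<in> {0..<T}"
    then have "{\<omega>\<in>space M. \<tau> 0 \<omega> \<le> t} = space (F t)" using assms by (auto simp: optimal_rule_def space_filt)
    then show "{\<omega>\<in>space M. \<tau> 0 \<omega> \<le> t} \<in> sets (F t)" by (metis sets.top)
  qed (use assms T_pos in \<open>auto simp: optimal_rule_def\<close>)
  moreover have "\<xi> 0 \<in> measurable (pre_sigma (\<tau> 0)) (count_space {1..m}) \<longleftrightarrow>
      (\<lambda>_. 1) \<in> measurable (pre_sigma (\<tau> 0)) (count_space {1..m})"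
    using assms by (intro measurable_cong) (auto simp: optimal_rule_def space_pre_sigma)
  ultimately show ?case using m_ge by (auto intro!: measurable_const)
next
  case (Suc n)
  then show ?case
    using assms by (auto simp: optimal_rule_def intro!: meet_select_stops[of "\<tau> n" "\<xi> n" "\<tau> (Suc n)"])
qed


lemma optimal_ruleD:
  assumes "optimal_rule \<tau> \<xi>" "\<omega> \<in> space M"
  shows "\<tau> 0 \<omega> = 0" "\<xi> 0 \<omega> = 1"
    "\<tau> (Suc n) \<omega> = first_meet T (Y (\<xi> n \<omega>)) (L (\<xi> n \<omega>)) (\<tau> n) \<omega>"
    "\<xi> (Suc n) \<omega> \<noteq> \<xi> n \<omega>"
    "- g (\<xi> n \<omega>) (\<xi> (Suc n) \<omega>) (\<tau> (Suc n) \<omega>) (X (\<tau> (Suc n) \<omega>) \<omega>) + Y (\<xi> (Suc n) \<omega>) (\<tau> (Suc n) \<omega>) \<omega>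
          = L (\<xi> n \<omega>) (\<tau> (Suc n) \<omega>) \<omega>"
    "\<xi> n \<omega> \<in> {1..m}" "\<tau> n \<omega> \<in> {0..T}" "\<tau> n \<omega> \<le> \<tau> (Suc n) \<omega>"
proof -
  note st = optimal_rule_stops[OF assms(1)]
  show "\<tau> 0 \<omega> = 0" "\<xi> 0 \<omega> = 1" "\<xi> (Suc n) \<omega> \<noteq> \<xi> n \<omega>"
    "- g (\<xi> n \<omega>) (\<xi> (Suc n) \<omega>) (\<tau> (Suc n) \<omega>) (X (\<tau> (Suc n) \<omega>) \<omega>) + Y (\<xi> (Suc n) \<omega>) (\<tau> (Suc n) \<omega>) \<omega>
          = L (\<xi> n \<omega>) (\<tau> (Suc n) \<omega>) \<omega>"
    and step: "\<tau> (Suc n) \<omega> = first_meet T (Y (\<xi> n \<omega>)) (L (\<xi> n \<omega>)) (\<tau> n) \<omega>"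
    using assms unfolding optimal_rule_def by blast+
  show "\<xi> n \<omega> \<in> {1..m}"
    using measurable_space[OF conjunct2[OF st[of n]]] assms(2) by (simp add: space_pre_sigma)
  show mem: "\<tau> n \<omega> \<in> {0..T}" using stopsD[OF conjunct1[OF st[of n]]] assms(2) by auto
  show "\<tau> n \<omega> \<le> \<tau> (Suc n) \<omega>" unfolding step using mem by (intro first_meet_ge) auto
qed

text \<open>A switching time before T is an actual meeting, so the value of the old mode equals its
  obstacle, and the new mode attains that obstacle.\<close>

lemma optimal_rule_slack:
  assumes opt: "optimal_rule \<tau> \<xi>" and \<omega>: "\<omega> \<in> space M"
  shows "slack \<tau> \<xi> n \<omega> = 0"
proof (cases "\<tau> (Suc n) \<omega> < T")
  case True
  note D = optimal_ruleD[OF opt \<omega>]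
  have "Y (\<xi> n \<omega>) (\<tau> (Suc n) \<omega>) \<omega> = L (\<xi> n \<omega>) (\<tau> (Suc n) \<omega>) \<omega>"
    using True D(7)[of n] unfolding D(3)[of n]
    by (intro first_meet_attained dominated_processD(2)[OF Y_dom[OF D(6)] \<omega>] dominated_processD(2)[OF L_dom[OF D(6)] \<omega>]) auto
  then show ?thesis using D(5)[of n] True by (simp add: slack_def switch_cost_at_def)
next
  case False
  note D = optimal_ruleD[OF opt \<omega>]
  have "\<tau> (Suc n) \<omega> = T" using False D(7)[of "Suc n"] by auto
  then show ?thesis using Y_T[OF D(6) \<omega>] by (simp add: slack_def switch_cost_at_def)
qed

text \<open>If infinitely many switches happened before \<open>T\<close>, some simple loop of modes would be followed
  infinitely often; letting the switching times converge, the switching costs along that loop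
  would add up to zero at the limit time.\<close>
lemma optimal_rule_reaches_T:
  assumes opt: "optimal_rule \<tau> \<xi>" and \<omega>: "\<omega> \<in> space M"
  shows "\<exists>n. \<tau> n \<omega> = T"
proof (rule ccontr)
  assume "\<not> (\<exists>n. \<tau> n \<omega> = T)"
  note D = optimal_ruleD[OF opt \<omega>]
  have lt: "\<tau> n \<omega> < T" for n using D(7)[of n] \<open>\<not> (\<exists>n. \<tau> n \<omega> = T)\<close> by (auto simp: order.order_iff_strict)
  have inc: "incseq (\<lambda>n. \<tau> n \<omega>)" by (rule incseq_SucI) (rule D(8))
  have "bdd_above (range (\<lambda>n. \<tau> n \<omega>))" using lt by (intro bdd_aboveI2[where M=T]) (simp add: less_imp_le)
  from LIMSEQ_incseq_SUP[OF this inc] obtain t where t: "(\<lambda>n. \<tau> n \<omega>) \<longlonglongrightarrow> t" by blast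
  have tT: "t \<in> {0..T}" using closed_sequentially[OF closed_atLeastAtMost _ t] D(7) by blast
  obtain l where l: "set l \<subseteq> {1..m}" "distinct l" "2 \<le> length l"
    and freq: "\<exists>\<^sub>F n in sequentially. \<forall>j<length l. \<xi> (n + j) \<omega> = l ! j \<and> \<xi> (n + Suc j) \<omega> = l ! (Suc j mod length l)"
    by (rule recurrent_simple_loop[of "\<lambda>n. \<xi> n \<omega>" m]) (use D(4,6) in auto)
  let ?n = "\<lambda>j. Suc j mod length l"
  have l_in: "l ! j \<in> {1..m}" if "j < length l" for j using l(1) that nth_mem by blast
  have l_in': "l ! ?n j \<in> {1..m}" for j using l(3) by (intro l_in) (auto intro: mod_less_divisor)
  \<comment> \<open>The slack of the j-th switch of the loop as a function of time. It vanishes at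
    \<open>\<tau> (n + Suc j) \<omega>\<close> whenever a traversal of the loop starts at index
    n.\<close>
  define h where "h j s = Y (l ! j) s \<omega> - Y (l ! ?n j) s \<omega> + g (l ! j) (l ! ?n j) s (X s \<omega>)" for j s
  have h_lim: "(\<lambda>n. h j (\<tau> (n + Suc j) \<omega>)) \<longlonglongrightarrow> h j t" if j: "j < length l" for j
  proof (rule continuous_on_tendsto_compose[of "{0..T}" "h j"])
    show "continuous_on {0..T} (h j)"
      unfolding h_def
      by (intro continuous_on_add continuous_on_diff dominated_processD(2)[OF Y_dom[OF l_in[OF j]] \<omega>]
          dominated_processD(2)[OF Y_dom[OF l_in'] \<omega>] dominated_processD(2)[OF g_dom[OF l_in[OF j] l_in'] \<omega>])
    show "(\<lambda>n. \<tau> (n + Suc j) \<omega>) \<longlonglongrightarrow> t" by (rule LIMSEQ_ignore_initial_segment[OF t])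
  qed (use D(7) tT in \<open>auto simp del: atLeastAtMost_iff\<close>)
  have lim: "(\<lambda>n. \<Sum>j<length l. h j (\<tau> (n + Suc j) \<omega>)) \<longlonglongrightarrow> (\<Sum>j<length l. h j t)"
    by (intro tendsto_sum h_lim) simp
  have freq0: "\<exists>\<^sub>F n in sequentially. (\<Sum>j<length l. h j (\<tau> (n + Suc j) \<omega>)) = 0"
    using freq
  proof (rule frequently_mono[rotated], intro allI impI sum.neutral ballI)
    fix n j assume n: "\<forall>j<length l. \<xi> (n + j) \<omega> = l ! j \<and> \<xi> (n + Suc j) \<omega> = l ! ?n j" and "j \<in> {..<length l}"
    then have "\<xi> (n + j) \<omega> = l ! j" "\<xi> (Suc (n + j)) \<omega> = l ! ?n j" by auto
    then show "h j (\<tau> (n + Suc j) \<omega>) = 0"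
      using optimal_rule_slack[OF opt \<omega>, of "n + j"] lt[of "Suc (n + j)"] by (simp add: h_def slack_def switch_cost_at_def)
  qed
  have zero: "(\<Sum>j<length l. h j t) = 0"
  \<comment> \<open>A nonzero limit would make the sums eventually nonzero, whereas they vanish for
    infinitely many n.\<close>
  proof (rule ccontr)
    assume "(\<Sum>j<length l. h j t) \<noteq> 0"
    from tendsto_imp_eventually_ne[OF lim this] freq0 show False
      by (simp add: frequently_def)
  qed
  have "(\<Sum>j<length l. Y (l ! ?n j) t \<omega>) = (\<Sum>j<length l. Y (l ! j) t \<omega>)"
    by (rule sum_cyclic_shift[of "length l" "\<lambda>j. Y (l ! j) t \<omega>"]) (use l(3) in linarith)
  then have "(\<Sum>j<length l. h j t) = (\<Sum>j<length l. g (l ! j) (l ! ?n j) t (X t \<omega>))"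
    unfolding h_def sum.distrib sum_subtractf by simp
  then show False using g_loop[OF l tT \<omega>] zero by simp
qed

lemma optimal_rule_admissible:
  assumes opt: "optimal_rule \<tau> \<xi>"
  shows "admissible M F T m \<tau> \<xi>"
  unfolding admissible_def
proof (intro conjI allI ballI)
  note st = optimal_rule_stops[OF opt]
  show "stopping_time F (\<tau> n)" for n using stopsD(1) st by blast
  show "\<xi> n \<in> measurable (pre_sigma (\<tau> n)) (count_space {1..m})" for n using st by blast
  have "{\<omega> \<in> space M. \<forall>n. \<tau> n \<omega> < T} = {}"
    using optimal_rule_reaches_T[OF opt] by force
  then show "emeasure M {\<omega> \<in> space M. \<forall>n. \<tau> n \<omega> < T} = 0" by (simp only: emeasure_empty)
  fix \<omega> assume \<omega>: "\<omega> \<in> space M"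
  note D = optimal_ruleD[OF opt \<omega>]
  show "\<tau> 0 \<omega> = 0" "\<xi> 0 \<omega> = 1" by (rule D)+
  fix n
  show "\<tau> n \<omega> \<le> \<tau> (Suc n) \<omega>" "0 \<le> \<tau> n \<omega>" "\<tau> n \<omega> \<le> T" using D(7,8)[of n] by auto
qed

text \<open>On the event that the k-th mode is i, the next switching time is the first meeting for
  the fixed mode i, so the martingale property of \<open>V i\<close> up to that meeting
  applies.\<close>

lemma optimal_rule_martingale:
  assumes opt: "optimal_rule \<tau> \<xi>" and i: "i \<in> {1..m}"
  shows "(\<integral>\<omega>. indicator (mode_set \<xi> k i) \<omega> * V i (\<tau> (Suc k) \<omega>) \<omega> \<partial>M)
    = (\<integral>\<omega>. indicator (mode_set \<xi> k i) \<omega> * V i (\<tau> k \<omega>) \<omega> \<partial>M)"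
proof -
  note st = optimal_rule_stops[OF opt, of k]
  have "mode_set \<xi> k i \<in> sets (pre_sigma (\<tau> k))"
    by (rule mode_set_sets[OF _ space_pre_sigma]) (use st in blast)
  then have "(\<integral>\<omega>. indicator (mode_set \<xi> k i) \<omega> * V i (first_meet T (Y i) (L i) (\<tau> k) \<omega>) \<omega> \<partial>M)
    = (\<integral>\<omega>. indicator (mode_set \<xi> k i) \<omega> * V i (\<tau> k \<omega>) \<omega> \<partial>M)"
    using st by (intro V_meet_martingale i) auto
  moreover have "(\<integral>\<omega>. indicator (mode_set \<xi> k i) \<omega> * V i (\<tau> (Suc k) \<omega>) \<omega> \<partial>M)
    = (\<integral>\<omega>. indicator (mode_set \<xi> k i) \<omega> * V i (first_meet T (Y i) (L i) (\<tau> k) \<omega>) \<omega> \<partial>M)"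
    using optimal_ruleD(3)[OF opt, of _ k]
    by (intro Bochner_Integration.integral_cong refl) (auto simp: mode_set_def indicator_def)
  ultimately show ?thesis by simp
qed

lemma switch_cost_at_measurable:
  assumes adm: "admissible M F T m \<tau> \<xi>"
  shows "switch_cost_at \<tau> \<xi> k \<in> borel_measurable M"
proof -
  note D = admissibleD[OF adm]
  \<comment> \<open>The random mode indices are resolved by events with fixed indices, on which only
    a fixed cost process is sampled.\<close>
  let ?f = "\<lambda>\<omega>. if \<tau> (Suc k) \<omega> < T then \<Sum>i\<in>{1..m}. \<Sum>j\<in>{1..m}.
    indicator (mode_set \<xi> k i) \<omega> * (indicator (mode_set \<xi> (Suc k) j) \<omega> * g i j (\<tau> (Suc k) \<omega>) (X (\<tau> (Suc k) \<omega>) \<omega>)) else 0"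
  have [measurable]: "mode_set \<xi> n i \<in> sets M" for n i
    by (rule pre_sigma_sets_M[OF D(1) mode_set_sets[OF D(2) space_pre_sigma]])
  note [measurable] = stops_measurable[OF D(1)]
  have [measurable]: "(\<lambda>\<omega>. g i j (\<tau> n \<omega>) (X (\<tau> n \<omega>) \<omega>)) \<in> borel_measurable M" if "i \<in> {1..m}" "j \<in> {1..m}" for i j n
    using progressive_stopped_M[OF dominated_processD(1)[OF g_dom[OF that]] D(1)[of n]] .
  have "?f \<in> borel_measurable M" by measurable
  also have "?this \<longleftrightarrow> switch_cost_at \<tau> \<xi> k \<in> borel_measurable M"
  proof (rule measurable_cong)
    fix \<omega> assume \<omega>: "\<omega> \<in> space M"
    let ?c = "\<lambda>i j. g i j (\<tau> (Suc k) \<omega>) (X (\<tau> (Suc k) \<omega>) \<omega>)"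
    have "(\<Sum>i\<in>{1..m}. \<Sum>j\<in>{1..m}. indicator (mode_set \<xi> k i) \<omega> * (indicator (mode_set \<xi> (Suc k) j) \<omega> * ?c i j))
      = (\<Sum>i\<in>{1..m}. if i = \<xi> k \<omega> then \<Sum>j\<in>{1..m}. if j = \<xi> (Suc k) \<omega> then ?c i j else 0 else 0)"
      using \<omega> by (intro sum.cong refl) (auto simp: mode_set_def indicator_def intro!: sum.cong)
    also have "\<dots> = ?c (\<xi> k \<omega>) (\<xi> (Suc k) \<omega>)"
      using D(7)[OF \<omega>, of k] D(7)[OF \<omega>, of "Suc k"] by (simp only: sum.delta finite_atLeastAtMost if_True)
    finally show "?f \<omega> = switch_cost_at \<tau> \<xi> k \<omega>" by (simp add: switch_cost_at_def)
  qed
  finally show ?thesis .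
qed

text \<open>All slacks vanish, so the payoff coincides almost everywhere with \<open>H\<close>,
  which is square integrable. The cost is the running profit minus the payoff, and both are
  dominated; its integrability therefore does not rely on the signs or the number of the individual
  costs.\<close>

theorem optimal_rule_value:
  assumes opt: "optimal_rule \<tau> \<xi>"
  shows "J M T X \<psi> g \<tau> \<xi> = ereal (\<integral>\<omega>. Y 1 0 \<omega> \<partial>M)" "integrable M (switching_cost T X g \<tau> \<xi>)"
proof -
  have adm: "admissible M F T m \<tau> \<xi>" by (rule optimal_rule_admissible[OF opt])
  show "J M T X \<psi> g \<tau> \<xi> = ereal (\<integral>\<omega>. Y 1 0 \<omega> \<partial>M)" "integrable M (switching_cost T X g \<tau> \<xi>)"
  proof (atomize (full), rule switching_value[OF adm])
    fix H assume H: "square_integrable M H"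
      and "(\<And>i k. i \<in> {1..m} \<Longrightarrow> (\<integral>\<omega>. indicator (mode_set \<xi> k i) \<omega> * V i (\<tau> (Suc k) \<omega>) \<omega> \<partial>M)
          = (\<integral>\<omega>. indicator (mode_set \<xi> k i) \<omega> * V i (\<tau> k \<omega>) \<omega> \<partial>M)) \<Longrightarrow> (\<integral>\<omega>. H \<omega> \<partial>M) = (\<integral>\<omega>. Y 1 0 \<omega> \<partial>M)"
      and dec: "AE \<omega> in M. \<exists>n. \<tau> n \<omega> = T \<and> switching_payoff T X \<psi> g \<tau> \<xi> \<omega> = H \<omega> - (\<Sum>k<n. slack \<tau> \<xi> k \<omega>)"
    then have EH: "(\<integral>\<omega>. H \<omega> \<partial>M) = (\<integral>\<omega>. Y 1 0 \<omega> \<partial>M)" using optimal_rule_martingale[OF opt] by blast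
    have payoff: "AE \<omega> in M. switching_payoff T X \<psi> g \<tau> \<xi> \<omega> = H \<omega>"
      using dec AE_space by eventually_elim (auto simp: optimal_rule_slack[OF opt])
    have "integrable M (switching_cost T X g \<tau> \<xi>)"
    proof (rule Bochner_Integration.integrable_bound)
      show "integrable M (\<lambda>\<omega>. (\<Sum>i\<in>{1..m}. UI i \<omega>) + \<bar>H \<omega>\<bar>)"
        by (intro square_integrable_integrable square_integrable_add square_integrable_sum square_integrable_abs H
            dominated_processD(3)[OF I_dom])
      show "switching_cost T X g \<tau> \<xi> \<in> borel_measurable M"
        unfolding switching_cost_def[abs_def] switch_cost_at_def[symmetric]
        by (intro borel_measurable_suminf switch_cost_at_measurable[OF adm])
      show "AE \<omega> in M. norm (switching_cost T X g \<tau> \<xi> \<omega>) \<le> norm ((\<Sum>i\<in>{1..m}. UI i \<omega>) + \<bar>H \<omega>\<bar>)"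
        using payoff AE_space
      proof eventually_elim
        case (elim \<omega>)
        obtain n where "\<tau> n \<omega> = T" using optimal_rule_reaches_T[OF opt elim(2)] by blast
        from running_integral_le[OF adm elim(2) this] elim(1) show ?case
          by (auto simp: switching_payoff_def)
      qed
    qed
    moreover have "J M T X \<psi> g \<tau> \<xi> = ereal (\<integral>\<omega>. Y 1 0 \<omega> \<partial>M)"
      unfolding J_def EH[symmetric] by (rule ext_expectation_eq[OF payoff square_integrable_integrable[OF H]])
    ultimately show "J M T X \<psi> g \<tau> \<xi> = ereal (\<integral>\<omega>. Y 1 0 \<omega> \<partial>M) \<and> integrable M (switching_cost T X g \<tau> \<xi>)"
      by blast
  qed
qed

section \<open>Measurable choice of the best mode and existence of an optimal rule\<close>

definition best_switch :: "nat \<Rightarrow> real \<Rightarrow> 'a \<Rightarrow> nat" where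
  "best_switch i t \<omega> = (LEAST k. k \<in> {1..m} - {i} \<and> - g i k t (X t \<omega>) + Y k t \<omega> = L i t \<omega>)"

lemma best_switch:
  "best_switch i t \<omega> \<in> {1..m} - {i}" (is ?a)
  "- g i (best_switch i t \<omega>) t (X t \<omega>) + Y (best_switch i t \<omega>) t \<omega> = L i t \<omega>" (is ?b)
proof -
  have "\<exists>k. k \<in> {1..m} - {i} \<and> - g i k t (X t \<omega>) + Y k t \<omega> = L i t \<omega>" using L_in[of i t \<omega>] by fastforce
  from LeastI_ex[OF this] show ?a ?b by (auto simp: best_switch_def)
qed

text \<open>Taking the least maximiser settles ties measurably. The random mode is replaced by each
  fixed mode on the event where it is active, so that only fixed processes are sampled at
  \<theta>.\<close>

lemma best_switch_measurable:
  assumes \<theta>: "\<theta> \<in> stops" and \<eta>: "\<eta> \<in> measurable (pre_sigma \<theta>) (count_space {1..m})"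
  shows "(\<lambda>\<omega>. best_switch (\<eta> \<omega>) (\<theta> \<omega>) \<omega>) \<in> measurable (pre_sigma \<theta>) (count_space {1..m})"
proof -
  let ?P = "\<lambda>k \<omega>. \<exists>i\<in>{1..m}. \<omega> \<in> mode_set (\<lambda>_. \<eta>) 0 i \<and> k \<in> {1..m} - {i} \<and>
    - g i k (\<theta> \<omega>) (X (\<theta> \<omega>) \<omega>) + Y k (\<theta> \<omega>) \<omega> = L i (\<theta> \<omega>) \<omega>"
  have \<eta>_in: "\<eta> \<omega> \<in> {1..m}" if "\<omega> \<in> space M" for \<omega>
    using measurable_space[OF \<eta>] that by (simp add: space_pre_sigma)
  have [measurable]: "mode_set (\<lambda>_. \<eta>) 0 i \<in> sets (pre_sigma \<theta>)" for i
    by (rule mode_set_sets[OF _ space_pre_sigma]) (rule \<eta>)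
  have "Measurable.pred (pre_sigma \<theta>) (?P k)" for k
  proof (cases "k \<in> {1..m}")
    case True
    have P: "Measurable.pred (pre_sigma \<theta>) (\<lambda>\<omega>. \<omega> \<in> mode_set (\<lambda>_. \<eta>) 0 i \<and> k \<in> {1..m} - {i} \<and>
      - g i k (\<theta> \<omega>) (X (\<theta> \<omega>) \<omega>) + Y k (\<theta> \<omega>) \<omega> = L i (\<theta> \<omega>) \<omega>)" if i: "i \<in> {1..m}" for i
    proof -
      note [measurable] = progressive_stopped[OF dominated_processD(1)[OF g_dom[OF i True]] \<theta>]
        progressive_stopped[OF dominated_processD(1)[OF Y_dom[OF True]] \<theta>]
        progressive_stopped[OF dominated_processD(1)[OF L_dom[OF i]] \<theta>]
      show ?thesis by measurable
    qed
    show ?thesis by (intro measurable_pred_countable countable_finite finite_atLeastAtMost P)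
  next
    case False
    then have "?P k = (\<lambda>_. False)" by auto
    then show ?thesis by simp
  qed
  then have "(\<lambda>\<omega>. LEAST k. ?P k \<omega>) \<in> measurable (pre_sigma \<theta>) (count_space UNIV)"
    by (rule measurable_Least)
  also have "?this \<longleftrightarrow> (\<lambda>\<omega>. best_switch (\<eta> \<omega>) (\<theta> \<omega>) \<omega>) \<in> measurable (pre_sigma \<theta>) (count_space UNIV)"
  proof (rule measurable_cong)
    fix \<omega> assume "\<omega> \<in> space (pre_sigma \<theta>)"
    then have \<omega>: "\<omega> \<in> space M" by (simp add: space_pre_sigma)
    have "?P k \<omega> \<longleftrightarrow> k \<in> {1..m} - {\<eta> \<omega>} \<and> - g (\<eta> \<omega>) k (\<theta> \<omega>) (X (\<theta> \<omega>) \<omega>) + Y k (\<theta> \<omega>) \<omega> = L (\<eta> \<omega>) (\<theta> \<omega>) \<omega>" for k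
      using \<omega> \<eta>_in[OF \<omega>] by (auto simp: mode_set_def)
    then show "(LEAST k. ?P k \<omega>) = best_switch (\<eta> \<omega>) (\<theta> \<omega>) \<omega>" by (simp add: best_switch_def)
  qed
  finally have "(\<lambda>\<omega>. best_switch (\<eta> \<omega>) (\<theta> \<omega>) \<omega>) \<in> measurable (pre_sigma \<theta>) (count_space UNIV)" .
  then show ?thesis
    unfolding measurable_count_space_eq2_countable using best_switch(1) by blast
qed

primrec opt_state :: "nat \<Rightarrow> 'a \<Rightarrow> real \<times> nat" where
  "opt_state 0 \<omega> = (0, 1)"
| "opt_state (Suc n) \<omega> = (let t = first_meet T (Y (snd (opt_state n \<omega>))) (L (snd (opt_state n \<omega>))) (\<lambda>_. fst (opt_state n \<omega>)) \<omega>
     in (t, best_switch (snd (opt_state n \<omega>)) t \<omega>))"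

text \<open>Needed for the value formula: a statement about all strategies obeying the rule yields
  the lower bound on the supremum only if there is one.\<close>

lemma optimal_rule_exists: "optimal_rule (\<lambda>n \<omega>. fst (opt_state n \<omega>)) (\<lambda>n \<omega>. snd (opt_state n \<omega>))"
proof -
  let ?\<tau> = "\<lambda>n \<omega>. fst (opt_state n \<omega>)" and ?\<xi> = "\<lambda>n \<omega>. snd (opt_state n \<omega>)"
  have step: "?\<tau> (Suc n) \<omega> = first_meet T (Y (?\<xi> n \<omega>)) (L (?\<xi> n \<omega>)) (?\<tau> n) \<omega>" for n \<omega>
    by (simp add: Let_def first_meet_def)
  have sw: "?\<xi> (Suc n) \<omega> = best_switch (?\<xi> n \<omega>) (?\<tau> (Suc n) \<omega>) \<omega>" for n \<omega>
    by (simp add: Let_def)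
  have st: "?\<tau> n \<in> stops \<and> ?\<xi> n \<in> measurable (pre_sigma (?\<tau> n)) (count_space {1..m})" for n
  proof (induction n)
    case 0
    then show ?case using stops_const[of 0] T_pos m_ge by auto
  next
    case (Suc n)
    have s: "?\<tau> (Suc n) \<in> stops" by (intro meet_select_stops[OF conjunct1[OF Suc] conjunct2[OF Suc] step])
    have le: "?\<tau> n \<omega> \<le> ?\<tau> (Suc n) \<omega>" if "\<omega> \<in> space M" for \<omega>
      unfolding step by (rule first_meet_ge) (use stopsD(3) Suc that in blast)
    have "sets (pre_sigma (?\<tau> n)) \<subseteq> sets (pre_sigma (?\<tau> (Suc n)))"
      by (rule mono_pre_sigma[OF stopsD(1)[OF conjunct1[OF Suc]] stopsD(1)[OF s] le])
    then have "?\<xi> n \<in> measurable (pre_sigma (?\<tau> (Suc n))) (count_space {1..m})"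
      using Suc unfolding measurable_def space_pre_sigma by blast
    from best_switch_measurable[OF s this] s show ?case unfolding sw by blast
  qed
  show ?thesis
    unfolding optimal_rule_def
  proof (intro conjI allI ballI)
    show "?\<xi> (Suc n) \<in> measurable (pre_sigma (?\<tau> (Suc n))) (count_space {1..m})" for n using st by blast
    fix n \<omega>
    show "?\<tau> (Suc n) \<omega> = first_meet T (Y (?\<xi> n \<omega>)) (L (?\<xi> n \<omega>)) (?\<tau> n) \<omega>" by (rule step)
    show "?\<xi> (Suc n) \<omega> \<in> {1..m} - {?\<xi> n \<omega>}" unfolding sw by (rule best_switch)
    show "- g (?\<xi> n \<omega>) (?\<xi> (Suc n) \<omega>) (?\<tau> (Suc n) \<omega>) (X (?\<tau> (Suc n) \<omega>) \<omega>) + Y (?\<xi> (Suc n) \<omega>) (?\<tau> (Suc n) \<omega>) \<omega>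
          = L (?\<xi> n \<omega>) (?\<tau> (Suc n) \<omega>) \<omega>" unfolding sw by (rule best_switch)
  qed simp_all
qed

theorem switching_verification:
  shows "AE \<omega> in M. ereal (Y 1 0 \<omega>) = (SUP s\<in>strategies M F T m. J M T X \<psi> g (fst s) (snd s))"
    and "optimal_rule \<tau> \<xi> \<Longrightarrow> (\<tau>, \<xi>) \<in> strategies M F T m
      \<and> (AE \<omega> in M. J M T X \<psi> g \<tau> \<xi> = ereal (Y 1 0 \<omega>))
      \<and> (\<forall>s\<in>strategies M F T m. J M T X \<psi> g (fst s) (snd s) \<le> J M T X \<psi> g \<tau> \<xi>)
      \<and> integrable M (switching_cost T X g \<tau> \<xi>)"
proof -
  have upper: "J M T X \<psi> g (fst s) (snd s) \<le> ereal (\<integral>\<omega>. Y 1 0 \<omega> \<partial>M)" if "s \<in> strategies M F T m" for s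
    using that switching_upper_bound by (auto simp: strategies_def)
  have strat: "(\<tau>, \<xi>) \<in> strategies M F T m" if "optimal_rule \<tau> \<xi>" for \<tau> \<xi>
    using optimal_rule_admissible[OF that] by (simp add: strategies_def)
  have "(SUP s\<in>strategies M F T m. J M T X \<psi> g (fst s) (snd s)) = ereal (\<integral>\<omega>. Y 1 0 \<omega> \<partial>M)"
  proof (rule antisym)
    show "(SUP s\<in>strategies M F T m. J M T X \<psi> g (fst s) (snd s)) \<le> ereal (\<integral>\<omega>. Y 1 0 \<omega> \<partial>M)"
      by (rule SUP_least[OF upper])
    show "ereal (\<integral>\<omega>. Y 1 0 \<omega> \<partial>M) \<le> (SUP s\<in>strategies M F T m. J M T X \<psi> g (fst s) (snd s))"
      using SUP_upper[OF strat[OF optimal_rule_exists], of "\<lambda>s. J M T X \<psi> g (fst s) (snd s)"]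
        optimal_rule_value(1)[OF optimal_rule_exists] by simp
  qed
  then show "AE \<omega> in M. ereal (Y 1 0 \<omega>) = (SUP s\<in>strategies M F T m. J M T X \<psi> g (fst s) (snd s))"
    using Y_0_const by (auto elim: eventually_mono)
  show "(\<tau>, \<xi>) \<in> strategies M F T m
      \<and> (AE \<omega> in M. J M T X \<psi> g \<tau> \<xi> = ereal (Y 1 0 \<omega>))
      \<and> (\<forall>s\<in>strategies M F T m. J M T X \<psi> g (fst s) (snd s) \<le> J M T X \<psi> g \<tau> \<xi>)
      \<and> integrable M (switching_cost T X g \<tau> \<xi>)" if opt: "optimal_rule \<tau> \<xi>"
    using strat[OF opt] optimal_rule_value[OF opt] upper Y_0_const by (auto elim: eventually_mono)
qed

end

section \<open>The Brownian filtration and the main theorem\<close>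

text \<open>Cauchy-Schwarz, obtained by integrating the square of |f| - c, where c is the mean of
  |f| over [0, T].\<close>

lemma integral_abs_squared_le:
  fixes f :: "real \<Rightarrow> real"
  assumes "0 < T" and f: "continuous_on {0..T} f"
  shows "(integral {0..T} (\<lambda>s. \<bar>f s\<bar>))\<^sup>2 \<le> T * integral {0..T} (\<lambda>s. (f s)\<^sup>2)"
proof -
  define a where "a = integral {0..T} (\<lambda>s. \<bar>f s\<bar>)"
  define c where "c = a / T"
  have i: "(\<lambda>s. \<bar>f s\<bar>) integrable_on {0..T}" "(\<lambda>s. (f s)\<^sup>2) integrable_on {0..T}" "(\<lambda>s. c\<^sup>2) integrable_on {0..T}"
    by (intro integrable_continuous_real continuous_intros f)+
  have "0 \<le> integral {0..T} (\<lambda>s. (\<bar>f s\<bar> - c)\<^sup>2)"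
    by (intro integral_nonneg integrable_continuous_real continuous_intros f) simp
  also have "(\<lambda>s. (\<bar>f s\<bar> - c)\<^sup>2) = (\<lambda>s. (f s)\<^sup>2 - 2 * c * \<bar>f s\<bar> + c\<^sup>2)"
    by (auto simp: power2_diff fun_eq_iff)
  also have "integral {0..T} \<dots> = integral {0..T} (\<lambda>s. (f s)\<^sup>2) - 2 * c * a + T * c\<^sup>2"
  proof -
    have j: "(\<lambda>s. 2 * c * \<bar>f s\<bar>) integrable_on {0..T}"
      by (intro integrable_continuous_real continuous_intros f)
    have "integral {0..T} (\<lambda>s. (f s)\<^sup>2 - 2 * c * \<bar>f s\<bar> + c\<^sup>2)
      = integral {0..T} (\<lambda>s. (f s)\<^sup>2 - 2 * c * \<bar>f s\<bar>) + integral {0..T} (\<lambda>s. c\<^sup>2)"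
      by (rule Henstock_Kurzweil_Integration.integral_add[OF integrable_diff[OF i(2) j] i(3)])
    also have "integral {0..T} (\<lambda>s. (f s)\<^sup>2 - 2 * c * \<bar>f s\<bar>) = integral {0..T} (\<lambda>s. (f s)\<^sup>2) - integral {0..T} (\<lambda>s. 2 * c * \<bar>f s\<bar>)"
      by (rule Henstock_Kurzweil_Integration.integral_diff[OF i(2) j])
    finally show ?thesis using \<open>0 < T\<close> by (simp add: a_def)
  qed
  finally have "0 \<le> integral {0..T} (\<lambda>s. (f s)\<^sup>2) - 2 * c * a + T * c\<^sup>2" .
  then show ?thesis using \<open>0 < T\<close>
    unfolding c_def a_def[symmetric] by (simp add: field_simps power2_eq_square)
qed

section \<open>Dominated processes from the spaces S2 and M2\<close>

context filtered_prob_space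
begin

lemma S2_dominated_process:
  assumes "S2 M F T w"
  shows "dominated_process w (\<lambda>\<omega>. SUP t\<in>{0..T}. \<bar>w t \<omega>\<bar>)"
proof -
  define U where "U \<omega> = (SUP t\<in>{0..T}. \<bar>w t \<omega>\<bar>)" for \<omega>
  have cont: "continuous_on {0..T} (\<lambda>t. w t \<omega>)" if "\<omega> \<in> space M" for \<omega>
    using assms that by (simp add: S2_def)
  have U_sq: "integrable M (\<lambda>\<omega>. (U \<omega>)\<^sup>2)" using assms by (simp add: S2_def U_def)
  have bound: "\<bar>w t \<omega>\<bar> \<le> U \<omega>" if "\<omega> \<in> space M" "t \<in> {0..T}" for \<omega> t
  proof -
    have "compact ((\<lambda>t. \<bar>w t \<omega>\<bar>) ` {0..T})"
      by (intro compact_continuous_image continuous_intros cont that) simp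
    then have "bdd_above ((\<lambda>t. \<bar>w t \<omega>\<bar>) ` {0..T})"
      by (intro bounded_imp_bdd_above compact_imp_bounded)
    then show ?thesis unfolding U_def by (rule cSUP_upper[OF that(2)])
  qed
  \<comment> \<open>Only the square of the supremum is given as integrable; measurability of the
    supremum itself is recovered by a square root, as it is nonnegative.\<close>
  have "U \<in> borel_measurable M \<longleftrightarrow> (\<lambda>\<omega>. sqrt ((U \<omega>)\<^sup>2)) \<in> borel_measurable M"
  proof (rule measurable_cong)
    fix \<omega> assume "\<omega> \<in> space M"
    then have "0 \<le> U \<omega>" using bound[of \<omega> 0] T_pos by auto
    then show "U \<omega> = sqrt ((U \<omega>)\<^sup>2)" by simp
  qed
  moreover have "(\<lambda>\<omega>. sqrt ((U \<omega>)\<^sup>2)) \<in> borel_measurable M"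
    using borel_measurable_integrable[OF U_sq] by measurable
  ultimately have "square_integrable M U" using U_sq by (simp add: square_integrable_def)
  then show ?thesis
    using assms bound unfolding dominated_process_def U_def[symmetric] by (simp add: S2_def)
qed

text \<open>The dominating variable is the integral of the absolute value over [0, T]: by
  Cauchy-Schwarz the M2 bound makes it square integrable, and unlike the supremum of the primitive
  it also bounds profits collected on pieces of [0, T].\<close>

lemma M2_integral_dominated_process:
  assumes M2: "M2 M F T f" and cont: "\<And>\<omega>. \<omega> \<in> space M \<Longrightarrow> continuous_on {0..T} (\<lambda>t. f t \<omega>)"
  shows "dominated_process (\<lambda>t \<omega>. integral {0..t} (\<lambda>s. f s \<omega>)) (\<lambda>\<omega>. integral {0..T} (\<lambda>s. \<bar>f s \<omega>\<bar>))"
proof -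
  have prog: "progressive F T f" using M2 by (simp add: M2_def)
  have absprog: "progressive F T (\<lambda>t \<omega>. \<bar>f t \<omega>\<bar>)"
    using prog unfolding progressive_def split_beta' by auto
  have abscont: "continuous_on {0..T} (\<lambda>t. \<bar>f t \<omega>\<bar>)" if "\<omega> \<in> space M" for \<omega>
    by (intro continuous_intros cont that)
  have "(\<lambda>\<omega>. integral {0..T} (\<lambda>s. \<bar>f s \<omega>\<bar>)) \<in> borel_measurable (F T)"
    using progressive_adapted[OF progressive_integral[OF absprog abscont], of T] T_pos by simp
  then have meas: "(\<lambda>\<omega>. integral {0..T} (\<lambda>s. \<bar>f s \<omega>\<bar>)) \<in> borel_measurable M"
    by (rule measurable_from_subalg[OF subalgebra_filt])
  have "integrable M (\<lambda>\<omega>. (integral {0..T} (\<lambda>s. \<bar>f s \<omega>\<bar>))\<^sup>2)"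
  proof (rule integrableI_nonneg)
    show "(\<lambda>\<omega>. (integral {0..T} (\<lambda>s. \<bar>f s \<omega>\<bar>))\<^sup>2) \<in> borel_measurable M" using meas by measurable
    have "(\<integral>\<^sup>+\<omega>. ennreal ((integral {0..T} (\<lambda>s. \<bar>f s \<omega>\<bar>))\<^sup>2) \<partial>M)
      \<le> (\<integral>\<^sup>+\<omega>. ennreal T * (\<integral>\<^sup>+s\<in>{0..T}. ennreal ((f s \<omega>)\<^sup>2) \<partial>lborel) \<partial>M)"
    proof (rule nn_integral_mono)
      fix \<omega> assume \<omega>: "\<omega> \<in> space M"
      have c: "continuous_on {0..T} (\<lambda>s. (f s \<omega>)\<^sup>2)" by (intro continuous_intros cont \<omega>)
      have int: "set_integrable lborel {0..T} (\<lambda>s. (f s \<omega>)\<^sup>2)" by (rule borel_integrable_atLeastAtMost'[OF c])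
      have "(\<integral>\<^sup>+s\<in>{0..T}. ennreal ((f s \<omega>)\<^sup>2) \<partial>lborel) = (\<integral>\<^sup>+s. ennreal (indicator {0..T} s *\<^sub>R (f s \<omega>)\<^sup>2) \<partial>lborel)"
        by (intro nn_integral_cong) (auto simp: indicator_def)
      also have "\<dots> = ennreal (LINT s:{0..T}|lborel. (f s \<omega>)\<^sup>2)"
        unfolding set_lebesgue_integral_def using int[unfolded set_integrable_def]
        by (intro nn_integral_eq_integral) auto
      also have "(LINT s:{0..T}|lborel. (f s \<omega>)\<^sup>2) = integral {0..T} (\<lambda>s. (f s \<omega>)\<^sup>2)"
        by (rule set_borel_integral_eq_integral(2)[OF int])
      finally have eq: "(\<integral>\<^sup>+s\<in>{0..T}. ennreal ((f s \<omega>)\<^sup>2) \<partial>lborel) = ennreal (integral {0..T} (\<lambda>s. (f s \<omega>)\<^sup>2))" .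
      show "ennreal ((integral {0..T} (\<lambda>s. \<bar>f s \<omega>\<bar>))\<^sup>2) \<le> ennreal T * (\<integral>\<^sup>+s\<in>{0..T}. ennreal ((f s \<omega>)\<^sup>2) \<partial>lborel)"
        unfolding eq using integral_abs_squared_le[OF T_pos cont[OF \<omega>]] T_pos
        by (subst ennreal_mult'[symmetric]) (auto intro!: ennreal_leI)
    qed
    also have "\<dots> = ennreal T * (\<integral>\<^sup>+\<omega>. (\<integral>\<^sup>+s\<in>{0..T}. ennreal ((f s \<omega>)\<^sup>2) \<partial>lborel) \<partial>M)"
    proof (rule nn_integral_cmult)
      \<comment> \<open>Time is clamped because joint measurability of \<open>f\<close> is known
        only on [0, T]; the indicator in the integral hides the change.\<close>
      have "(\<lambda>p. (max 0 (min (snd p) T), fst p)) \<in> (F T \<Otimes>\<^sub>M lborel) \<rightarrow>\<^sub>M (restrict_space borel {0..T} \<Otimes>\<^sub>M F T)"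
        using T_pos by (intro measurable_Pair measurable_restrict_space2) auto
      from measurable_compose[OF this, of "\<lambda>(s,\<omega>). f s \<omega>" borel]
      have [measurable]: "(\<lambda>p. f (max 0 (min (snd p) T)) (fst p)) \<in> borel_measurable (F T \<Otimes>\<^sub>M lborel)"
        using prog T_pos by (simp add: progressive_def)
      have "(\<lambda>\<omega>. \<integral>\<^sup>+s. ennreal ((f (max 0 (min s T)) \<omega>)\<^sup>2) * indicator {0..T} s \<partial>lborel) \<in> borel_measurable (F T)"
        by (rule lborel.borel_measurable_nn_integral) (simp add: split_beta')
      also have "(\<lambda>\<omega>. \<integral>\<^sup>+s. ennreal ((f (max 0 (min s T)) \<omega>)\<^sup>2) * indicator {0..T} s \<partial>lborel)
        = (\<lambda>\<omega>. \<integral>\<^sup>+s\<in>{0..T}. ennreal ((f s \<omega>)\<^sup>2) \<partial>lborel)"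
        by (intro ext nn_integral_cong) (auto simp: indicator_def)
      finally show "(\<lambda>\<omega>. \<integral>\<^sup>+s\<in>{0..T}. ennreal ((f s \<omega>)\<^sup>2) \<partial>lborel) \<in> borel_measurable M"
        by (rule measurable_from_subalg[OF subalgebra_filt])
    qed
    also have "\<dots> < \<infinity>" using M2 by (simp add: M2_def ennreal_mult_less_top)
    finally show "(\<integral>\<^sup>+\<omega>. ennreal ((integral {0..T} (\<lambda>s. \<bar>f s \<omega>\<bar>))\<^sup>2) \<partial>M) < \<infinity>" .
  qed simp
  then have sq: "square_integrable M (\<lambda>\<omega>. integral {0..T} (\<lambda>s. \<bar>f s \<omega>\<bar>))"
    using meas by (simp add: square_integrable_def)
  have bound: "\<bar>integral {0..t} (\<lambda>s. f s \<omega>)\<bar> \<le> integral {0..T} (\<lambda>s. \<bar>f s \<omega>\<bar>)" if "\<omega> \<in> space M" "t \<in> {0..T}" for \<omega> t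
  proof -
    have sub: "{0..t} \<subseteq> {0..T}" using that(2) by auto
    have i: "(\<lambda>s. f s \<omega>) integrable_on {0..t}" "(\<lambda>s. \<bar>f s \<omega>\<bar>) integrable_on {0..t}" "(\<lambda>s. \<bar>f s \<omega>\<bar>) integrable_on {0..T}"
      by (intro integrable_continuous_real continuous_on_subset[OF cont[OF that(1)] sub]
          continuous_on_subset[OF abscont[OF that(1)] sub] abscont[OF that(1)])+
    have "norm (integral {0..t} (\<lambda>s. f s \<omega>)) \<le> integral {0..t} (\<lambda>s. \<bar>f s \<omega>\<bar>)"
      by (rule integral_norm_bound_integral[OF i(1,2)]) simp
    also have "\<dots> \<le> integral {0..T} (\<lambda>s. \<bar>f s \<omega>\<bar>)"
      by (rule integral_subset_le[OF sub i(2,3)]) simp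
    finally show ?thesis by simp
  qed
  have "continuous_on {0..T} (\<lambda>t. integral {0..t} (\<lambda>s. f s \<omega>))" if "\<omega> \<in> space M" for \<omega>
    by (intro indefinite_integral_continuous_1 integrable_continuous_real cont that)
  then show ?thesis
    unfolding dominated_process_def using progressive_integral[OF prog cont] sq bound by blast
qed

end

section \<open>The completed Brownian filtration and its triviality at time zero\<close>

definition filtration_generators :: "'a measure \<Rightarrow> real \<Rightarrow> (real \<Rightarrow> 'a \<Rightarrow> real^'d) \<Rightarrow> real \<Rightarrow> 'a set set" where
  "filtration_generators M T B t =
     (\<Union>s\<in>{0..min t T}. {B s -` A \<inter> space M | A. A \<in> sets borel}) \<union> null_sets M"

lemma filtration_generators_sets:
  assumes "brownian_motion M T B"
  shows "filtration_generators M T B t \<subseteq> sets M"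
proof -
  have "B s \<in> borel_measurable M" if "s \<in> {0..min t T}" for s
    using assms that by (auto simp: brownian_motion_def)
  then show ?thesis by (auto simp: filtration_generators_def intro: measurable_sets)
qed

lemma filtration_generators_Pow:
  assumes "brownian_motion M T B"
  shows "filtration_generators M T B t \<subseteq> Pow (space M)"
  using filtration_generators_sets[OF assms] sets.space_closed[of M] by (rule subset_trans)

lemma sets_brownian_filtration:
  assumes "brownian_motion M T B"
  shows "sets (brownian_filtration M T B t) = sigma_sets (space M) (filtration_generators M T B t)"
  unfolding brownian_filtration_def filtration_generators_def[symmetric]
  by (rule sets_measure_of[OF filtration_generators_Pow[OF assms]])

lemma brownian_filtration_filtered_prob_space:
  assumes "0 < T" "brownian_motion M T B"
  shows "filtered_prob_space M (brownian_filtration M T B) T"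
proof -
  interpret prob_space M using assms by (simp add: brownian_motion_def)
  show ?thesis
  proof unfold_locales
    show "0 < T" by fact
    show "space (brownian_filtration M T B t) = space M" for t
      unfolding brownian_filtration_def filtration_generators_def[symmetric]
      by (rule space_measure_of[OF filtration_generators_Pow[OF assms(2)]])
    show "sets (brownian_filtration M T B t) \<subseteq> sets M" for t
      unfolding sets_brownian_filtration[OF assms(2)]
      by (rule sets.sigma_sets_subset[OF filtration_generators_sets[OF assms(2)]])
    show "sets (brownian_filtration M T B s) \<subseteq> sets (brownian_filtration M T B t)" if "s \<le> t" for s t
      unfolding sets_brownian_filtration[OF assms(2)] filtration_generators_def
      by (intro sigma_sets_subseteq Un_mono UN_mono) (use that in auto)
  qed
qed

text \<open>Since the Brownian motion starts at 0 everywhere, its events at time zero are empty or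
  the whole space, and the remaining generators are null sets. Events of probability 0 or 1 are
  closed under complements and countable unions, so the property spreads from the generators. This
  concerns time zero only, not the germ after it.\<close>

lemma brownian_filtration_0_trivial:
  assumes T: "0 < T" and BM: "brownian_motion M T B" and A: "A \<in> sets (brownian_filtration M T B 0)"
  shows "measure M A = 0 \<or> measure M A = 1"
proof -
  interpret prob_space M using BM by (simp add: brownian_motion_def)
  have "A \<in> sigma_sets (space M) (filtration_generators M T B 0)"
    using A sets_brownian_filtration[OF BM] by blast
  then have "A \<in> sets M \<and> (prob A = 0 \<or> prob A = 1)"
  proof (induction rule: sigma_sets.induct)
    case (Basic a)
    then have aM: "a \<in> sets M" using filtration_generators_sets[OF BM] by blast
    show ?case
    proof (cases "a \<in> null_sets M")
      case True
      then show ?thesis using aM by (auto simp: measure_def)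
    next
      case False
      then obtain C where "a = B 0 -` C \<inter> space M"
        using Basic T by (auto simp: filtration_generators_def)
      moreover have "B 0 \<omega> = 0" if "\<omega> \<in> space M" for \<omega> using BM that by (simp add: brownian_motion_def)
      ultimately have "a = (if 0 \<in> C then space M else {})" by auto
      then show ?thesis using aM by (simp add: prob_space split: if_splits)
    qed
  next
    case (Compl a)
    then show ?case using prob_compl[of a] by auto
  next
    case (Union a)
    then have aM: "a i \<in> sets M" for i by blast
    then have UM: "(\<Union>i. a i) \<in> sets M" by blast
    show ?case
    proof (cases "\<exists>i. prob (a i) = 1")
      case True
      then obtain i where "prob (a i) = 1" by blast
      moreover have "prob (a i) \<le> prob (\<Union>i. a i)" by (rule finite_measure_mono[OF _ UM]) blast
      ultimately have "prob (\<Union>i. a i) = 1" by (intro antisym prob_le_1) simp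
      then show ?thesis using UM by blast
    next
      case False
      then have "a i \<in> null_sets M" for i
        using Union(2) aM by (auto simp: null_sets_def emeasure_eq_measure)
      then have "(\<Union>i. a i) \<in> null_sets M" by blast
      then show ?thesis using UM by (simp add: null_sets_def measure_def)
    qed
  qed simp
  then show ?thesis by blast
qed

theorem theorem3p1:
  fixes M :: "'a measure" and T :: real and m :: nat
    and B :: "real \<Rightarrow> 'a \<Rightarrow> real^'d" and F :: "real \<Rightarrow> 'a measure"
    and X :: "real \<Rightarrow> 'a \<Rightarrow> real^'k"
    and \<psi> :: "nat \<Rightarrow> real \<Rightarrow> real^'k \<Rightarrow> real"
    and g :: "nat \<Rightarrow> nat \<Rightarrow> real \<Rightarrow> real^'k \<Rightarrow> real"
    and Y :: "nat \<Rightarrow> real \<Rightarrow> 'a \<Rightarrow> real"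
  assumes T_pos: "T > 0"
    and BM: "brownian_motion M T B"
    and F_def: "F = brownian_filtration M T B"
    and X_cont: "\<forall>\<omega>\<in>space M. continuous_on {0..T} (\<lambda>t. X t \<omega>)"
    and X_prog: "progressive F T X"
    and m_ge: "m \<ge> 2"
    and psi_cont: "\<forall>i\<in>{1..m}. continuous_on ({0..T} \<times> UNIV) (\<lambda>(t, x). \<psi> i t x)"
    and g_cont: "\<forall>i\<in>{1..m}. \<forall>j\<in>{1..m}. continuous_on ({0..T} \<times> UNIV) (\<lambda>(t, x). g i j t x)"
    and growth: "\<exists>C \<gamma>. C > 0 \<and> \<gamma> > 0 \<and> (\<forall>i\<in>{1..m}. \<forall>j\<in>{1..m}. \<forall>t\<in>{0..T}. \<forall>x.
                   \<bar>\<psi> i t x\<bar> + \<bar>g i j t x\<bar> \<le> C * (1 + norm x powr \<gamma>))"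
    and psi_M2: "\<forall>i\<in>{1..m}. M2 M F T (\<lambda>t \<omega>. \<psi> i t (X t \<omega>))"
    and g_S2: "\<forall>i\<in>{1..m}. \<forall>j\<in>{1..m}. S2 M F T (\<lambda>t \<omega>. g i j t (X t \<omega>))"
    and g_diag: "\<forall>i\<in>{1..m}. \<forall>t\<in>{0..T}. \<forall>x. g i i t x = 0"
    and g_pair: "\<forall>i\<in>{1..m}. \<forall>j\<in>{1..m}. i \<noteq> j \<longrightarrow> (\<forall>t\<in>{0..T}. \<forall>x. g i j t x + g j i t x > 0)"
    and g_loop: "\<forall>l. set l \<subseteq> {1..m} \<and> distinct l \<and> length l \<ge> 2 \<longrightarrow>
                   (\<forall>t\<in>{0..T}. \<forall>x. (\<Sum>n<length l. g (l ! n) (l ! (Suc n mod length l)) t x) > 0)"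
    and g_terminal: "\<forall>i\<in>{1..m}. \<forall>j\<in>{1..m}. \<forall>\<omega>\<in>space M.
                   g i j T (X T \<omega>) \<le> 0 \<longrightarrow> g i j T (X T \<omega>) = 0"
    and g_neg_limited: "\<exists>K>0. \<forall>i\<in>{1..m}.
                   real (card {j\<in>{1..m} - {i}. \<exists>t\<in>{0..T}. \<exists>x. g i j t x < 0}) \<le> K"
    and Y_S2: "\<forall>i\<in>{1..m}. S2 M F T (Y i)"
    and Y_snell: "\<forall>i\<in>{1..m}. \<forall>t\<in>{0..T}. is_ess_sup M
        {real_cond_exp M (F t)
           (\<lambda>\<omega>. integral {t..\<theta> \<omega>} (\<lambda>s. \<psi> i s (X s \<omega>)) +
                 (if \<theta> \<omega> < T
                  then Max ((\<lambda>j. - g i j (\<theta> \<omega>) (X (\<theta> \<omega>) \<omega>) + Y j (\<theta> \<omega>) \<omega>) ` ({1..m} - {i}))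
                  else 0))
         | \<theta>. \<theta> \<in> stopping_times_from M F T (\<lambda>_. t)}
        (Y i t)"
    and Y_T: "\<forall>i\<in>{1..m}. \<forall>\<omega>\<in>space M. Y i T \<omega> = 0"
  shows "(AE \<omega> in M. ereal (Y 1 0 \<omega>) =
            (SUP s\<in>strategies M F T m. J M T X \<psi> g (fst s) (snd s)))
       \<and> (\<forall>\<tau>s \<xi>s.
           (\<forall>\<omega>\<in>space M. \<tau>s 0 \<omega> = 0 \<and> \<xi>s 0 \<omega> = 1) \<and>
           (\<forall>n. \<forall>\<omega>\<in>space M. \<tau>s (Suc n) \<omega> =
              (let S = {s\<in>{\<tau>s n \<omega>..T}. Y (\<xi>s n \<omega>) s \<omega> =
                    Max ((\<lambda>k. - g (\<xi>s n \<omega>) k s (X s \<omega>) + Y k s \<omega>) ` ({1..m} - {\<xi>s n \<omega>}))}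
               in if S = {} then T else min (Inf S) T)) \<and>
           (\<forall>n. \<xi>s (Suc n) \<in> measurable (filtration.pre_sigma (space M) F (\<tau>s (Suc n))) (count_space {1..m})) \<and>
           (\<forall>n. \<forall>\<omega>\<in>space M. \<xi>s (Suc n) \<omega> \<in> {1..m} - {\<xi>s n \<omega>} \<and>
              - g (\<xi>s n \<omega>) (\<xi>s (Suc n) \<omega>) (\<tau>s (Suc n) \<omega>) (X (\<tau>s (Suc n) \<omega>) \<omega>)
                + Y (\<xi>s (Suc n) \<omega>) (\<tau>s (Suc n) \<omega>) \<omega> =
              Max ((\<lambda>k. - g (\<xi>s n \<omega>) k (\<tau>s (Suc n) \<omega>) (X (\<tau>s (Suc n) \<omega>) \<omega>)
                          + Y k (\<tau>s (Suc n) \<omega>) \<omega>) ` ({1..m} - {\<xi>s n \<omega>})))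
           \<longrightarrow> (\<tau>s, \<xi>s) \<in> strategies M F T m
             \<and> (AE \<omega> in M. J M T X \<psi> g \<tau>s \<xi>s = ereal (Y 1 0 \<omega>))
             \<and> (\<forall>s\<in>strategies M F T m. J M T X \<psi> g (fst s) (snd s) \<le> J M T X \<psi> g \<tau>s \<xi>s)
             \<and> integrable M (switching_cost T X g \<tau>s \<xi>s))"
proof -
  have fps: "filtered_prob_space M F T"
    unfolding F_def by (rule brownian_filtration_filtered_prob_space[OF T_pos BM])
  interpret fp: filtered_prob_space M F T by (rule fps)
  let ?UI = "\<lambda>i \<omega>. integral {0..T} (\<lambda>s. \<bar>\<psi> i s (X s \<omega>)\<bar>)"
  let ?UY = "\<lambda>i \<omega>. SUP t\<in>{0..T}. \<bar>Y i t \<omega>\<bar>"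
  let ?Ug = "\<lambda>i j \<omega>. SUP t\<in>{0..T}. \<bar>g i j t (X t \<omega>)\<bar>"
  have psi_path: "continuous_on {0..T} (\<lambda>t. \<psi> i t (X t \<omega>))" if "i \<in> {1..m}" "\<omega> \<in> space M" for i \<omega>
  proof -
    have "continuous_on {0..T} (\<lambda>t. (t, X t \<omega>))"
      using X_cont that(2) by (intro continuous_on_Pair continuous_on_id) auto
    from continuous_on_compose2[OF psi_cont[rule_format, OF that(1)] this] show ?thesis by auto
  qed
  interpret switching M F T m X \<psi> g Y ?UI ?UY ?Ug
  proof unfold_locales
    show "2 \<le> m" by (rule m_ge)
    fix i :: nat assume i: "i \<in> {1..m}"
    show "fp.dominated_process (\<lambda>t \<omega>. integral {0..t} (\<lambda>s. \<psi> i s (X s \<omega>))) (?UI i)"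
      by (rule fp.M2_integral_dominated_process[OF psi_M2[rule_format, OF i] psi_path[OF i]])
    show "fp.dominated_process (Y i) (?UY i)"
      by (rule fp.S2_dominated_process[OF Y_S2[rule_format, OF i]])
    show "is_ess_sup M
        {real_cond_exp M (F t)
           (\<lambda>\<omega>. integral {t..\<theta> \<omega>} (\<lambda>s. \<psi> i s (X s \<omega>)) +
                 (if \<theta> \<omega> < T
                  then Max ((\<lambda>j. - g i j (\<theta> \<omega>) (X (\<theta> \<omega>) \<omega>) + Y j (\<theta> \<omega>) \<omega>) ` ({1..m} - {i}))
                  else 0))
         | \<theta>. \<theta> \<in> stopping_times_from M F T (\<lambda>_. t)}
        (Y i t)" if "t \<in> {0..T}" for t
      by (rule Y_snell[rule_format, OF i that])
    show "fp.dominated_process (\<lambda>t \<omega>. g i j t (X t \<omega>)) (?Ug i j)" if "j \<in> {1..m}" for j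
      by (rule fp.S2_dominated_process[OF g_S2[rule_format, OF i that]])
    fix \<omega> assume \<omega>: "\<omega> \<in> space M"
    show "continuous_on {0..T} (\<lambda>t. \<psi> i t (X t \<omega>))" by (rule psi_path[OF i \<omega>])
    show "?UI i \<omega> \<le> ?UI i \<omega>" by simp
    show "g i i t (X t \<omega>) = 0" if "t \<in> {0..T}" for t by (rule g_diag[rule_format, OF i that])
    \<comment> \<open>A cost that is nonpositive at T vanishes there, so terminal costs are
      nonnegative; this is what puts each obstacle at T below the terminal value 0.\<close>
    show "0 \<le> g i j T (X T \<omega>)" if "j \<in> {1..m}" for j
      using g_terminal[rule_format, OF i that \<omega>] by linarith
    show "Y i T \<omega> = 0" by (rule Y_T[rule_format, OF i \<omega>])
  next
    fix l :: "nat list" and t \<omega>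
    assume "set l \<subseteq> {1..m}" "distinct l" "2 \<le> length l" "t \<in> {0..T}" "\<omega> \<in> space M"
    then show "0 < (\<Sum>n<length l. g (l ! n) (l ! (Suc n mod length l)) t (X t \<omega>))"
      using g_loop by blast
  next
    fix A assume "A \<in> sets (F 0)"
    then show "measure M A = 0 \<or> measure M A = 1"
      unfolding F_def by (rule brownian_filtration_0_trivial[OF T_pos BM])
  qed
  show ?thesis
  proof (rule conjI[OF switching_verification(1)], intro allI impI, goal_cases)
    case (1 \<tau>s \<xi>s)
    then have "optimal_rule \<tau>s \<xi>s" unfolding optimal_rule_def first_meet_def L_def by blast
    from switching_verification(2)[OF this] show ?case .
  qed
qed

end
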